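(* Let $n\ge1$ and let $\Lambda^{(0,\bullet)}_q=\bigoplus_k\Lambda^{(0,k)}_q$ be the quantum exterior algebra associated to the tangent space $T^{(0,1)}$ of $\mathcal O_q(\mathrm{SU}_{n+1})$. For $k=1,\dots,|\Delta^+|$, a basis of $\Lambda^{(0,k)}_q$ is given by $$\{e_{\gamma_1}\wedge\cdots\wedge e_{\gamma_k}\mid\gamma_1<\cdots<\gamma_k\in\Delta^+\}.$$ In particular, $\dim\Lambda^{(0,k)}_q=\binom{|\Delta^+|}{k}$ and $\dim\Lambda^{(0,\bullet)}_q=2^{|\Delta^+|}$.
   Context: All algebras are over $\mathbb C$. Fix $q\in\mathbb R$, $q\ne-1,0,1$; $[a,b]_c:=ab-c\,ba$. $\Delta^+=\{\alpha_{ij}=\varepsilon_i-\varepsilon_j\mid1\le i<j\le n+1\}$ is the set of positive roots of $\mathfrak{sl}_{n+1}$, with the total (convex) order in which $\alpha_{ij}<\alpha_{kl}$ whenever $j>l$, or $j=l$ and $i>k$. $U_q(\mathfrak{sl}_{n+1})$ is the standard Drinfeld--Jimbo algebra with generators $E_i,F_i,K_i^{\pm1}$, $i=1,\dots,n$ ($K_iE_j=q^{a_{ij}}E_jK_i$, $K_iF_j=q^{-a_{ij}}F_jK_i$, $E_iF_j-F_jE_i=\delta_{ij}\frac{K_i-K_i^{-1}}{q-q^{-1}}$, $K_i$'s commuting and invertible, quantum Serre relations), and coproduct $\Delta(K_i)=K_i\otimes K_i$, $\Delta(E_i)=E_i\otimes K_i+1\otimes E_i$, $\Delta(F_i)=F_i\otimes1+K_i^{-1}\otimes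 F_i$. $A:=\mathcal O_q(\mathrm{SU}_{n+1})$ is the Hopf algebra of matrix coefficients of the finite-dimensional type-1 representations of $U_q(\mathfrak{sl}_{n+1})$. It is generated by $u_{ij}$, $i,j=1,\dots,n+1$, with $\Delta(u_{ij})=\sum_au_{ia}\otimes u_{aj}$, $\varepsilon(u_{ij})=\delta_{ij}$; the evaluation pairing satisfies $\langle E_i,u_{i+1,i}\rangle=1$, $\langle F_i,u_{i,i+1}\rangle=1$, $\langle K_j^{\pm1},u_{ii}\rangle=q^{\pm(\delta_{j+1,i}-\delta_{ij})}$, all other pairings of generators being zero. For $1\le i<j\le n+1$ put $E_{ji}:=[E_{j-1},[E_{j-2},[\cdots[E_{i+1},E_i]_{q^{-1}}\cdots]_{q^{-1}}]_{q^{-1}}$ (with $E_{i+1,i}=E_i$), and $T^{(0,1)}:=\mathrm{span}_{\mathbb C}\{E_{ji}\}$. Put $A^+=\ker\varepsilon$, $a^+:=a-\varepsilon(a)1$, $I:=\{x\in A^+\mid\langle X,x\rangle=0\ \forall X\in T^{(0,1)}\}$, and $\Lambda^{(0,1)}_q:=A^+/I$. The elements $e_{\alpha_{ij}}:=e_{ji}:=[u_{ji}]$, $i<j$, form the basis dual to $\{E_{ji}\}$. With $I^{(2)}:=\{[x_{(1)}^+]\otimes[x_{(2)}^+]\mid x\in I\}\subseteq\Lambda^{(0,1)}_q\otimes\Lambda^{(0,1)}_q$, the quantum exterior algebra is the $\mathbb Z_{\ge0}$-graded algebra $\Lambda^{(0,\bullet)}_q:=\mathcal T(\Lambda^{(0,1)}_q)/\langle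 I^{(2)}\rangle$, with multiplication $\wedge$. *)

theory Defs
  imports
    "Jordan_Normal_Form.VS_Connect"
    "HOL-Algebra.QuotRing"
    "HOL-Library.Poly_Mapping"
begin

section \<open>Free algebras, quotients and tensor algebras over the complex numbers\<close>

text \<open>
  Words form a monoid under concatenation, so that the convolution product of
  \<open>poly_mapping\<close> on finitely supported functions on words is the product of
  noncommutative polynomials.
\<close>

datatype 'x fword = FWord (letters: "'x list")

instantiation fword :: (type) monoid_add
begin

definition zero_fword :: "'a fword" where
  "0 = FWord []"

definition plus_fword :: "'a fword \<Rightarrow> 'a fword \<Rightarrow> 'a fword" where
  "u + v = FWord (letters u @ letters v)"

instance
  by standard (simp_all add: zero_fword_def plus_fword_def)

end

type_synonym 'x falg = "('x fword, complex) poly_mapping"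

definition fmon :: "'x list \<Rightarrow> 'x falg" where
  "fmon xs = Poly_Mapping.single (FWord xs) 1"

abbreviation fvar :: "'x \<Rightarrow> 'x falg" where
  "fvar x \<equiv> fmon [x]"

definition fconst :: "complex \<Rightarrow> 'x falg" where
  "fconst c = Poly_Mapping.single 0 c"

definition free_algebra :: "'x set \<Rightarrow> (complex, 'x falg) module" where
  "free_algebra X =
    \<lparr>carrier = {p. \<forall>w\<in>Poly_Mapping.keys p. set (letters w) \<subseteq> X},
     mult = (*), one = 1, zero = 0, add = (+), smult = (\<lambda>c p. fconst c * p)\<rparr>"

text \<open>
  Quotient of a vector space \<open>M\<close> by a subspace \<open>J\<close>. As for \<^const>\<open>module_vec\<close>, the
  multiplicative fields of the record carry no meaning.
\<close>

definition vs_quot :: "(complex, 'a) module \<Rightarrow> 'a set \<Rightarrow> (complex, 'a set) module" where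
  "vs_quot M J =
    \<lparr>carrier = a_rcosets\<^bsub>M\<^esub> J, mult = undefined, one = undefined,
     zero = J, add = set_add M,
     smult = (\<lambda>c S. \<Union>a\<in>S. J +>\<^bsub>M\<^esub> (c \<odot>\<^bsub>M\<^esub> a))\<rparr>"

text \<open>
  Quotient of an algebra by the two-sided ideal generated by \<open>S\<close>: the ring \<open>M Quot Idl S\<close> of
  the library together with the induced scalar multiplication.
\<close>

definition alg_quot :: "(complex, 'a) module \<Rightarrow> 'a set \<Rightarrow> (complex, 'a set) module" where
  "alg_quot M S =
    (let J = Idl\<^bsub>M\<^esub> S in
     (vs_quot M J)\<lparr>mult := mult (M Quot J), one := one (M Quot J)\<rparr>)"

definition alg_cls :: "(complex, 'a) module \<Rightarrow> 'a set \<Rightarrow> 'a \<Rightarrow> 'a set" where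
  "alg_cls M S a = (Idl\<^bsub>M\<^esub> S) +>\<^bsub>M\<^esub> a"

text \<open>
  The tensor algebra of \<open>V\<close> is the free algebra on the set \<open>V\<close> modulo linearity of the
  inclusion of \<open>V\<close>.
\<close>

definition tensor_relators :: "(complex, 'v) module \<Rightarrow> 'v falg set" where
  "tensor_relators V =
    {fvar (v \<oplus>\<^bsub>V\<^esub> w) - fvar v - fvar w | v w. v \<in> carrier V \<and> w \<in> carrier V} \<union>
    {fvar (c \<odot>\<^bsub>V\<^esub> v) - fconst c * fvar v | c v. v \<in> carrier V}"

definition tensor_algebra :: "(complex, 'v) module \<Rightarrow> (complex, 'v falg set) module" where
  "tensor_algebra V = alg_quot (free_algebra (carrier V)) (tensor_relators V)"

definition tensor_incl :: "(complex, 'v) module \<Rightarrow> 'v \<Rightarrow> 'v falg set" where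
  "tensor_incl V v = alg_cls (free_algebra (carrier V)) (tensor_relators V) (fvar v)"


section \<open>The quantized enveloping algebra\<close>

datatype uq_gen = GenE nat | GenF nat | GenK nat | GenKinv nat

definition uq_gens :: "nat \<Rightarrow> uq_gen set" where
  "uq_gens n = GenE ` {1..n} \<union> GenF ` {1..n} \<union> GenK ` {1..n} \<union> GenKinv ` {1..n}"

definition cartan :: "nat \<Rightarrow> nat \<Rightarrow> int" where
  "cartan i j = (if i = j then 2 else if i = j + 1 \<or> j = i + 1 then -1 else 0)"

definition serre :: "real \<Rightarrow> (nat \<Rightarrow> uq_gen) \<Rightarrow> nat \<Rightarrow> nat \<Rightarrow> uq_gen falg" where
  "serre q g i j =
    (let x = fvar (g i); y = fvar (g j) in
     if cartan i j = -1
     then x * x * y - fconst (of_real (q + 1 / q)) * x * y * x + y * x * x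
     else x * y - y * x)"

definition uq_relators :: "nat \<Rightarrow> real \<Rightarrow> uq_gen falg set" where
  "uq_relators n q =
    (let E = (\<lambda>i. fvar (GenE i)); F = (\<lambda>i. fvar (GenF i));
         K = (\<lambda>i. fvar (GenK i)); K' = (\<lambda>i. fvar (GenKinv i)) in
      {K i * K' i - 1 | i. i \<in> {1..n}} \<union>
      {K' i * K i - 1 | i. i \<in> {1..n}} \<union>
      {K i * K j - K j * K i | i j. i \<in> {1..n} \<and> j \<in> {1..n}} \<union>
      {K i * E j - fconst (of_real (q powi cartan i j)) * E j * K i | i j.
         i \<in> {1..n} \<and> j \<in> {1..n}} \<union>
      {K i * F j - fconst (of_real (q powi (- cartan i j))) * F j * K i | i j.
         i \<in> {1..n} \<and> j \<in> {1..n}} \<union>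
      {E i * F j - F j * E i
         - (if i = j then fconst (of_real (1 / (q - 1 / q))) * (K i - K' i) else 0) | i j.
         i \<in> {1..n} \<and> j \<in> {1..n}} \<union>
      {serre q GenE i j | i j. i \<in> {1..n} \<and> j \<in> {1..n} \<and> i \<noteq> j} \<union>
      {serre q GenF i j | i j. i \<in> {1..n} \<and> j \<in> {1..n} \<and> i \<noteq> j})"

definition Uq :: "nat \<Rightarrow> real \<Rightarrow> (complex, uq_gen falg set) module" where
  "Uq n q = alg_quot (free_algebra (uq_gens n)) (uq_relators n q)"

definition uq_cls :: "nat \<Rightarrow> real \<Rightarrow> uq_gen list \<Rightarrow> uq_gen falg set" where
  "uq_cls n q xs = alg_cls (free_algebra (uq_gens n)) (uq_relators n q) (fmon xs)"

definition qcomm :: "(complex, 'a) module \<Rightarrow> complex \<Rightarrow> 'a \<Rightarrow> 'a \<Rightarrow> 'a" where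
  "qcomm M c a b = (a \<otimes>\<^bsub>M\<^esub> b) \<ominus>\<^bsub>M\<^esub> (c \<odot>\<^bsub>M\<^esub> (b \<otimes>\<^bsub>M\<^esub> a))"

text \<open>\<open>root_vec n q j i\<close> is $E_{ji}$; it is only used for $i < j$.\<close>

primrec root_vec :: "nat \<Rightarrow> real \<Rightarrow> nat \<Rightarrow> nat \<Rightarrow> uq_gen falg set" where
  "root_vec n q 0 i = \<zero>\<^bsub>Uq n q\<^esub>"
| "root_vec n q (Suc j) i =
    (if j \<le> i then uq_cls n q [GenE i]
     else qcomm (Uq n q) (of_real (1 / q)) (uq_cls n q [GenE j]) (root_vec n q j i))"

text \<open>The pair \<open>(i, j)\<close> stands for the root $\varepsilon_i - \varepsilon_j$.\<close>

definition pos_roots :: "nat \<Rightarrow> (nat \<times> nat) set" where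
  "pos_roots n = {(i, j). 1 \<le> i \<and> i < j \<and> j \<le> n + 1}"

definition root_less :: "nat \<times> nat \<Rightarrow> nat \<times> nat \<Rightarrow> bool" where
  "root_less \<alpha> \<beta> \<longleftrightarrow>
    (case \<alpha> of (i, j) \<Rightarrow> case \<beta> of (k, l) \<Rightarrow> j > l \<or> (j = l \<and> i > k))"

definition T01 :: "nat \<Rightarrow> real \<Rightarrow> uq_gen falg set set" where
  "T01 n q = LinearCombinations.module.span class_ring (Uq n q) {root_vec n q j i | i j. (i, j) \<in> pos_roots n}"


section \<open>The quantized function algebra\<close>

text \<open>
  Elements of $\mathcal{O}_q(\mathrm{SU}_{n+1})$ are linear functionals on $U_q$, and the pairing
  is evaluation. A functional is represented by the function that has the given values on
  \<open>carrier (Uq n q)\<close> and is zero elsewhere, so that vector space operations are pointwise.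
\<close>

definition uq_rep ::
  "nat \<Rightarrow> real \<Rightarrow> nat \<Rightarrow> (uq_gen falg set \<Rightarrow> complex mat) \<Rightarrow> bool" where
  "uq_rep n q d \<rho> \<longleftrightarrow>
    \<rho> \<in> Ring.ring_hom (Uq n q) (ring_mat TYPE(complex) d ()) \<and>
    (\<forall>c. \<forall>X\<in>carrier (Uq n q). \<rho> (c \<odot>\<^bsub>Uq n q\<^esub> X) = c \<cdot>\<^sub>m \<rho> X)"

text \<open>
  Type 1: the space is spanned by weight vectors on which each $K_i$ acts as an integral power
  of $q$.
\<close>

definition type1_rep ::
  "nat \<Rightarrow> real \<Rightarrow> nat \<Rightarrow> (uq_gen falg set \<Rightarrow> complex mat) \<Rightarrow> bool" where
  "type1_rep n q d \<rho> \<longleftrightarrow> uq_rep n q d \<rho> \<and>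
    LinearCombinations.module.span class_ring (module_vec TYPE(complex) d)
      {v \<in> carrier_vec d. \<exists>\<mu> :: nat \<Rightarrow> int. \<forall>i\<in>{1..n}.
         \<rho> (uq_cls n q [GenK i]) *\<^sub>v v = of_real (q powi \<mu> i) \<cdot>\<^sub>v v}
    = carrier_vec d"

definition mat_coeff :: "nat \<Rightarrow> real \<Rightarrow> (uq_gen falg set \<Rightarrow> complex mat) \<Rightarrow>
    complex vec \<Rightarrow> complex vec \<Rightarrow> uq_gen falg set \<Rightarrow> complex" where
  "mat_coeff n q \<rho> \<phi> v = (\<lambda>X. if X \<in> carrier (Uq n q) then \<phi> \<bullet> (\<rho> X *\<^sub>v v) else 0)"

text \<open>
  \<open>on_Uq n q f\<close> is the linear functional on $U_q$ whose value on the class of the monomial \<open>xs\<close>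
  is \<open>f xs\<close>, for \<open>f\<close> whose linear extension is constant on classes.
\<close>

definition lin_ext :: "('x list \<Rightarrow> complex) \<Rightarrow> 'x falg \<Rightarrow> complex" where
  "lin_ext f p = (\<Sum>w\<in>Poly_Mapping.keys p. Poly_Mapping.lookup p w * f (letters w))"

definition on_Uq ::
  "nat \<Rightarrow> real \<Rightarrow> (uq_gen list \<Rightarrow> complex) \<Rightarrow> uq_gen falg set \<Rightarrow> complex" where
  "on_Uq n q f X = (if X \<in> carrier (Uq n q) then the_elem (lin_ext f ` X) else 0)"

primrec comult_gen :: "uq_gen \<Rightarrow> (uq_gen list \<times> uq_gen list) list" where
  "comult_gen (GenE i) = [([GenE i], [GenK i]), ([], [GenE i])]"
| "comult_gen (GenF i) = [([GenF i], []), ([GenKinv i], [GenF i])]"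
| "comult_gen (GenK i) = [([GenK i], [GenK i])]"
| "comult_gen (GenKinv i) = [([GenKinv i], [GenKinv i])]"

primrec comult_word :: "uq_gen list \<Rightarrow> (uq_gen list \<times> uq_gen list) list" where
  "comult_word [] = [([], [])]"
| "comult_word (g # xs) =
    [(a @ c, b @ d). (a, b) \<leftarrow> comult_gen g, (c, d) \<leftarrow> comult_word xs]"

primrec counit_gen :: "uq_gen \<Rightarrow> complex" where
  "counit_gen (GenE i) = 0"
| "counit_gen (GenF i) = 0"
| "counit_gen (GenK i) = 1"
| "counit_gen (GenKinv i) = 1"

text \<open>
  The product is dual to the coproduct of $U_q$, and the unit is the counit of $U_q$. Only the
  unit and the coalgebra structure enter the exterior algebra.
\<close>

definition Oq :: "nat \<Rightarrow> real \<Rightarrow> (complex, uq_gen falg set \<Rightarrow> complex) module" where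
  "Oq n q =
    \<lparr>carrier = {mat_coeff n q \<rho> \<phi> v | d \<rho> \<phi> v.
        type1_rep n q d \<rho> \<and> \<phi> \<in> carrier_vec d \<and> v \<in> carrier_vec d},
     mult = (\<lambda>a b. on_Uq n q (\<lambda>xs. \<Sum>(y, z)\<leftarrow>comult_word xs. a (uq_cls n q y) * b (uq_cls n q z))),
     one = on_Uq n q (\<lambda>xs. \<Prod>g\<leftarrow>xs. counit_gen g),
     zero = (\<lambda>X. 0),
     add = (\<lambda>a b X. a X + b X),
     smult = (\<lambda>c a X. c * a X)\<rparr>"

definition oq_counit :: "nat \<Rightarrow> real \<Rightarrow> (uq_gen falg set \<Rightarrow> complex) \<Rightarrow> complex" where
  "oq_counit n q a = a \<one>\<^bsub>Uq n q\<^esub>"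

text \<open>
  $\Delta(x) = \sum_{k<m} a_k \otimes b_k$ in $A \otimes A$; the coproduct of $A$ is dual to the
  product of $U_q$, and $A \otimes A$ embeds into the bilinear forms on $U_q$.
\<close>

definition oq_comult :: "nat \<Rightarrow> real \<Rightarrow> (uq_gen falg set \<Rightarrow> complex) \<Rightarrow> nat \<Rightarrow>
    (nat \<Rightarrow> uq_gen falg set \<Rightarrow> complex) \<Rightarrow> (nat \<Rightarrow> uq_gen falg set \<Rightarrow> complex) \<Rightarrow> bool" where
  "oq_comult n q x m a b \<longleftrightarrow>
    (\<forall>k<m. a k \<in> carrier (Oq n q) \<and> b k \<in> carrier (Oq n q)) \<and>
    (\<forall>X\<in>carrier (Uq n q). \<forall>Y\<in>carrier (Uq n q).
       x (X \<otimes>\<^bsub>Uq n q\<^esub> Y) = (\<Sum>k<m. a k X * b k Y))"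

text \<open>
  The pairing of a generator of $U_q$ with $u_{ij}$, extended to monomials by
  $\Delta(u_{ij}) = \sum_a u_{ia} \otimes u_{aj}$ and $\varepsilon(u_{ij}) = \delta_{ij}$.
\<close>

primrec u_gen :: "real \<Rightarrow> uq_gen \<Rightarrow> nat \<Rightarrow> nat \<Rightarrow> complex" where
  "u_gen q (GenE k) i j = (if i = k + 1 \<and> j = k then 1 else 0)"
| "u_gen q (GenF k) i j = (if i = k \<and> j = k + 1 then 1 else 0)"
| "u_gen q (GenK k) i j =
    (if i = j then of_real (q powi (of_bool (k + 1 = i) - of_bool (i = k))) else 0)"
| "u_gen q (GenKinv k) i j =
    (if i = j then of_real (q powi (- (of_bool (k + 1 = i) - of_bool (i = k)))) else 0)"

primrec u_word :: "nat \<Rightarrow> real \<Rightarrow> uq_gen list \<Rightarrow> nat \<Rightarrow> nat \<Rightarrow> complex" where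
  "u_word n q [] i j = of_bool (i = j)"
| "u_word n q (g # xs) i j = (\<Sum>a=1..n+1. u_gen q g i a * u_word n q xs a j)"

definition u_elt :: "nat \<Rightarrow> real \<Rightarrow> nat \<Rightarrow> nat \<Rightarrow> uq_gen falg set \<Rightarrow> complex" where
  "u_elt n q i j = on_Uq n q (\<lambda>xs. u_word n q xs i j)"


section \<open>The quantum exterior algebra\<close>

definition Oq_plus :: "nat \<Rightarrow> real \<Rightarrow> (complex, uq_gen falg set \<Rightarrow> complex) module" where
  "Oq_plus n q = (Oq n q)\<lparr>carrier := {a \<in> carrier (Oq n q). oq_counit n q a = 0}\<rparr>"

definition plus_part ::
  "nat \<Rightarrow> real \<Rightarrow> (uq_gen falg set \<Rightarrow> complex) \<Rightarrow> uq_gen falg set \<Rightarrow> complex" where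
  "plus_part n q a = (\<lambda>X. a X - oq_counit n q a * \<one>\<^bsub>Oq n q\<^esub> X)"

definition I01 :: "nat \<Rightarrow> real \<Rightarrow> (uq_gen falg set \<Rightarrow> complex) set" where
  "I01 n q = {x \<in> carrier (Oq_plus n q). \<forall>X\<in>T01 n q. x X = 0}"

type_synonym form01 = "(uq_gen falg set \<Rightarrow> complex) set"

definition Lambda01 :: "nat \<Rightarrow> real \<Rightarrow> (complex, form01) module" where
  "Lambda01 n q = vs_quot (Oq_plus n q) (I01 n q)"

definition cls01 :: "nat \<Rightarrow> real \<Rightarrow> (uq_gen falg set \<Rightarrow> complex) \<Rightarrow> form01" where
  "cls01 n q a = I01 n q +>\<^bsub>Oq_plus n q\<^esub> a"

definition e01 :: "nat \<Rightarrow> real \<Rightarrow> nat \<times> nat \<Rightarrow> form01" where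
  "e01 n q \<alpha> = (case \<alpha> of (i, j) \<Rightarrow> cls01 n q (u_elt n q j i))"

definition I2 :: "nat \<Rightarrow> real \<Rightarrow> form01 falg set set" where
  "I2 n q =
    (let T = tensor_algebra (Lambda01 n q);
         \<iota> = (\<lambda>a. tensor_incl (Lambda01 n q) (cls01 n q (plus_part n q a))) in
     {finsum T (\<lambda>k. \<iota> (a k) \<otimes>\<^bsub>T\<^esub> \<iota> (b k)) {..<m} | x m a b.
        x \<in> I01 n q \<and> oq_comult n q x m a b})"

type_synonym ext_form = "form01 falg set set"

definition ext_algebra :: "nat \<Rightarrow> real \<Rightarrow> (complex, ext_form) module" where
  "ext_algebra n q = alg_quot (tensor_algebra (Lambda01 n q)) (I2 n q)"

definition ext_incl :: "nat \<Rightarrow> real \<Rightarrow> form01 \<Rightarrow> ext_form" where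
  "ext_incl n q v =
    alg_cls (tensor_algebra (Lambda01 n q)) (I2 n q) (tensor_incl (Lambda01 n q) v)"

definition wedge :: "nat \<Rightarrow> real \<Rightarrow> form01 list \<Rightarrow> ext_form" where
  "wedge n q vs =
    foldr (\<lambda>v \<omega>. ext_incl n q v \<otimes>\<^bsub>ext_algebra n q\<^esub> \<omega>) vs \<one>\<^bsub>ext_algebra n q\<^esub>"

text \<open>The homogeneous component of degree \<open>k\<close> is the image of the \<open>k\<close>-th tensor power.\<close>

definition ext_degree :: "nat \<Rightarrow> real \<Rightarrow> nat \<Rightarrow> (complex, ext_form) module" where
  "ext_degree n q k = (ext_algebra n q)\<lparr>carrier :=
    LinearCombinations.module.span class_ring (ext_algebra n q)
      {wedge n q vs | vs. length vs = k \<and> set vs \<subseteq> carrier (Lambda01 n q)}\<rparr>"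

end

theory Submission
  imports Defs
begin

text \<open>
  Write \<open>E\<^sub>\<alpha>\<close> for the root vector and \<open>e\<^sub>\<alpha>\<close> for the dual form of a positive root \<open>\<alpha>\<close>. An element \<open>x\<close> of
  the space \<open>I\<close> of functionals that vanish on the tangent space contributes to the exterior algebra
  the relation \<open>\<Sum> x (E\<^sub>\<alpha> E\<^sub>\<beta>) e\<^sub>\<alpha> \<and> e\<^sub>\<beta> = 0\<close>, the sum being over all pairs of positive roots. So the quadratic
  relations are dual to the relations that hold between the products \<open>E\<^sub>\<alpha> E\<^sub>\<beta>\<close> modulo the tangent space.

  In \<open>U\<^sub>q\<close> a product \<open>E\<^sub>\<alpha> E\<^sub>\<beta>\<close> with \<open>\<alpha> < \<beta>\<close> equals a power of \<open>q\<close> times \<open>E\<^sub>\<beta> E\<^sub>\<alpha>\<close>, plus \<open>q - 1/q\<close> times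
  the product of the two root vectors with exchanged end points when the roots cross, plus a root
  vector when the roots add up to a root
  (\<open>X_split\<close>, \<open>X_same_start\<close>, \<open>X_same_end\<close>, \<open>X_nested\<close>, \<open>X_crossing\<close>, put together in \<open>Oq_root_relation\<close>). Dually,
  every \<open>e\<^sub>\<beta> \<and> e\<^sub>\<alpha>\<close> in the wrong order should be a multiple of \<open>e\<^sub>\<alpha> \<and> e\<^sub>\<beta>\<close>, with a correction term when one root
  is nested in the other, and \<open>e\<^sub>\<alpha> \<and> e\<^sub>\<alpha>\<close> should be \<open>0\<close>. These are the straightening rules \<open>straighten\<close>.

  Spanning needs enough elements of \<open>I\<close>. For \<open>\<beta> = (i, j)\<close> and \<open>\<alpha> = (k, l)\<close> in the wrong order the matrix
  coefficient \<open>u\<^sub>l\<^sub>k u\<^sub>j\<^sub>i\<close> of the square of the defining representation vanishes on all root vectors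
  (\<open>sq_coeff_root\<close>), and its values on products of root vectors are computed from the coproduct
  (\<open>sq_coeff_root_root\<close>); the relation that it contributes is, up to a nonzero factor, the straightening rule of
  the pair (\<open>ec_eq_straighten\<close>). Rewriting lowers words in a well-founded order, so increasing words span.

  Independence needs functionals on the exterior algebra. The straightening rules are confluent
  (\<open>overlap\<close>), so by the diamond lemma the coefficient of an increasing word in the normal form of a word
  is unchanged by every rule (\<open>nf_step\<close>). Extended multilinearly to words of forms, it kills the relations of
  all \<open>x\<close> in \<open>I\<close>, because the rules and the commutation relations of root vectors are dual to each other
  (\<open>relation_sum_zero\<close>). Hence it descends to the exterior algebra (\<open>ec_null\<close>) and separates the increasing
  words, which are as many as the subsets of the set of positive roots.
\<close>

section \<open>Confluent systems of quadratic rewriting rules\<close>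

text \<open>
  The diamond lemma for rules that replace two adjacent letters. An overlap of two rules only has to
  be resolved modulo the rules on smaller words. This is expressed through an arbitrary function \<open>F\<close>
  on words of three letters that satisfies the rules below the overlap, so that no quotient has to
  be formed.
\<close>

locale quadratic_rewriting =
  fixes less :: "'x \<Rightarrow> 'x \<Rightarrow> bool"
    and red :: "'x \<Rightarrow> 'x \<Rightarrow> bool"
    and rhs :: "'x \<Rightarrow> 'x \<Rightarrow> (complex \<times> 'x \<times> 'x) list"
  assumes wf_less: "wf {(x, y). less x y}"
    and decreasing: "red x y \<Longrightarrow> (c, x', y') \<in> set (rhs x y) \<Longrightarrow> less x' x"
    and confluent: "red x y \<Longrightarrow> red y z \<Longrightarrow>
      (\<And>a b c. less a x \<or> a = x \<and> less b y \<Longrightarrow> red a b \<Longrightarrow>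
         F a b c = (\<Sum>(s, a', b')\<leftarrow>rhs a b. s * F a' b' c)) \<Longrightarrow>
      (\<And>a b c. less a x \<or> a = x \<and> less b y \<Longrightarrow> red b c \<Longrightarrow>
         F a b c = (\<Sum>(s, b', c')\<leftarrow>rhs b c. s * F a b' c')) \<Longrightarrow>
      (\<Sum>(s, x', y')\<leftarrow>rhs x y. s * F x' y' z) = (\<Sum>(s, y', z')\<leftarrow>rhs y z. s * F x y' z' :: complex)"
begin

abbreviation word_less :: "('x list \<times> 'x list) set" where
  "word_less \<equiv> lenlex {(x, y). less x y}"

lemma wf_word_less: "wf word_less"
  by (rule wf_lenlex[OF wf_less])

lemma word_lessI: "less a b \<Longrightarrow> length v = length v' \<Longrightarrow> (u @ a # v, u @ b # v') \<in> word_less"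
  by (force simp: lenlex_conv lex_conv)

lemma word_less_replace: "less x' x \<Longrightarrow> (u @ x' # y' # v, u @ x # y # v) \<in> word_less"
  by (rule word_lessI) simp_all

definition redex :: "'x list \<Rightarrow> nat \<Rightarrow> bool" where
  "redex w p \<longleftrightarrow> Suc p < length w \<and> red (w ! p) (w ! Suc p)"

lemma redex_append: "red x y \<Longrightarrow> redex (u @ x # y # v) (length u)"
  by (simp add: redex_def nth_append)

lemma redexD:
  assumes "redex w p"
  obtains u x y v where "w = u @ x # y # v" "length u = p" "red x y"
proof
  have p: "Suc p < length w" using assms by (simp add: redex_def)
  show "w = take p w @ w ! p # w ! Suc p # drop (Suc (Suc p)) w"
    using p by (simp add: Cons_nth_drop_Suc id_take_nth_drop[symmetric])
  show "length (take p w) = p" "red (w ! p) (w ! Suc p)"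
    using assms by (auto simp: redex_def)
qed

text \<open>
  Only the coefficients of a normal form are needed, so it is encoded as a function of the word \<open>w\<close> that is
  rewritten and of the word \<open>g\<close> whose coefficient is taken.
\<close>

function nf :: "'x list \<Rightarrow> 'x list \<Rightarrow> complex" where
  "nf w g =
    (if \<exists>p. redex w p then
       let p = LEAST p. redex w p in
       \<Sum>(s, x, y)\<leftarrow>rhs (w ! p) (w ! Suc p). s * nf (take p w @ x # y # drop (Suc (Suc p)) w) g
     else of_bool (w = g))"
  by pat_completeness auto
termination
proof (relation "inv_image word_less fst")
  show "wf (inv_image word_less fst)" by (rule wf_inv_image[OF wf_word_less])
next
  fix w g :: "'x list" and p t s xy x y
  assume ex: "\<exists>p. redex w p" and p: "p = (LEAST p. redex w p)"
    and t: "t \<in> set (rhs (w ! p) (w ! Suc p))" and txy: "(s, xy) = t" "(x, y) = xy"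
  have "redex w p" unfolding p using ex by (rule LeastI_ex)
  then obtain u a b v where w: "w = u @ a # b # v" "length u = p" "red a b" by (rule redexD)
  with t txy have "less x a" by (auto intro!: decreasing simp: nth_append)
  then show "((take p w @ x # y # drop (Suc (Suc p)) w, g), (w, g)) \<in> inv_image word_less fst"
    using w by (auto simp: word_less_replace)
qed

declare nf.simps[simp del]

lemma nf_irreducible:
  assumes "\<And>p. \<not> redex w p"
  shows "nf w g = of_bool (w = g)"
proof -
  have "\<not> (\<exists>p. redex w p)" using assms by blast
  then show ?thesis by (subst nf.simps) (simp only: if_False)
qed

lemma sum_list_swap_gen:
  "(\<Sum>x\<leftarrow>xs. \<Sum>y\<leftarrow>ys. f x y) = (\<Sum>y\<leftarrow>ys. \<Sum>x\<leftarrow>xs. f x y :: complex)"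
  by (induction xs) (simp_all add: sum_list_addf)

text \<open>
  The order of rewriting is irrelevant. By induction, the claim may be used for all smaller words, in
  particular for everything that arises from one rewriting step. A given redex and the
  leftmost one coincide, share a letter, or are disjoint.
\<close>

lemma nf_step:
  "red x y \<Longrightarrow> nf (u @ x # y # v) g = (\<Sum>(s, x', y')\<leftarrow>rhs x y. s * nf (u @ x' # y' # v) g)"
proof (induction "u @ x # y # v" arbitrary: u x y v rule: wf_induct_rule[OF wf_word_less])
  case (1 u x y v)
  note IH = 1(1)
  let ?w = "u @ x # y # v"
  have rex: "redex ?w (length u)" using 1 by (simp add: redex_append)
  define p where "p = (LEAST p. redex ?w p)"
  have pr: "redex ?w p" unfolding p_def using rex by (rule LeastI)
  have ple: "p \<le> length u" unfolding p_def using rex by (rule Least_le)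
  from pr obtain u1 a b v1 where w1: "?w = u1 @ a # b # v1" "length u1 = p" "red a b"
    by (rule redexD)
  have step: "nf ?w g = (\<Sum>(s, a', b')\<leftarrow>rhs a b. s * nf (u1 @ a' # b' # v1) g)"
  proof -
    have "\<exists>p. redex ?w p" using rex by blast
    then have "nf ?w g = (\<Sum>(s, x, y)\<leftarrow>rhs (?w ! p) (?w ! Suc p).
        s * nf (take p ?w @ x # y # drop (Suc (Suc p)) ?w) g)"
      by (subst nf.simps) (simp only: if_True Let_def p_def)
    then show ?thesis unfolding w1(1) using w1(2) by (simp add: nth_append)
  qed
  consider "length u = p" | "length u = Suc p" | "length u \<ge> Suc (Suc p)" using ple by linarith
  then show ?case
  proof cases
    case 1
    then have "u = u1" "x = a" "y = b" "v = v1" using w1 by auto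
    then show ?thesis using step by simp
  next
    case 2
    \<comment> \<open>The two redexes share the letter \<open>x\<close>: this is where confluence enters.\<close>
    then obtain a0 where u: "u = u1 @ [a]" and bx: "b = x" and v1: "v1 = y # v"
      using w1 by (cases u rule: rev_cases) auto
    have ih1: "nf (u1 @ r # s # t # v) g = (\<Sum>(d, r', s')\<leftarrow>rhs r s. d * nf (u1 @ r' # s' # t # v) g)"
      if "less r a \<or> r = a \<and> less s x" "red r s" for r s t
    proof (rule IH)
      show "(u1 @ r # s # t # v, ?w) \<in> word_less"
        using that(1) word_lessI[of r a "s # t # v" "x # y # v" u1]
          word_lessI[of s x "t # v" "y # v" "u1 @ [a]"] by (auto simp: u)
    qed (rule that)
    have ih2: "nf (u1 @ r # s # t # v) g = (\<Sum>(d, s', t')\<leftarrow>rhs s t. d * nf (u1 @ r # s' # t' # v) g)"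
      if "less r a \<or> r = a \<and> less s x" "red s t" for r s t
    proof -
      have "nf ((u1 @ [r]) @ s # t # v) g = (\<Sum>(d, s', t')\<leftarrow>rhs s t. d * nf ((u1 @ [r]) @ s' # t' # v) g)"
      proof (rule IH)
        show "((u1 @ [r]) @ s # t # v, ?w) \<in> word_less"
          using that(1) word_lessI[of r a "s # t # v" "x # y # v" u1]
            word_lessI[of s x "t # v" "y # v" "u1 @ [a]"] by (auto simp: u)
      qed (rule that)
      then show ?thesis by simp
    qed
    from confluent[of a x y "\<lambda>r s t. nf (u1 @ r # s # t # v) g", OF _ _ ih1 ih2] w1(3) 1
    have "(\<Sum>(s, x', y')\<leftarrow>rhs a x. s * nf (u1 @ x' # y' # y # v) g)
        = (\<Sum>(s, y', z')\<leftarrow>rhs x y. s * nf (u1 @ a # y' # z' # v) g)"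
      by (simp add: bx "1.prems")
    then show ?thesis using step by (simp add: u bx v1)
  next
    case 3
    \<comment> \<open>Disjoint redexes: after either step the other redex is still there, and both orders give the same double sum.\<close>
    then have "\<exists>m. u = u1 @ a # b # m \<and> v1 = m @ x # y # v"
    proof -
      have u1: "u1 = take p u" using w1 3 by (metis append_eq_append_conv_if le_SucI le_Suc_eq
            Suc_leD append_take_drop_id take_append diff_is_0_eq take_0 append_Nil2)
      have "drop p ?w = a # b # v1" using w1 by (metis append_eq_conv_conj)
      then have dp: "drop p u @ x # y # v = a # b # v1" using 3 by simp
      have "length (drop p u) \<ge> 2" using 3 by simp
      then obtain m where "drop p u = a # b # m" using dp
        by (cases "drop p u"; cases "tl (drop p u)") auto
      then show ?thesis using dp u1 by (metis append_Cons append_take_drop_id list.inject)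
    qed
    then obtain m where m: "u = u1 @ a # b # m" "v1 = m @ x # y # v" by blast
    have lh: "nf (u1 @ a' # b' # v1) g = (\<Sum>(s, x', y')\<leftarrow>rhs x y. s * nf (u1 @ a' # b' # m @ x' # y' # v) g)"
      if "(c, a', b') \<in> set (rhs a b)" for c a' b'
    proof -
      have "less a' a" using that w1(3) by (rule decreasing[rotated])
      then have "nf ((u1 @ a' # b' # m) @ x # y # v) g =
          (\<Sum>(s, x', y')\<leftarrow>rhs x y. s * nf ((u1 @ a' # b' # m) @ x' # y' # v) g)"
        using "1.prems" by (intro IH) (auto simp: m intro: word_less_replace)
      then show ?thesis by (simp add: m)
    qed
    have rh: "nf (u @ x' # y' # v) g = (\<Sum>(s, a', b')\<leftarrow>rhs a b. s * nf (u1 @ a' # b' # m @ x' # y' # v) g)"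
      if "(c, x', y') \<in> set (rhs x y)" for c x' y'
    proof -
      have "less x' x" using that "1.prems" by (rule decreasing[rotated])
      then have "(u1 @ a # b # (m @ x' # y' # v), ?w) \<in> word_less"
        using word_less_replace[of x' x "u1 @ a # b # m" y' v y] by (simp add: m)
      from IH[OF this] w1(3) show ?thesis by (simp add: m)
    qed
    have "nf ?w g = (\<Sum>(s, a', b')\<leftarrow>rhs a b. s *
        (\<Sum>(t, x', y')\<leftarrow>rhs x y. t * nf (u1 @ a' # b' # m @ x' # y' # v) g))"
      unfolding step by (intro arg_cong[of _ _ sum_list] map_cong) (auto simp: lh)
    also have "\<dots> = (\<Sum>(s, a', b')\<leftarrow>rhs a b. 
        (\<Sum>(t, x', y')\<leftarrow>rhs x y. s * (t * nf (u1 @ a' # b' # m @ x' # y' # v) g)))"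
      by (simp add: sum_list_const_mult[symmetric] case_prod_unfold)
    also have "\<dots> = (\<Sum>(t, x', y')\<leftarrow>rhs x y. 
        (\<Sum>(s, a', b')\<leftarrow>rhs a b. t * (s * nf (u1 @ a' # b' # m @ x' # y' # v) g)))"
      unfolding case_prod_unfold
      by (subst sum_list_swap_gen) (simp add: mult.left_commute)
    also have "\<dots> = (\<Sum>(t, x', y')\<leftarrow>rhs x y. t *
        (\<Sum>(s, a', b')\<leftarrow>rhs a b. s * nf (u1 @ a' # b' # m @ x' # y' # v) g))"
      by (simp add: sum_list_const_mult[symmetric] case_prod_unfold)
    also have "\<dots> = (\<Sum>(t, x', y')\<leftarrow>rhs x y. t * nf (u @ x' # y' # v) g)"
      by (intro arg_cong[of _ _ sum_list] map_cong) (auto simp: rh)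
    finally show ?thesis .
  qed
qed

end

section \<open>Straightening rules for pairs of positive roots\<close>

text \<open>
  For \<open>\<beta>\<close> and \<open>\<alpha>\<close> distinct and in the wrong order this is \<open>q\<close> to the power of the inner product of the two
  roots; the contribution of \<open>i = l\<close> is missing because then \<open>\<beta>\<close> precedes \<open>\<alpha>\<close>.
\<close>

definition swap_coeff :: "real \<Rightarrow> nat \<times> nat \<Rightarrow> nat \<times> nat \<Rightarrow> complex" where
  "swap_coeff q \<beta> \<alpha> = (case \<beta> of (i, j) \<Rightarrow> case \<alpha> of (k, l) \<Rightarrow>
     (if k = i then of_real q else 1) * (if l = j then of_real q else 1) *
     (if k = j then of_real (1 / q) else 1))"

text \<open>
  The sum that replaces \<open>e\<^sub>\<beta> \<and> e\<^sub>\<alpha>\<close>, as a list of coefficients with pairs of roots.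
\<close>

definition straighten :: "real \<Rightarrow> nat \<times> nat \<Rightarrow> nat \<times> nat \<Rightarrow> (complex \<times> (nat \<times> nat) \<times> (nat \<times> nat)) list" where
  "straighten q \<beta> \<alpha> = (if \<beta> = \<alpha> then [] else
     (- swap_coeff q \<beta> \<alpha>, \<alpha>, \<beta>) #
     (case \<beta> of (i, j) \<Rightarrow> case \<alpha> of (k, l) \<Rightarrow>
        if k < i \<and> j < l then [(- of_real (q - 1 / q), (i, l), (k, j))] else []))"

text \<open>
  The words on both sides are rewritten until all letters are increasing. Which rules apply depends
  only on the relative order of \<open>i1, i2, i3\<close> and of \<open>j1 \<le> j2 \<le> j3\<close>, and in each of the finitely many
  configurations the two results agree by an identity between polynomials in \<open>q\<close> and \<open>1/q\<close>.
\<close>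

lemma overlap:
  fixes F :: "nat \<times> nat \<Rightarrow> nat \<times> nat \<Rightarrow> nat \<times> nat \<Rightarrow> complex"
  assumes q: "q \<noteq> 0" and up: "i1 < j1" "i2 < j2" "i3 < j3"
  and mem: "\<And>i j. i \<in> {i1, i2, i3} \<Longrightarrow> j \<in> {j1, j2, j3} \<Longrightarrow> i < j \<Longrightarrow> (i, j) \<in> P"
  and r: "\<not> root_less (i1,j1) (i2,j2)" "\<not> root_less (i2,j2) (i3,j3)"
  and H1: "\<And>i j k l m s. root_less (i,j) (i1,j1) \<or> (i,j) = (i1,j1) \<and> root_less (k,l) (i2,j2) \<Longrightarrow>
     (i, j) \<in> P \<Longrightarrow> (k, l) \<in> P \<Longrightarrow> \<not> root_less (i,j) (k,l) \<Longrightarrow> F (i,j) (k,l) (m,s) =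
      (if (i,j) = (k,l) then 0 else
        - swap_coeff q (i,j) (k,l) * F (k,l) (i,j) (m,s) - 
         (if k < i \<and> j < l then of_real (q - 1/q) * F (i,l) (k,j) (m,s) else 0))"
  and H2: "\<And>i j k l m s. root_less (m,s) (i1,j1) \<or> (m,s) = (i1,j1) \<and> root_less (i,j) (i2,j2) \<Longrightarrow>
     (m, s) \<in> P \<Longrightarrow> (i, j) \<in> P \<Longrightarrow> (k, l) \<in> P \<Longrightarrow> \<not> root_less (i,j) (k,l) \<Longrightarrow> F (m,s) (i,j) (k,l) =
      (if (i,j) = (k,l) then 0 else
        - swap_coeff q (i,j) (k,l) * F (m,s) (k,l) (i,j) - 
         (if k < i \<and> j < l then of_real (q - 1/q) * F (m,s) (i,l) (k,j) else 0))"
  shows "(if (i1,j1) = (i2,j2) then 0 else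
        - swap_coeff q (i1,j1) (i2,j2) * F (i2,j2) (i1,j1) (i3,j3) - 
         (if i2 < i1 \<and> j1 < j2 then of_real (q - 1/q) * F (i1,j2) (i2,j1) (i3,j3) else 0)) = 
     (if (i2,j2) = (i3,j3) then 0 else
        - swap_coeff q (i2,j2) (i3,j3) * F (i1,j1) (i3,j3) (i2,j2) - 
         (if i3 < i2 \<and> j2 < j3 then of_real (q - 1/q) * F (i1,j1) (i2,j3) (i3,j2) else 0))"
proof -
  \<comment> \<open>Most comparisons \<open>k = j\<close> of a first with a second index are decided by \<open>k < j\<close>. Hiding them in \<open>A\<close>, with the
    rewrite rule \<open>A1\<close>, keeps the simplifier from splitting them.\<close>
  define A where "A x y = (if x = y then of_real (1/q) else (1::complex))" for x y :: nat
  have A1: "A x y = 1" if "x < y" for x y using that by (simp add: A_def)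
  obtain Q :: complex where Q: "Q = of_real q" by simp
  have Q0: "Q \<noteq> 0" using q Q by simp
  have sc: "swap_coeff q (i,j) (k,l) = (if k = i then Q else 1) * (if l = j then Q else 1) * A k j" for i j k l
    by (simp add: swap_coeff_def A_def Q)
  obtain P' :: complex where P: "P' = of_real (1 / q)" by simp
  have QP: "Q * P' = 1" "P' * Q = 1" "Q * (P' * x) = x" "P' * (Q * x) = x" for x
    using q by (simp_all add: Q P)
  have d: "of_real (q - 1/q) = Q - P'" by (simp add: Q P)
  note H1' = H1[unfolded sc d root_less_def] note H2' = H2[unfolded sc d root_less_def]
  have "j1 \<le> j2" "j2 \<le> j3" and s1: "j1 = j2 \<Longrightarrow> i1 \<le> i2" and s2: "j2 = j3 \<Longrightarrow> i2 \<le> i3"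
    using r by (auto simp: root_less_def)
  then consider "j1 < j2" "j2 < j3" | "j1 = j2" "j2 < j3" | "j1 < j2" "j2 = j3" | "j1 = j2" "j2 = j3"
    by linarith
  then show ?thesis
  proof cases
    case 1
    consider "i1 < i2" "i2 < i3" |
      "i1 < i3" "i3 < i2" |
      "i2 < i1" "i1 < i3" |
      "i2 < i3" "i3 < i1" |
      "i3 < i1" "i1 < i2" |
      "i3 < i2" "i2 < i1" |
      "i1 = i2" "i2 < i3" |
      "i1 = i2" "i3 < i2" |
      "i1 = i3" "i2 < i3" |
      "i1 = i3" "i3 < i2" |
      "i2 = i3" "i1 < i2" |
      "i2 = i3" "i2 < i1" |
      "i1 = i2" "i2 = i3"
      by (cases i1 i2 rule: linorder_cases; cases i2 i3 rule: linorder_cases;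
          cases i1 i3 rule: linorder_cases) auto
    then show ?thesis
    proof cases
    qed (use [[linarith_neq_limit = 0]] in \<open>insert 1 up, unfold sc d, (simp add: H1' H2' A1 mem; simp add: algebra_simps QP)+\<close>)
  next
    case 2
    have "i1 \<le> i2" using s1 2 by simp
    then consider "i1 < i2" "i2 < i3" |
      "i1 < i3" "i3 < i2" |
      "i3 < i1" "i1 < i2" |
      "i1 = i2" "i2 < i3" |
      "i1 = i2" "i3 < i2" |
      "i1 = i3" "i3 < i2" |
      "i2 = i3" "i1 < i2" |
      "i1 = i2" "i2 = i3"
      by (cases i1 i2 rule: linorder_cases; cases i2 i3 rule: linorder_cases;
          cases i1 i3 rule: linorder_cases) auto
    then show ?thesis
    proof cases
    qed (use [[linarith_neq_limit = 0]] in \<open>insert 2 up, unfold sc d, (simp add: H1' H2' A1 mem; simp add: algebra_simps QP)+\<close>)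
  next
    case 3
    have "i2 \<le> i3" using s2 3 by simp
    then consider "i1 < i2" "i2 < i3" |
      "i2 < i1" "i1 < i3" |
      "i2 < i3" "i3 < i1" |
      "i1 = i2" "i2 < i3" |
      "i1 = i3" "i2 < i3" |
      "i2 = i3" "i1 < i2" |
      "i2 = i3" "i2 < i1" |
      "i1 = i2" "i2 = i3"
      by (cases i1 i2 rule: linorder_cases; cases i2 i3 rule: linorder_cases;
          cases i1 i3 rule: linorder_cases) auto
    then show ?thesis
    proof cases
    qed (use [[linarith_neq_limit = 0]] in \<open>insert 3 up, unfold sc d, (simp add: H1' H2' A1 mem; simp add: algebra_simps QP)+\<close>)
  next
    case 4
    have "i1 \<le> i2" "i2 \<le> i3" using s1 s2 4 by simp_all
    then consider "i1 < i2" "i2 < i3" |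
      "i1 = i2" "i2 < i3" |
      "i2 = i3" "i1 < i2" |
      "i1 = i2" "i2 = i3"
      by (cases i1 i2 rule: linorder_cases; cases i2 i3 rule: linorder_cases;
          cases i1 i3 rule: linorder_cases) auto
    then show ?thesis
    proof cases
    qed (use [[linarith_neq_limit = 0]] in \<open>insert 4 up, unfold sc d, (simp add: H1' H2' A1 mem; simp add: algebra_simps QP)+\<close>)
  qed
qed

section \<open>Matrices of all sizes as elements of one algebra\<close>

text \<open>
  Linear endomorphisms of the space of sequences. Square matrices of every size embed into this one
  type, so identities in real algebras apply to representations of arbitrary dimension.
\<close>

typedef endo = "{f :: (nat \<Rightarrow> complex) \<Rightarrow> nat \<Rightarrow> complex.
    (\<forall>x y. f (\<lambda>i. x i + y i) = (\<lambda>i. f x i + f y i)) \<and> (\<forall>c x. f (\<lambda>i. c * x i) = (\<lambda>i. c * f x i))}"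
  by (rule exI[of _ "\<lambda>x. x"]) simp

setup_lifting type_definition_endo

instantiation endo :: real_algebra_1
begin

lift_definition zero_endo :: endo is "\<lambda>x i. 0" by simp
lift_definition one_endo :: endo is "\<lambda>x. x" by simp
lift_definition plus_endo :: "endo \<Rightarrow> endo \<Rightarrow> endo" is "\<lambda>f g x i. f x i + g x i"
  by (simp add: algebra_simps)
lift_definition minus_endo :: "endo \<Rightarrow> endo \<Rightarrow> endo" is "\<lambda>f g x i. f x i - g x i"
  by (simp add: algebra_simps)
lift_definition uminus_endo :: "endo \<Rightarrow> endo" is "\<lambda>f x i. - f x i"
  by (simp add: algebra_simps)
lift_definition times_endo :: "endo \<Rightarrow> endo \<Rightarrow> endo" is "\<lambda>f g x. f (g x)"
  by simp
lift_definition scaleR_endo :: "real \<Rightarrow> endo \<Rightarrow> endo" is "\<lambda>r f x i. of_real r * f x i"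
  by (simp add: algebra_simps)

instance
proof
  show "(0 :: endo) \<noteq> 1"
    by transfer (metis zero_neq_one)
qed ((transfer; (auto simp: algebra_simps fun_eq_iff)?)+)

end

lift_definition mat_endo :: "complex mat \<Rightarrow> endo" is
  "\<lambda>A x i. if i < dim_row A then \<Sum>j<dim_col A. A $$ (i, j) * x j else 0"
  by (auto simp: fun_eq_iff sum.distrib sum_distrib_left algebra_simps)

lemma mat_endo_add: "A \<in> carrier_mat d d \<Longrightarrow> B \<in> carrier_mat d d \<Longrightarrow> mat_endo (A + B) = mat_endo A + mat_endo B"
  by transfer (auto simp: fun_eq_iff sum.distrib algebra_simps)

lemma mat_endo_mult: "A \<in> carrier_mat d d \<Longrightarrow> B \<in> carrier_mat d d \<Longrightarrow> mat_endo (A * B) = mat_endo A * mat_endo B"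
proof (transfer fixing: d, intro ext)
  fix A B :: "complex mat" and x i
  assume A: "A \<in> carrier_mat d d" and B: "B \<in> carrier_mat d d"
  have "(\<Sum>j<d. (A * B) $$ (i, j) * x j) = (\<Sum>k<d. A $$ (i, k) * (\<Sum>j<d. B $$ (k, j) * x j))" if "i < d"
  proof -
    have "(\<Sum>j<d. (A * B) $$ (i, j) * x j) = (\<Sum>j<d. (\<Sum>k<d. A $$ (i, k) * B $$ (k, j)) * x j)"
      using A B that by (intro sum.cong) (auto simp: scalar_prod_def atLeast0LessThan)
    also have "\<dots> = (\<Sum>j<d. \<Sum>k<d. A $$ (i, k) * (B $$ (k, j) * x j))"
      by (simp add: sum_distrib_right mult.assoc)
    also have "\<dots> = (\<Sum>k<d. A $$ (i, k) * (\<Sum>j<d. B $$ (k, j) * x j))"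
      by (subst sum.swap) (simp add: sum_distrib_left)
    finally show ?thesis .
  qed
  then show "(if i < dim_row (A * B) then \<Sum>j<dim_col (A * B). (A * B) $$ (i, j) * x j else 0) =
    (if i < dim_row A then \<Sum>j<dim_col A. A $$ (i, j) * (if j < dim_row B then \<Sum>ja<dim_col B. B $$ (j, ja) * x ja else 0) else 0)"
    using A B by simp
qed

lemma mat_endo_smult: "mat_endo (of_real r \<cdot>\<^sub>m A) = r *\<^sub>R mat_endo A"
  by transfer (auto simp: fun_eq_iff sum_distrib_left algebra_simps)

section \<open>Commutation relations between iterated brackets\<close>

lemma q_commute_prod:
  fixes x y z :: "'a :: real_algebra"
  assumes "x * y = s *\<^sub>R (y * x)" "x * z = t *\<^sub>R (z * x)"
  shows "x * (y * z) = (s * t) *\<^sub>R (y * z * x)"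
proof -
  have "x * (y * z) = (x * y) * z" by (simp add: mult.assoc)
  also have "\<dots> = s *\<^sub>R (y * (x * z))" by (simp add: assms mult.assoc)
  also have "\<dots> = (s * t) *\<^sub>R (y * z * x)" by (simp add: assms mult.assoc)
  finally show ?thesis .
qed

lemma q_commute_prod':
  fixes x y z :: "'a :: real_algebra"
  assumes "y * x = s *\<^sub>R (x * y)" "z * x = t *\<^sub>R (x * z)"
  shows "y * z * x = (s * t) *\<^sub>R (x * (y * z))"
proof -
  have "y * z * x = y * (z * x)" by (simp add: mult.assoc)
  also have "\<dots> = t *\<^sub>R (y * x * z)" by (simp add: assms(2) mult.assoc)
  also have "\<dots> = (s * t) *\<^sub>R (x * (y * z))" unfolding assms(1) by (simp add: mult.assoc mult.commute)
  finally show ?thesis .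
qed

text \<open>
  An element that commutes with \<open>y\<close> and \<open>z\<close> up to scalars commutes with their bracket up to the product
  of the scalars. This is what makes the inductions over iterated brackets work.
\<close>

lemma q_commute_qcomm:
  fixes x y z :: "'a :: real_algebra"
  assumes "x * y = s *\<^sub>R (y * x)" "x * z = t *\<^sub>R (z * x)"
  shows "x * (y * z - r *\<^sub>R (z * y)) = (s * t) *\<^sub>R ((y * z - r *\<^sub>R (z * y)) * x)"
  using q_commute_prod[OF assms] q_commute_prod[OF assms(2,1)]
  by (simp add: right_diff_distrib left_diff_distrib scaleR_diff_right mult.commute)

lemma q_commute_qcomm':
  fixes x y z :: "'a :: real_algebra"
  assumes "y * x = s *\<^sub>R (x * y)" "z * x = t *\<^sub>R (x * z)"
  shows "(y * z - r *\<^sub>R (z * y)) * x = (s * t) *\<^sub>R (x * (y * z - r *\<^sub>R (z * y)))"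
  using q_commute_prod'[OF assms] q_commute_prod'[OF assms(2,1)]
  by (simp add: right_diff_distrib left_diff_distrib scaleR_diff_right mult.commute)

text \<open>
  Let \<open>C = Z * Y - Y * Z\<close>. Expanding \<open>b * X\<close> with the two expressions for \<open>X\<close> gives
  \<open>q\<^sup>2 (X * b) - q C\<close> and \<open>(1/q\<^sup>2) (X * b) + (1/q) C\<close>. Since \<open>q + 1/q \<noteq> 0\<close> for real \<open>q\<close>, comparing them
  determines \<open>C\<close>, and then \<open>b * X\<close>.
\<close>

lemma nested_and_crossing:
  fixes a b c :: "'a :: real_algebra"
  assumes q: "q \<noteq> 0" and ac: "a * c = c * a"
    and Y: "Y = b * a - (1/q) *\<^sub>R (a * b)" and Z: "Z = c * b - (1/q) *\<^sub>R (b * c)"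
    and XY: "X = c * Y - (1/q) *\<^sub>R (Y * c)" and XZ: "X = Z * a - (1/q) *\<^sub>R (a * Z)"
    and bY: "b * Y = q *\<^sub>R (Y * b)" and Zb: "Z * b = q *\<^sub>R (b * Z)"
  shows "b * X = X * b" and "Z * Y - Y * Z = (q - 1/q) *\<^sub>R (X * b)"
proof -
  define p where "p = 1/q"
  have qp: "q * p = 1" "p * q = 1" using q by (simp_all add: p_def)
  have bc: "b * c = q *\<^sub>R (c * b) - q *\<^sub>R Z" using Z q by (simp add: scaleR_diff_right)
  have ba: "b * a = Y + p *\<^sub>R (a * b)" using Y by (simp add: p_def)
  have cY: "c * Y = X + p *\<^sub>R (Y * c)" using XY by (simp add: p_def)
  have Za: "Z * a = X + p *\<^sub>R (a * Z)" using XZ by (simp add: p_def)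
  have bZ: "b * Z = p *\<^sub>R (Z * b)" using Zb q by (simp add: p_def)
  define C where "C = Z * Y - Y * Z"
  have 1: "b * X = (q * q) *\<^sub>R (X * b) - q *\<^sub>R C"
  proof -
    have "b * X = (b * c) * Y - p *\<^sub>R ((b * Y) * c)" by (simp add: XY p_def right_diff_distrib mult.assoc)
    also have "\<dots> = q *\<^sub>R (c * (b * Y)) - q *\<^sub>R (Z * Y) - Y * (b * c)"
      by (simp add: bc bY left_diff_distrib qp mult.assoc)
    also have "c * (b * Y) = q *\<^sub>R ((c * Y) * b)" by (simp add: bY mult.assoc)
    also have "(c * Y) * b = X * b + p *\<^sub>R (Y * c * b)" by (simp add: cY distrib_right)
    also have "Y * (b * c) = q *\<^sub>R (Y * c * b) - q *\<^sub>R (Y * Z)" by (simp add: bc right_diff_distrib mult.assoc)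
    finally show ?thesis by (simp add: C_def qp scaleR_add_right scaleR_diff_right mult.assoc)
  qed
  have 2: "b * X = (p * p) *\<^sub>R (X * b) + p *\<^sub>R C"
  proof -
    have "b * X = (b * Z) * a - p *\<^sub>R ((b * a) * Z)" by (simp add: XZ p_def right_diff_distrib mult.assoc)
    also have "\<dots> = p *\<^sub>R (Z * (b * a)) - p *\<^sub>R (Y * Z) - (p * p) *\<^sub>R (a * (b * Z))"
      by (simp add: bZ ba distrib_right scaleR_add_right mult.assoc)
    also have "Z * (b * a) = Z * Y + p *\<^sub>R ((Z * a) * b)" by (simp add: ba distrib_left mult.assoc)
    also have "(Z * a) * b = X * b + p *\<^sub>R (a * Z * b)" by (simp add: Za distrib_right)
    also have "a * (b * Z) = p *\<^sub>R (a * Z * b)" by (simp add: bZ mult.assoc)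
    finally show ?thesis by (simp add: C_def scaleR_add_right scaleR_diff_right mult.assoc)
  qed
  have qq: "q + p \<noteq> 0"
  proof
    assume "q + p = 0"
    then have "q * q + 1 = 0" using qp by (metis distrib_left mult_zero_right)
    moreover have "q * q \<ge> 0" by simp
    ultimately show False by linarith
  qed
  have "(q + p) *\<^sub>R C = (q * q - p * p) *\<^sub>R (X * b)"
    using 1 2 by (simp add: scaleR_left_distrib scaleR_left_diff_distrib algebra_simps)
  also have "\<dots> = (q + p) *\<^sub>R ((q - p) *\<^sub>R (X * b))" by (simp add: algebra_simps)
  finally have C: "C = (q - p) *\<^sub>R (X * b)" using qq scaleR_cancel_left by blast
  then show "Z * Y - Y * Z = (q - 1/q) *\<^sub>R (X * b)" by (simp add: C_def p_def)
  show "b * X = X * b" unfolding 1 C using qp by (simp add: algebra_simps scaleR_diff_left)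
qed


locale serre_generators =
  fixes q :: real and E :: "nat \<Rightarrow> 'a :: real_algebra"
  assumes q_nonzero: "q \<noteq> 0"
    and far: "Suc i < j \<Longrightarrow> E i * E j = E j * E i"
    and serre_up: "E i * E i * E (Suc i) - (q + 1 / q) *\<^sub>R (E i * E (Suc i) * E i) + E (Suc i) * E i * E i = 0"
    and serre_down: "E (Suc i) * E (Suc i) * E i - (q + 1 / q) *\<^sub>R (E (Suc i) * E i * E (Suc i)) +
      E i * E (Suc i) * E (Suc i) = 0"
begin

text \<open>
  The iterated bracket that defines the root vector of \<open>(i, j)\<close>.
\<close>

fun X :: "nat \<Rightarrow> nat \<Rightarrow> 'a" where
  "X i 0 = 0"
| "X i (Suc j) = (if j \<le> i then E i else E j * X i j - (1 / q) *\<^sub>R (X i j * E j))"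

lemma X_simple: "X i (Suc i) = E i"
  by simp

lemma X_step: "i < j \<Longrightarrow> X i (Suc j) = E j * X i j - (1 / q) *\<^sub>R (X i j * E j)"
  by simp

declare X.simps[simp del]

lemma E_X_far:
  assumes "Suc i \<le> j" and "Suc k < i \<or> j < k"
  shows "E k * X i j = X i j * E k"
  using assms
proof (induction j rule: nat_induct_at_least)
  case base
  then show ?case using far[of k i] far[of i k] by (auto simp: X_simple)
next
  case (Suc j)
  then have "E k * E j = 1 *\<^sub>R (E j * E k)" "E k * X i j = 1 *\<^sub>R (X i j * E k)"
    using far[of k j] far[of j k] by auto
  from q_commute_qcomm[OF this, of "1/q"] Suc.hyps show ?case by (simp add: X_step)
qed

lemma X_X_far:
  assumes "i < j" "j < k" "Suc k \<le> l"
  shows "X i j * X k l = X k l * X i j"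
  using assms(3)
proof (induction l rule: nat_induct_at_least)
  case base
  then show ?case using E_X_far[of i j k] assms by (simp add: X_simple)
next
  case (Suc l)
  then have "X i j * E l = 1 *\<^sub>R (E l * X i j)" "X i j * X k l = 1 *\<^sub>R (X k l * X i j)"
    using E_X_far[of i j l] assms by auto
  from q_commute_qcomm[OF this, of "1/q"] Suc.hyps show ?case by (simp add: X_step)
qed

text \<open>
  The bracket may be cut at any inner position, because \<open>E l\<close> commutes with the part \<open>X i j\<close>.
\<close>

lemma X_split:
  assumes "i < j" "Suc j \<le> l"
  shows "X i l = X j l * X i j - (1 / q) *\<^sub>R (X i j * X j l)"
  using assms(2)
proof (induction l rule: nat_induct_at_least)
  case base
  then show ?case using assms by (simp add: X_simple X_step)
next
  case (Suc l)
  have c: "E l * X i j = X i j * E l" using E_X_far[of i j l] assms Suc.hyps by auto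
  have "X i (Suc l) = E l * X i l - (1 / q) *\<^sub>R (X i l * E l)"
    using assms Suc.hyps by (simp add: X_step)
  also have "\<dots> = E l * X j l * X i j - (1 / q) *\<^sub>R (E l * X i j * X j l) -
      (1 / q) *\<^sub>R (X j l * (X i j * E l)) + (1 / q * (1 / q)) *\<^sub>R (X i j * X j l * E l)"
    unfolding Suc.IH by (simp add: algebra_simps)
  also have "\<dots> = X j (Suc l) * X i j - (1 / q) *\<^sub>R (X i j * X j (Suc l))"
  proof -
    have 1: "E l * X i j * X j l = X i j * (E l * X j l)" by (simp add: c mult.assoc)
    have 2: "X j l * (X i j * E l) = X j l * E l * X i j" by (simp add: c[symmetric] mult.assoc)
    have 3: "X j (Suc l) = E l * X j l - (1 / q) *\<^sub>R (X j l * E l)" using Suc.hyps by (simp add: X_step)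
    show ?thesis unfolding 1 2 3 by (simp add: algebra_simps)
  qed
  finally show ?case .
qed

text \<open>
  The Serre relation is the case \<open>j = i + 2\<close>; the other cases follow by cutting at \<open>i + 2\<close>.
\<close>

lemma X_E_start:
  assumes "Suc (Suc i) \<le> j"
  shows "X i j * E i = q *\<^sub>R (E i * X i j)"
proof -
  have base: "X i (Suc (Suc i)) * E i = q *\<^sub>R (E i * X i (Suc (Suc i)))"
    using serre_up[of i] q_nonzero by (simp add: X_step X_simple algebra_simps)
  show ?thesis
  proof (cases "j = Suc (Suc i)")
    case True
    then show ?thesis using base by simp
  next
    case False
    then have j: "Suc (Suc (Suc i)) \<le> j" using assms by simp
    then have "X (Suc (Suc i)) j * E i = 1 *\<^sub>R (E i * X (Suc (Suc i)) j)"
      using E_X_far[of "Suc (Suc i)" j i] by simp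
    from q_commute_qcomm'[OF this base, of "1/q"] X_split[of i "Suc (Suc i)" j] j
    show ?thesis by simp
  qed
qed

lemma E_X_end:
  assumes "i < j"
  shows "E j * X i (Suc j) = q *\<^sub>R (X i (Suc j) * E j)"
proof -
  obtain k where k: "j = Suc k" using assms by (cases j) auto
  have base: "E j * X k (Suc j) = q *\<^sub>R (X k (Suc j) * E j)"
    using serre_down[of k] q_nonzero by (simp add: k X_step X_simple algebra_simps)
  show ?thesis
  proof (cases "i = k")
    case True
    then show ?thesis using base by simp
  next
    case False
    then have i: "Suc i \<le> k" using assms k by simp
    then have "E j * X i k = 1 *\<^sub>R (X i k * E j)"
      using E_X_far[of i k j] by (simp add: k)
    from q_commute_qcomm[OF base this, of "1/q"] X_split[of i k "Suc j"] i k
    show ?thesis by simp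
  qed
qed

text \<open>
  An instance of the nested position with \<open>b = E k\<close> between \<open>a = X i k\<close> and \<open>c = X (k + 1) j\<close>.
\<close>

lemma E_X_inner:
  assumes "i < k" "Suc k < j"
  shows "E k * X i j = X i j * E k"
proof (rule nested_and_crossing(1)[OF q_nonzero])
  show "X i k * X (Suc k) j = X (Suc k) j * X i k" using assms by (intro X_X_far) auto
  show "X i (Suc k) = E k * X i k - (1 / q) *\<^sub>R (X i k * E k)" using assms by (simp add: X_step)
  show "X k j = X (Suc k) j * E k - (1 / q) *\<^sub>R (E k * X (Suc k) j)"
    using X_split[of k "Suc k" j] assms by (simp add: X_simple)
  show "X i j = X (Suc k) j * X i (Suc k) - (1 / q) *\<^sub>R (X i (Suc k) * X (Suc k) j)"
    using X_split[of i "Suc k" j] assms by simp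
  show "X i j = X k j * X i k - (1 / q) *\<^sub>R (X i k * X k j)"
    using X_split[of i k j] assms by simp
  show "E k * X i (Suc k) = q *\<^sub>R (X i (Suc k) * E k)" using assms by (rule_tac E_X_end)
  show "X k j * E k = q *\<^sub>R (E k * X k j)" using assms by (intro X_E_start) simp
qed

lemma X_same_start:
  assumes "Suc k \<le> j" "j < l"
  shows "X k l * X k j = q *\<^sub>R (X k j * X k l)"
  using assms
proof (induction j rule: nat_induct_at_least)
  case base
  then show ?case using X_E_start[of k l] by (simp add: X_simple)
next
  case (Suc j)
  then have "E j * X k l = 1 *\<^sub>R (X k l * E j)" "X k l * X k j = q *\<^sub>R (X k j * X k l)"
    using E_X_inner[of k j l] by auto
  from q_commute_qcomm[OF _ this(2), of "E j" 1 "1/q"] this(1) Suc.hyps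
  show ?case by (simp add: X_step)
qed

lemma X_same_end:
  assumes "i < k" "k < j"
  shows "X k j * X i j = q *\<^sub>R (X i j * X k j)"
proof -
  have "k \<le> j - 1" using assms by simp
  then show ?thesis using assms(1)
  proof (induction k rule: inc_induct)
    case base
    then show ?case using E_X_end[of i "j - 1"] assms X_simple[of "j - 1"] by simp
  next
    case (step k)
    then have "E k * X i j = 1 *\<^sub>R (X i j * E k)" "X (Suc k) j * X i j = q *\<^sub>R (X i j * X (Suc k) j)"
      using E_X_inner[of i k j] by auto
    from q_commute_qcomm'[OF this(2,1), of "1/q"] X_split[of k "Suc k" j] step.hyps assms
    show ?case by (simp add: X_simple)
  qed
qed

text \<open>
  Cutting at \<open>k\<close> and \<open>j\<close> puts \<open>b = X k j\<close> between the commuting elements \<open>a = X i k\<close> and \<open>c = X j l\<close>.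
\<close>

lemma
  assumes "i < k" "k < j" "j < l"
  shows X_nested: "X k j * X i l = X i l * X k j"
    and X_crossing: "X k l * X i j - X i j * X k l = (q - 1 / q) *\<^sub>R (X i l * X k j)"
proof -
  have 1: "X i k * X j l = X j l * X i k" using assms by (intro X_X_far) auto
  have 2: "X i j = X k j * X i k - (1 / q) *\<^sub>R (X i k * X k j)" using X_split[of i k j] assms by simp
  have 3: "X k l = X j l * X k j - (1 / q) *\<^sub>R (X k j * X j l)" using X_split[of k j l] assms by simp
  have 4: "X i l = X j l * X i j - (1 / q) *\<^sub>R (X i j * X j l)" using X_split[of i j l] assms by simp
  have 5: "X i l = X k l * X i k - (1 / q) *\<^sub>R (X i k * X k l)" using X_split[of i k l] assms by simp
  have 6: "X k j * X i j = q *\<^sub>R (X i j * X k j)" using assms by (intro X_same_end) auto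
  have 7: "X k l * X k j = q *\<^sub>R (X k j * X k l)" using assms by (intro X_same_start) auto
  show "X k j * X i l = X i l * X k j" "X k l * X i j - X i j * X k l = (q - 1 / q) *\<^sub>R (X i l * X k j)"
    using nested_and_crossing[OF q_nonzero 1 2 3 4 5 6 7] by auto
qed

end

section \<open>Free algebras\<close>

lemma fmon_append: "fmon (u @ v) = fmon u * fmon v"
  by (simp add: fmon_def mult_single plus_fword_def)

lemma fmon_Nil: "fmon [] = 1"
  by (simp add: fmon_def single_one[symmetric] zero_fword_def)

lemma fmon_Cons: "fmon (x # v) = fvar x * fmon v"
  using fmon_append[of "[x]" v] by simp

lemma fconst_mult: "fconst c * fconst d = fconst (c * d)"
  by (simp add: fconst_def mult_single)

lemma fconst_add: "fconst c + fconst d = fconst (c + d)"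
  by (simp add: fconst_def single_add)

lemma fconst_1: "fconst 1 = 1"
  by (simp add: fconst_def)

lemma fconst_0: "fconst 0 = 0"
  by (simp add: fconst_def)

lemma fconst_fmon: "fconst c * fmon w = Poly_Mapping.single (FWord w) c"
  by (simp add: fconst_def fmon_def mult_single)

lemma falg_sum_monomials:
  "p = (\<Sum>w\<in>Poly_Mapping.keys p. fconst (Poly_Mapping.lookup p w) * fmon (letters w))"
proof (rule poly_mapping_eqI)
  fix w
  show "Poly_Mapping.lookup p w =
    Poly_Mapping.lookup (\<Sum>w\<in>Poly_Mapping.keys p. fconst (Poly_Mapping.lookup p w) * fmon (letters w)) w"
    by (simp add: fconst_fmon lookup_sum lookup_single when_def in_keys_iff)
qed

lemma falg_induct [consumes 1, case_names zero add monom]: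
  assumes p: "p \<in> carrier (free_algebra X)"
    and 0: "P 0" and add: "\<And>p q. p \<in> carrier (free_algebra X) \<Longrightarrow> q \<in> carrier (free_algebra X) \<Longrightarrow> P p \<Longrightarrow> P q \<Longrightarrow> P (p + q)"
    and monom: "\<And>c w. set w \<subseteq> X \<Longrightarrow> P (fconst c * fmon w)"
  shows "P p"
proof -
  have mon: "fconst c * fmon w \<in> carrier (free_algebra X)" if "set w \<subseteq> X" for c w
    using that by (auto simp: fconst_fmon free_algebra_def)
  have "finite A \<Longrightarrow> (\<And>w. w \<in> A \<Longrightarrow> set (letters w) \<subseteq> X) \<Longrightarrow>
      (\<Sum>w\<in>A. fconst (f w) * fmon (letters w)) \<in> carrier (free_algebra X) \<and>
      P (\<Sum>w\<in>A. fconst (f w) * fmon (letters w))" for A and f :: "'a fword \<Rightarrow> complex"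
  proof (induction A rule: finite_induct)
    case empty
    then show ?case using 0 by (simp add: free_algebra_def)
  next
    case (insert w A)
    have "a + b \<in> carrier (free_algebra X)" if "a \<in> carrier (free_algebra X)" "b \<in> carrier (free_algebra X)"
      for a b :: "'a falg"
      using that keys_add[of a b] by (auto simp: free_algebra_def)
    with insert show ?case using mon[of "letters w" "f w"] monom[of "letters w" "f w"]
      by (simp add: add)
  qed
  from this[of "Poly_Mapping.keys p" "Poly_Mapping.lookup p"] p show ?thesis
    by (auto simp: falg_sum_monomials[of p, symmetric] free_algebra_def)
qed

lemma free_algebra_UNIV: "p \<in> carrier (free_algebra UNIV)"
  by (simp add: free_algebra_def)

lemma fconst_central: "fconst c * p = p * fconst c"
  using free_algebra_UNIV[of p]
  by (induction rule: falg_induct)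
    (simp_all add: algebra_simps fconst_fmon, simp add: fconst_def mult_single mult.commute)

lemma falg_carrier_add:
  "p \<in> carrier (free_algebra X) \<Longrightarrow> r \<in> carrier (free_algebra X) \<Longrightarrow> p + r \<in> carrier (free_algebra X)"
  using keys_add[of p r] by (auto simp: free_algebra_def)

lemma falg_carrier_mult:
  "p \<in> carrier (free_algebra X) \<Longrightarrow> r \<in> carrier (free_algebra X) \<Longrightarrow> p * r \<in> carrier (free_algebra X)"
  using keys_mult[of p r] by (fastforce simp: free_algebra_def plus_fword_def)

lemma falg_carrier_minus: "p \<in> carrier (free_algebra X) \<Longrightarrow> - p \<in> carrier (free_algebra X)"
  by (simp add: free_algebra_def)

lemma falg_carrier_diff:
  "p \<in> carrier (free_algebra X) \<Longrightarrow> r \<in> carrier (free_algebra X) \<Longrightarrow> p - r \<in> carrier (free_algebra X)"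
  using falg_carrier_add[of p X "- r"] falg_carrier_minus[of r X] by simp

lemma falg_carrier_fconst: "fconst c \<in> carrier (free_algebra X)"
  by (simp add: free_algebra_def fconst_def zero_fword_def)

lemma falg_carrier_fmon: "set w \<subseteq> X \<Longrightarrow> fmon w \<in> carrier (free_algebra X)"
  by (simp add: free_algebra_def fmon_def)

lemma falg_carrier_01: "0 \<in> carrier (free_algebra X)" "1 \<in> carrier (free_algebra X)"
  using falg_carrier_fmon[of "[]" X] by (simp_all add: fmon_Nil) (simp add: free_algebra_def)

lemmas falg_carrier = falg_carrier_add falg_carrier_mult falg_carrier_minus falg_carrier_diff
  falg_carrier_fconst falg_carrier_fmon falg_carrier_01

lemma free_algebra_simps:
  "mult (free_algebra X) = (*)" "one (free_algebra X) = 1" "zero (free_algebra X) = 0"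
  "add (free_algebra X) = (+)" "module.smult (free_algebra X) c p = fconst c * p"
  by (simp_all add: free_algebra_def)

lemma lin_ext_superset:
  assumes "finite A" "Poly_Mapping.keys p \<subseteq> A"
  shows "lin_ext f p = (\<Sum>w\<in>A. Poly_Mapping.lookup p w * f (letters w))"
  unfolding lin_ext_def using assms by (intro sum.mono_neutral_left) (auto simp: in_keys_iff)

lemma lin_ext_add: "lin_ext f (p + r) = lin_ext f p + lin_ext f r"
  using keys_add[of p r]
  by (simp add: lin_ext_superset[of "Poly_Mapping.keys p \<union> Poly_Mapping.keys r"]
      lookup_add algebra_simps sum.distrib)

lemma lin_ext_monom: "lin_ext f (fconst c * fmon w) = c * f w"
  by (simp add: fconst_fmon lin_ext_superset[of "{FWord w}"])

lemma lin_ext_fmon: "lin_ext f (fmon w) = f w"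
  using lin_ext_monom[of f 1 w] by (simp add: fconst_1)

lemma lin_ext_0: "lin_ext f 0 = 0"
  by (simp add: lin_ext_def)

lemma lin_ext_fconst_mult: "lin_ext f (fconst c * p) = c * lin_ext f p"
  using free_algebra_UNIV[of p]
proof (induction rule: falg_induct)
  case (monom d w)
  then show ?case by (simp add: mult.assoc[symmetric] fconst_mult lin_ext_monom)
qed (simp_all add: lin_ext_0 lin_ext_add algebra_simps)

lemma lin_ext_minus: "lin_ext f (- p) = - lin_ext f p"
  using lin_ext_add[of f p "- p"] by (simp add: lin_ext_0 add_eq_0_iff)

lemma lin_ext_diff: "lin_ext f (p - r) = lin_ext f p - lin_ext f r"
  using lin_ext_add[of f p "- r"] by (simp add: lin_ext_minus)

lemma lin_ext_sum: "lin_ext f (\<Sum>i\<in>A. p i) = (\<Sum>i\<in>A. lin_ext f (p i))"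
  by (induction A rule: infinite_finite_induct) (simp_all add: lin_ext_0 lin_ext_add)

text \<open>
  If a functional on words has a coproduct \<open>\<Sum> g\<^sub>k \<otimes> h\<^sub>k\<close> with respect to concatenation, its linear extension
  has the same coproduct with respect to the product of polynomials.
\<close>

lemma lin_ext_mult:
  assumes "\<And>u v. set u \<subseteq> X \<Longrightarrow> set v \<subseteq> X \<Longrightarrow> f (u @ v) = (\<Sum>k\<in>A. g k u * h k v)"
    and "p \<in> carrier (free_algebra X)" "r \<in> carrier (free_algebra X)"
  shows "lin_ext f (p * r) = (\<Sum>k\<in>A. lin_ext (g k) p * lin_ext (h k) r)"
  using assms(2)
proof (induction rule: falg_induct)
  case zero
  show ?case by (simp add: lin_ext_0)
next
  case (add p p')
  then show ?case by (simp add: lin_ext_add distrib_right sum.distrib)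
next
  case (monom c w)
  from assms(3) show ?case
  proof (induction rule: falg_induct)
    case zero
    show ?case by (simp add: lin_ext_0)
  next
    case (add p p')
    then show ?case by (simp add: lin_ext_add distrib_left sum.distrib)
  next
    case (monom d v)
    have "fconst c * fmon w * (fconst d * fmon v) = fconst (c * d) * fmon (w @ v)"
      by (simp add: fconst_fmon mult_single plus_fword_def)
    moreover have "f (w @ v) = (\<Sum>k\<in>A. g k w * h k v)"
      using monom \<open>set w \<subseteq> X\<close> by (simp add: assms(1))
    ultimately show ?case
      by (simp add: lin_ext_monom sum_distrib_left mult.assoc) (simp add: mult.left_commute)
  qed
qed

section \<open>Associative algebras and their quotients\<close>

locale assoc_algebra = Rng?: ring M + Mod?: Module.module "class_ring :: complex ring" M
  for M :: "(complex, 'a) module" (structure) +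
  assumes smult_mult_left: "x \<in> carrier M \<Longrightarrow> y \<in> carrier M \<Longrightarrow> (c \<odot> x) \<otimes> y = c \<odot> (x \<otimes> y)"
    and smult_mult_right: "x \<in> carrier M \<Longrightarrow> y \<in> carrier M \<Longrightarrow> x \<otimes> (c \<odot> y) = c \<odot> (x \<otimes> y)"

lemma assoc_algebraI:
  assumes "ring M"
    and "\<And>c x. x \<in> carrier M \<Longrightarrow> c \<odot>\<^bsub>M\<^esub> x \<in> carrier M"
    and "\<And>c d x. x \<in> carrier M \<Longrightarrow> (c + d) \<odot>\<^bsub>M\<^esub> x = c \<odot>\<^bsub>M\<^esub> x \<oplus>\<^bsub>M\<^esub> d \<odot>\<^bsub>M\<^esub> x"
    and "\<And>c x y. x \<in> carrier M \<Longrightarrow> y \<in> carrier M \<Longrightarrow> c \<odot>\<^bsub>M\<^esub> (x \<oplus>\<^bsub>M\<^esub> y) = c \<odot>\<^bsub>M\<^esub> x \<oplus>\<^bsub>M\<^esub> c \<odot>\<^bsub>M\<^esub> y"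
    and "\<And>c d x. x \<in> carrier M \<Longrightarrow> (c * d) \<odot>\<^bsub>M\<^esub> x = c \<odot>\<^bsub>M\<^esub> (d \<odot>\<^bsub>M\<^esub> x)"
    and "\<And>x. x \<in> carrier M \<Longrightarrow> (1 :: complex) \<odot>\<^bsub>M\<^esub> x = x"
    and "\<And>c x y. x \<in> carrier M \<Longrightarrow> y \<in> carrier M \<Longrightarrow> (c \<odot>\<^bsub>M\<^esub> x) \<otimes>\<^bsub>M\<^esub> y = c \<odot>\<^bsub>M\<^esub> (x \<otimes>\<^bsub>M\<^esub> y)"
    and "\<And>c x y. x \<in> carrier M \<Longrightarrow> y \<in> carrier M \<Longrightarrow> x \<otimes>\<^bsub>M\<^esub> (c \<odot>\<^bsub>M\<^esub> y) = c \<odot>\<^bsub>M\<^esub> (x \<otimes>\<^bsub>M\<^esub> y)"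
  shows "assoc_algebra M"
proof -
  interpret ring M by fact
  have "cring (class_ring :: complex ring)"
    by (rule field.axioms(1)[THEN domain.axioms(1)]) (rule class_field)
  then have "Module.module (class_ring :: complex ring) M"
    by (rule moduleI) (simp_all add: assms abelian_group_axioms)
  with assms(1) show ?thesis
    by (intro assoc_algebra.intro assoc_algebra_axioms.intro) (simp_all add: assms)
qed

lemma fconst_mult_right: "p * (fconst c * r) = fconst c * (p * r)"
proof -
  have "p * (fconst c * r) = (p * fconst c) * r" by (simp only: mult.assoc)
  also have "\<dots> = fconst c * (p * r)" by (simp only: fconst_central[symmetric] mult.assoc)
  finally show ?thesis .
qed

lemma assoc_algebra_free: "assoc_algebra (free_algebra X)"
proof (rule assoc_algebraI)
  show "ring (free_algebra X)"
  proof (rule ringI)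
    show "abelian_group (free_algebra X)"
    proof (rule abelian_groupI)
      fix x assume "x \<in> carrier (free_algebra X)"
      then show "\<exists>y\<in>carrier (free_algebra X). y \<oplus>\<^bsub>free_algebra X\<^esub> x = \<zero>\<^bsub>free_algebra X\<^esub>"
        by (intro bexI[of _ "- x"]) (auto simp: free_algebra_simps falg_carrier)
    qed (auto simp: free_algebra_simps falg_carrier algebra_simps)
  qed (auto simp: free_algebra_simps falg_carrier algebra_simps intro!: monoidI)
  fix c x y assume "x \<in> carrier (free_algebra X)" "y \<in> carrier (free_algebra X)"
  show "x \<otimes>\<^bsub>free_algebra X\<^esub> (c \<odot>\<^bsub>free_algebra X\<^esub> y) = c \<odot>\<^bsub>free_algebra X\<^esub> (x \<otimes>\<^bsub>free_algebra X\<^esub> y)"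
    unfolding free_algebra_simps by (rule fconst_mult_right)
qed (simp_all add: free_algebra_simps falg_carrier fconst_1 fconst_add[symmetric] distrib_right distrib_left
    fconst_mult[symmetric] mult.assoc)

context assoc_algebra
begin

lemma vectorspace: "vectorspace (class_ring :: complex ring) M"
  unfolding vectorspace_def by (simp add: class_field module_axioms)

lemma smult_add_scalar: "x \<in> carrier M \<Longrightarrow> (c + d) \<odot> x = c \<odot> x \<oplus> d \<odot> x"
  using smult_l_distr[of c d x] by simp

lemma smult_mult_scalar: "x \<in> carrier M \<Longrightarrow> (c * d) \<odot> x = c \<odot> (d \<odot> x)"
  using smult_assoc1[of c d x] by simp

lemma smult_one_scalar: "x \<in> carrier M \<Longrightarrow> 1 \<odot> x = x"
  using smult_one[of x] by simp

text \<open>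
  Scalars act as multiplication by multiples of the unit, so ideals of rings are subspaces.
\<close>

lemma ideal_smult:
  assumes "ideal J M" "x \<in> J"
  shows "c \<odot> x \<in> J"
proof -
  interpret J: ideal J M by fact
  have x: "x \<in> carrier M" using assms(2) by (rule J.a_Hcarr)
  have "(c \<odot> \<one>) \<otimes> x \<in> J" using assms by (intro J.I_l_closed) auto
  then show ?thesis using x by (simp add: smult_mult_left)
qed

end


locale vs_quotient = A?: Module.module "class_ring :: complex ring" M + J: abelian_subgroup J M
  for M :: "(complex, 'a) module" (structure) and J +
  assumes smult_J: "x \<in> J \<Longrightarrow> c \<odot> x \<in> J"
begin

abbreviation "V \<equiv> vs_quot M J"

lemma coset_closed: "x \<in> carrier M \<Longrightarrow> J +> x \<in> carrier V"
  by (simp add: vs_quot_def M.a_rcosetsI J.a_subset)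

lemma coset_cases:
  assumes "v \<in> carrier V"
  obtains x where "x \<in> carrier M" "v = J +> x"
  using assms by (auto simp: vs_quot_def A_RCOSETS_def RCOSETS_def a_r_coset_def)

lemma coset_add: "x \<in> carrier M \<Longrightarrow> y \<in> carrier M \<Longrightarrow> (J +> x) \<oplus>\<^bsub>V\<^esub> (J +> y) = J +> (x \<oplus> y)"
  by (simp add: vs_quot_def J.a_rcos_sum)

lemma coset_eqI: "x \<in> carrier M \<Longrightarrow> y \<in> carrier M \<Longrightarrow> x \<ominus> y \<in> J \<Longrightarrow> J +> x = J +> y"
  by (metis J.a_rcos_module_rev J.a_repr_independence' a_minus_def)

lemma coset_eqD: "x \<in> carrier M \<Longrightarrow> y \<in> carrier M \<Longrightarrow> J +> x = J +> y \<Longrightarrow> x \<ominus> y \<in> J"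
  by (metis J.a_rcos_module_imp J.a_rcos_self a_minus_def)

lemma coset_smult: 
  assumes x: "x \<in> carrier M"
  shows "c \<odot>\<^bsub>V\<^esub> (J +> x) = J +> (c \<odot> x)"
proof -
  have "J +> (c \<odot> y) = J +> (c \<odot> x)" if y: "y \<in> J +> x" for y
  proof (rule coset_eqI)
    have yc: "y \<in> carrier M" using y x M.a_r_coset_subset_G J.a_subset by blast
    then show "c \<odot> y \<in> carrier M" "c \<odot> x \<in> carrier M" using x by auto
    have "c \<odot> (y \<oplus> \<ominus> x) \<in> J" using J.a_rcos_module_imp[OF x y] by (rule smult_J)
    then show "c \<odot> y \<ominus> c \<odot> x \<in> J" using x yc by (simp add: a_minus_def smult_r_distr smult_r_minus)
  qed
  then have "(\<Union>y\<in>J +> x. J +> (c \<odot> y)) = (\<Union>y\<in>J +> x. J +> (c \<odot> x))"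
    by (rule SUP_cong[OF refl])
  moreover have "J +> x \<noteq> {}" using J.a_rcos_self[OF x] by blast
  ultimately show ?thesis by (simp add: vs_quot_def)
qed

end

locale algebra_quotient = A?: assoc_algebra M for M :: "(complex, 'a) module" (structure) +
  fixes S assumes S_subset: "S \<subseteq> carrier M"
begin

abbreviation "J \<equiv> Idl S"
abbreviation "Q \<equiv> alg_quot M S"
abbreviation "cls \<equiv> alg_cls M S"

sublocale I: ideal J M
  using S_subset by (rule Rng.genideal_ideal)

sublocale vs_quotient M J
  by (intro vs_quotient.intro vs_quotient_axioms.intro module_axioms I.abelian_subgroup_axioms)
    (auto intro: ideal_smult I.ideal_axioms)

lemma cls_closed: "x \<in> carrier M \<Longrightarrow> cls x \<in> carrier Q"
  using coset_closed by (simp add: alg_quot_def Let_def alg_cls_def)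

lemma cls_cases:
  assumes "v \<in> carrier Q"
  obtains x where "x \<in> carrier M" "v = cls x"
  using assms coset_cases by (auto simp: alg_quot_def Let_def alg_cls_def)

lemma cls_add: "x \<in> carrier M \<Longrightarrow> y \<in> carrier M \<Longrightarrow> cls x \<oplus>\<^bsub>Q\<^esub> cls y = cls (x \<oplus> y)"
  using coset_add by (simp add: alg_quot_def Let_def alg_cls_def)

lemma cls_smult: "x \<in> carrier M \<Longrightarrow> c \<odot>\<^bsub>Q\<^esub> cls x = cls (c \<odot> x)"
  using coset_smult by (simp add: alg_quot_def Let_def alg_cls_def)

lemma cls_mult: "x \<in> carrier M \<Longrightarrow> y \<in> carrier M \<Longrightarrow> cls x \<otimes>\<^bsub>Q\<^esub> cls y = cls (x \<otimes> y)"
  by (simp add: alg_quot_def FactRing_def alg_cls_def Let_def I.rcoset_mult_add)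

lemma cls_one: "\<one>\<^bsub>Q\<^esub> = cls \<one>"
  by (simp add: alg_quot_def FactRing_def alg_cls_def Let_def)

lemma cls_zero: "\<zero>\<^bsub>Q\<^esub> = cls \<zero>"
  using I.a_rcos_const[OF I.zero_closed] by (simp add: alg_quot_def vs_quot_def alg_cls_def Let_def)

lemma cls_eqI: "x \<in> carrier M \<Longrightarrow> y \<in> carrier M \<Longrightarrow> x \<ominus> y \<in> J \<Longrightarrow> cls x = cls y"
  unfolding alg_cls_def by (rule coset_eqI)

lemma cls_eqD: "x \<in> carrier M \<Longrightarrow> y \<in> carrier M \<Longrightarrow> cls x = cls y \<Longrightarrow> x \<ominus> y \<in> J"
  unfolding alg_cls_def by (rule coset_eqD)

lemma cls_eq_zero_iff: "x \<in> carrier M \<Longrightarrow> cls x = \<zero>\<^bsub>Q\<^esub> \<longleftrightarrow> x \<in> J"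
  using cls_eqI[of x "\<zero>\<^bsub>M\<^esub>"] cls_eqD[of x "\<zero>\<^bsub>M\<^esub>"]
  by (auto simp: cls_zero a_minus_def)

lemma cls_relator: "x \<in> S \<Longrightarrow> cls x = \<zero>\<^bsub>Q\<^esub>"
  using Rng.genideal_self[OF S_subset] S_subset cls_eq_zero_iff by blast

lemma assoc_algebra_Q: "assoc_algebra Q"
proof (rule assoc_algebraI)
  note simps = cls_add cls_mult cls_smult cls_one cls_zero cls_closed
  show "ring Q"
  proof (rule ringI)
    show "abelian_group Q"
    proof (rule abelian_groupI)
      fix x assume "x \<in> carrier Q"
      then show "\<exists>y\<in>carrier Q. y \<oplus>\<^bsub>Q\<^esub> x = \<zero>\<^bsub>Q\<^esub>"
      proof (elim cls_cases)
        fix y assume "y \<in> carrier M" "x = cls y"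
        then show ?thesis
          by (intro bexI[of _ "cls (\<ominus> y)"]) (simp_all add: simps Rng.l_neg)
      qed
    qed (auto elim!: cls_cases simp: simps Rng.a_ac)
    show "Group.monoid Q"
      by (rule monoidI) (auto elim!: cls_cases simp: simps Rng.m_assoc)
  qed (auto elim!: cls_cases simp: simps Rng.l_distr Rng.r_distr)
qed (auto elim!: cls_cases simp: cls_add cls_mult cls_smult cls_closed smult_add_scalar smult_r_distr smult_mult_scalar smult_one_scalar
      smult_mult_left smult_mult_right)

sublocale Q: assoc_algebra Q
  by (rule assoc_algebra_Q)

lemma cls_minus: "x \<in> carrier M \<Longrightarrow> y \<in> carrier M \<Longrightarrow> cls x \<ominus>\<^bsub>Q\<^esub> cls y = cls (x \<ominus> y)"
proof -
  assume x: "x \<in> carrier M" and y: "y \<in> carrier M"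
  have "cls (x \<ominus> y) \<oplus>\<^bsub>Q\<^esub> cls y = cls x"
    using x y by (simp add: cls_add a_minus_def Rng.a_assoc Rng.l_neg)
  then show ?thesis using x y
    by (metis Q.add.inv_solve_right' Rng.minus_closed a_minus_def cls_closed)
qed

end

section \<open>Matrices indexed by letters\<close>

primrec mat_word :: "'i set \<Rightarrow> ('g \<Rightarrow> 'i \<Rightarrow> 'i \<Rightarrow> complex) \<Rightarrow> 'g list \<Rightarrow> 'i \<Rightarrow> 'i \<Rightarrow> complex" where
  "mat_word S m [] a b = of_bool (a = b)"
| "mat_word S m (g # w) a b = (\<Sum>c\<in>S. m g a c * mat_word S m w c b)"

definition mat_poly :: "'i set \<Rightarrow> ('g \<Rightarrow> 'i \<Rightarrow> 'i \<Rightarrow> complex) \<Rightarrow> 'g falg \<Rightarrow> 'i \<Rightarrow> 'i \<Rightarrow> complex" where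
  "mat_poly S m p a b = lin_ext (\<lambda>w. mat_word S m w a b) p"

text \<open>
  The action of a polynomial on functions on the index set. Products of matrices become compositions
  of operators, which are easier to evaluate than sums over intermediate indices.
\<close>

definition act :: "'i set \<Rightarrow> ('g \<Rightarrow> 'i \<Rightarrow> 'i \<Rightarrow> complex) \<Rightarrow> 'g falg \<Rightarrow> ('i \<Rightarrow> complex) \<Rightarrow> 'i \<Rightarrow> complex" where
  "act S m p f a = (\<Sum>b\<in>S. mat_poly S m p a b * f b)"

lemma mat_word_append:
  assumes "finite S" "a \<in> S"
  shows "mat_word S m (u @ v) a b = (\<Sum>c\<in>S. mat_word S m u a c * mat_word S m v c b)"
  using assms(2)
proof (induction u arbitrary: a)
  case Nil
  then show ?case using assms(1) by (simp add: of_bool_def if_distrib[of "\<lambda>x. x * y" for y] sum.delta cong: if_cong)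
next
  case (Cons g u)
  then show ?case
    by (simp add: sum_distrib_left sum_distrib_right mult.assoc)
      (rule sum.swap)
qed

lemma mat_poly_mult:
  assumes "finite S" "a \<in> S"
  shows "mat_poly S m (p * r) a b = (\<Sum>c\<in>S. mat_poly S m p a c * mat_poly S m r c b)"
  unfolding mat_poly_def
  by (rule lin_ext_mult[where X = UNIV]) (simp_all add: mat_word_append assms free_algebra_UNIV)

lemma act_mult:
  assumes "finite S" "a \<in> S"
  shows "act S m (p * r) f a = act S m p (act S m r f) a"
proof -
  have "act S m (p * r) f a = (\<Sum>b\<in>S. \<Sum>c\<in>S. mat_poly S m p a c * mat_poly S m r c b * f b)"
    by (simp add: act_def mat_poly_mult assms sum_distrib_right)
  also have "\<dots> = (\<Sum>c\<in>S. \<Sum>b\<in>S. mat_poly S m p a c * mat_poly S m r c b * f b)"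
    by (rule sum.swap)
  finally show ?thesis by (simp add: act_def sum_distrib_left mult.assoc)
qed

lemma act_add: "act S m (p + r) f a = act S m p f a + act S m r f a"
  by (simp add: act_def mat_poly_def lin_ext_add algebra_simps sum.distrib)

lemma act_diff: "act S m (p - r) f a = act S m p f a - act S m r f a"
  by (simp add: act_def mat_poly_def lin_ext_diff algebra_simps sum_subtractf)

lemma act_1: "finite S \<Longrightarrow> a \<in> S \<Longrightarrow> act S m 1 f a = f a"
  by (simp add: act_def mat_poly_def fmon_Nil[symmetric] lin_ext_fmon of_bool_def
      if_distrib[of "\<lambda>x. x * y" for y] sum.delta cong: if_cong)

lemma act_0: "act S m 0 f a = 0"
  by (simp add: act_def mat_poly_def lin_ext_0)

lemma act_fconst: "finite S \<Longrightarrow> a \<in> S \<Longrightarrow> act S m (fconst c) f a = c * f a"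
proof -
  have "mat_poly S m (fconst c) a b = c * mat_poly S m 1 a b" for b
    using lin_ext_fconst_mult[of _ c 1] by (simp add: mat_poly_def)
  then have "act S m (fconst c) f a = c * act S m 1 f a"
    by (simp add: act_def sum_distrib_left mult.assoc)
  then show "finite S \<Longrightarrow> a \<in> S \<Longrightarrow> ?thesis" by (simp add: act_1)
qed

lemma act_fvar: "finite S \<Longrightarrow> a \<in> S \<Longrightarrow> act S m (fvar g) f a = (\<Sum>b\<in>S. m g a b * f b)"
  by (simp add: act_def mat_poly_def lin_ext_fmon of_bool_def
      if_distrib[of "\<lambda>x. y * x" for y] sum.delta cong: if_cong)

lemma act_cong: "(\<And>b. b \<in> S \<Longrightarrow> f b = f' b) \<Longrightarrow> act S m p f a = act S m p f' a"
  by (simp add: act_def)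

lemma mat_poly_act: "finite S \<Longrightarrow> b \<in> S \<Longrightarrow> mat_poly S m p a b = act S m p (\<lambda>c. of_bool (c = b)) a"
  by (simp add: act_def of_bool_def if_distrib[of "\<lambda>x. y * x" for y] sum.delta cong: if_cong)

section \<open>Representations of the quantized enveloping algebra\<close>

lemma uq_relators_carrier: "uq_relators n q \<subseteq> carrier (free_algebra (uq_gens n))"
proof -
  have gens: "GenE i \<in> uq_gens n" "GenF i \<in> uq_gens n" "GenK i \<in> uq_gens n" "GenKinv i \<in> uq_gens n"
    if "i \<in> {1..n}" for i
    using that by (auto simp: uq_gens_def)
  have v: "fvar g \<in> carrier (free_algebra (uq_gens n))" if "g \<in> uq_gens n" for g
    using that by (simp add: falg_carrier)
  show ?thesis
    unfolding uq_relators_def Let_def serre_def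
    by (auto intro!: falg_carrier_add falg_carrier_mult falg_carrier_diff falg_carrier_fconst falg_carrier_01 v gens)
qed

lemma Uq_quotient: "algebra_quotient (free_algebra (uq_gens n)) (uq_relators n q)"
  by (intro algebra_quotient.intro algebra_quotient_axioms.intro assoc_algebra_free uq_relators_carrier)

abbreviation uq_class :: "nat \<Rightarrow> real \<Rightarrow> uq_gen falg \<Rightarrow> uq_gen falg set" where
  "uq_class n q \<equiv> alg_cls (free_algebra (uq_gens n)) (uq_relators n q)"

lemmas assoc_algebra_Uq = algebra_quotient.assoc_algebra_Q[OF Uq_quotient, folded Uq_def]
lemmas uq_class_closed = algebra_quotient.cls_closed[OF Uq_quotient, folded Uq_def]
lemmas uq_class_cases = algebra_quotient.cls_cases[OF Uq_quotient, folded Uq_def]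
lemmas uq_class_simps =
  algebra_quotient.cls_add[OF Uq_quotient, folded Uq_def, unfolded free_algebra_simps]
  algebra_quotient.cls_mult[OF Uq_quotient, folded Uq_def, unfolded free_algebra_simps]
  algebra_quotient.cls_smult[OF Uq_quotient, folded Uq_def, unfolded free_algebra_simps]
lemmas uq_class_one = algebra_quotient.cls_one[OF Uq_quotient, folded Uq_def, unfolded free_algebra_simps]
lemmas uq_class_zero = algebra_quotient.cls_zero[OF Uq_quotient, folded Uq_def, unfolded free_algebra_simps]
lemmas uq_class_relator = algebra_quotient.cls_relator[OF Uq_quotient, folded Uq_def]

lemma uq_class_self: "p \<in> carrier (free_algebra (uq_gens n)) \<Longrightarrow> p \<in> uq_class n q p"
proof -
  assume p: "p \<in> carrier (free_algebra (uq_gens n))"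
  interpret algebra_quotient "free_algebra (uq_gens n)" "uq_relators n q" by (rule Uq_quotient)
  show ?thesis using p unfolding alg_cls_def by (rule I.a_rcos_self)
qed

text \<open>
  Matrices for the generators that satisfy the defining relations, with an arbitrary finite index set
  in order to treat pairs of indices as indices of the tensor square.
\<close>

locale uq_matrices =
  fixes n :: nat and q :: real and S :: "'i set" and m :: "uq_gen \<Rightarrow> 'i \<Rightarrow> 'i \<Rightarrow> complex"
  assumes fin: "finite S"
    and relators: "r \<in> uq_relators n q \<Longrightarrow> a \<in> S \<Longrightarrow> act S m r f a = 0"
begin

lemma act_Idl:
  assumes "p \<in> Idl\<^bsub>free_algebra (uq_gens n)\<^esub> (uq_relators n q)" "a \<in> S"
  shows "act S m p f a = 0"
proof -
  let ?F = "free_algebra (uq_gens n)"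
  let ?K = "{p \<in> carrier ?F. \<forall>f. \<forall>a\<in>S. act S m p f a = 0}"
  interpret F: assoc_algebra ?F by (rule assoc_algebra_free)
  have "ideal ?K ?F"
  proof (rule idealI)
    show "ring ?F" by (rule F.Rng.ring_axioms)
    show "subgroup ?K (add_monoid ?F)"
    proof (rule F.Rng.add.subgroupI)
      fix p assume "p \<in> ?K"
      moreover have "\<ominus>\<^bsub>?F\<^esub> p = - p" if "p \<in> carrier ?F" for p
        using that by (intro F.Rng.minus_equality) (auto simp: free_algebra_simps falg_carrier)
      ultimately show "\<ominus>\<^bsub>?F\<^esub> p \<in> ?K"
        using act_diff[of S m 0 p] by (auto simp: act_0 falg_carrier)
    qed (auto simp: free_algebra_simps falg_carrier act_add act_0)
    show "x \<otimes>\<^bsub>?F\<^esub> p \<in> ?K" if "p \<in> ?K" "x \<in> carrier ?F" for p x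
    proof -
      have "act S m (x * p) f a = 0" if "a \<in> S" for f a
        using \<open>p \<in> ?K\<close> that act_cong[of S "act S m p f" "\<lambda>_. 0" m x a] fin
        by (simp add: act_mult) (simp add: act_def)
      then show ?thesis using that by (auto simp: free_algebra_simps falg_carrier)
    qed
    show "p \<otimes>\<^bsub>?F\<^esub> x \<in> ?K" if "p \<in> ?K" "x \<in> carrier ?F" for p x
      using that fin by (auto simp: free_algebra_simps falg_carrier act_mult)
  qed
  then have "Idl\<^bsub>?F\<^esub> (uq_relators n q) \<subseteq> ?K"
    using uq_relators_carrier[of n q] relators by (intro F.Rng.genideal_minimal) auto
  then show ?thesis using assms by auto
qed

definition coeff :: "'i \<Rightarrow> 'i \<Rightarrow> uq_gen falg set \<Rightarrow> complex" where
  "coeff a b = on_Uq n q (\<lambda>w. mat_word S m w a b)"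

lemma coeff_cls:
  assumes "p \<in> carrier (free_algebra (uq_gens n))" "a \<in> S" "b \<in> S"
  shows "coeff a b (alg_cls (free_algebra (uq_gens n)) (uq_relators n q) p) = mat_poly S m p a b"
proof -
  let ?X = "alg_cls (free_algebra (uq_gens n)) (uq_relators n q) p"
  have "lin_ext (\<lambda>w. mat_word S m w a b) r = mat_poly S m p a b" if "r \<in> ?X" for r
  proof -
    from that obtain j where j: "j \<in> Idl\<^bsub>free_algebra (uq_gens n)\<^esub> (uq_relators n q)" "r = j + p"
      by (auto simp: alg_cls_def a_r_coset_def r_coset_def free_algebra_simps)
    then show ?thesis
      using act_Idl[OF j(1) assms(2)] mat_poly_act[OF fin assms(3), of m j a]
      by (simp add: mat_poly_def lin_ext_add)
  qed
  then have "lin_ext (\<lambda>w. mat_word S m w a b) ` ?X = (\<lambda>_. mat_poly S m p a b) ` ?X"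
    by (rule image_cong[OF refl])
  also have "\<dots> = {mat_poly S m p a b}" using uq_class_self[OF assms(1)] by auto
  finally have "lin_ext (\<lambda>w. mat_word S m w a b) ` ?X = {mat_poly S m p a b}" .
  then show ?thesis using assms(1) by (simp add: coeff_def on_Uq_def uq_class_closed)
qed

lemma coeff_outside: "X \<notin> carrier (Uq n q) \<Longrightarrow> coeff a b X = 0"
  by (simp add: coeff_def on_Uq_def)

lemma coeff_mult:
  assumes "X \<in> carrier (Uq n q)" "Y \<in> carrier (Uq n q)" "a \<in> S" "b \<in> S"
  shows "coeff a b (X \<otimes>\<^bsub>Uq n q\<^esub> Y) = (\<Sum>c\<in>S. coeff a c X * coeff c b Y)"
  using assms by (elim uq_class_cases) (simp add: uq_class_simps coeff_cls free_algebra_simps falg_carrier mat_poly_mult fin)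

lemma coeff_add:
  assumes "X \<in> carrier (Uq n q)" "Y \<in> carrier (Uq n q)" "a \<in> S" "b \<in> S"
  shows "coeff a b (X \<oplus>\<^bsub>Uq n q\<^esub> Y) = coeff a b X + coeff a b Y"
  using assms by (elim uq_class_cases)
   (simp add: uq_class_simps coeff_cls free_algebra_simps falg_carrier, simp add: mat_poly_def lin_ext_add)

lemma coeff_smult:
  assumes "X \<in> carrier (Uq n q)" "a \<in> S" "b \<in> S"
  shows "coeff a b (c \<odot>\<^bsub>Uq n q\<^esub> X) = c * coeff a b X"
  using assms by (elim uq_class_cases)
   (simp add: uq_class_simps coeff_cls free_algebra_simps falg_carrier, simp add: mat_poly_def lin_ext_fconst_mult)

lemma coeff_one:
  assumes "a \<in> S" "b \<in> S"
  shows "coeff a b \<one>\<^bsub>Uq n q\<^esub> = of_bool (a = b)"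
  using assms by (simp add: uq_class_one coeff_cls free_algebra_simps falg_carrier)
    (simp add: mat_poly_def fmon_Nil[symmetric] lin_ext_fmon)

lemma exists_rep:
  obtains \<rho> e where "uq_rep n q (card S) \<rho>" "bij_betw e {..<card S} S"
    "\<And>X i j. i < card S \<Longrightarrow> j < card S \<Longrightarrow> \<rho> X $$ (i, j) = coeff (e i) (e j) X"
    "\<And>X. \<rho> X \<in> carrier_mat (card S) (card S)"
proof -
  obtain e where e: "bij_betw e {..<card S} S"
    using ex_bij_betw_nat_finite[OF fin] by (auto simp: atLeast0LessThan)
  define \<rho> where "\<rho> X = mat (card S) (card S) (\<lambda>(i, j). coeff (e i) (e j) X)" for X
  have eS: "e i \<in> S" if "i < card S" for i using e that by (auto simp: bij_betw_def)
  have inj: "e i = e j \<longleftrightarrow> i = j" if "i < card S" "j < card S" for i j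
    using e that by (auto simp: bij_betw_def inj_on_def)
  have mult: "\<rho> (X \<otimes>\<^bsub>Uq n q\<^esub> Y) = \<rho> X * \<rho> Y" if "X \<in> carrier (Uq n q)" "Y \<in> carrier (Uq n q)" for X Y
  proof (rule eq_matI)
    fix i j assume "i < dim_row (\<rho> X * \<rho> Y)" "j < dim_col (\<rho> X * \<rho> Y)"
    then have ij: "i < card S" "j < card S" by (simp_all add: \<rho>_def)
    have "(\<rho> X * \<rho> Y) $$ (i, j) = (\<Sum>k<card S. coeff (e i) (e k) X * coeff (e k) (e j) Y)"
      using ij by (simp add: \<rho>_def scalar_prod_def atLeast0LessThan)
    also have "\<dots> = (\<Sum>c\<in>S. coeff (e i) c X * coeff c (e j) Y)"
      by (rule sum.reindex_bij_betw[OF e])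
    finally show "\<rho> (X \<otimes>\<^bsub>Uq n q\<^esub> Y) $$ (i, j) = (\<rho> X * \<rho> Y) $$ (i, j)"
      using ij by (simp add: coeff_mult[OF that] eS) (simp add: \<rho>_def coeff_mult[OF that] eS)
  qed (simp_all add: \<rho>_def)
  have "uq_rep n q (card S) \<rho>"
    unfolding uq_rep_def
  proof (intro conjI allI ballI)
    show "\<rho> \<in> Ring.ring_hom (Uq n q) (ring_mat TYPE(complex) (card S) ())"
    proof (rule ring_hom_memI)
      fix X Y assume XY: "X \<in> carrier (Uq n q)" "Y \<in> carrier (Uq n q)"
      show "\<rho> (X \<otimes>\<^bsub>Uq n q\<^esub> Y) = \<rho> X \<otimes>\<^bsub>ring_mat TYPE(complex) (card S) ()\<^esub> \<rho> Y"
        using mult[OF XY] by (simp add: ring_mat_def)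
      show "\<rho> (X \<oplus>\<^bsub>Uq n q\<^esub> Y) = \<rho> X \<oplus>\<^bsub>ring_mat TYPE(complex) (card S) ()\<^esub> \<rho> Y"
        unfolding ring_mat_def by (rule eq_matI) (simp_all add: \<rho>_def coeff_add XY eS)
    next
      show "\<rho> \<one>\<^bsub>Uq n q\<^esub> = \<one>\<^bsub>ring_mat TYPE(complex) (card S) ()\<^esub>"
        unfolding ring_mat_def by (rule eq_matI) (simp_all add: \<rho>_def coeff_one eS inj)
    qed (simp add: \<rho>_def ring_mat_def)
    fix c X assume "X \<in> carrier (Uq n q)"
    then show "\<rho> (c \<odot>\<^bsub>Uq n q\<^esub> X) = c \<cdot>\<^sub>m \<rho> X"
      by (intro eq_matI) (simp_all add: \<rho>_def coeff_smult eS)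
  qed
  with e show thesis by (intro that[of \<rho> e]) (simp_all add: \<rho>_def)
qed

end

locale uq_weight_matrices = uq_matrices +
  fixes wt :: "nat \<Rightarrow> 'a \<Rightarrow> int"
  assumes K_diagonal: "i \<in> {1..n} \<Longrightarrow> a \<in> S \<Longrightarrow> b \<in> S \<Longrightarrow> m (GenK i) a b = (if a = b then of_real (q powi wt i a) else 0)"
begin

text \<open>
  The generators \<open>K\<close> act diagonally, so the unit vectors are weight vectors and the representation is of
  type 1.
\<close>

lemma coeff_in_Oq:
  assumes "a \<in> S" "b \<in> S"
  shows "coeff a b \<in> carrier (Oq n q)"
proof -
  obtain \<rho> e where rho: "uq_rep n q (card S) \<rho>" and e: "bij_betw e {..<card S} S"
    and entry: "\<And>X i j. i < card S \<Longrightarrow> j < card S \<Longrightarrow> \<rho> X $$ (i, j) = coeff (e i) (e j) X"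
    and dim: "\<And>X. \<rho> X \<in> carrier_mat (card S) (card S)"
    by (rule exists_rep) blast
  have eS: "e i \<in> S" if "i < card S" for i using e that by (auto simp: bij_betw_def)
  have inj: "e i = e j \<longleftrightarrow> i = j" if "i < card S" "j < card S" for i j
    using e that by (auto simp: bij_betw_def inj_on_def)
  interpret V: vec_space "TYPE(complex)" "card S" .
  let ?W = "{v \<in> carrier_vec (card S). \<exists>\<mu> :: nat \<Rightarrow> int. \<forall>i\<in>{1..n}.
         \<rho> (uq_cls n q [GenK i]) *\<^sub>v v = of_real (q powi \<mu> i) \<cdot>\<^sub>v v}"
  have "unit_vec (card S) k \<in> ?W" if k: "k < card S" for k
  proof -
    have "\<rho> (uq_cls n q [GenK i]) *\<^sub>v unit_vec (card S) k = of_real (q powi wt i (e k)) \<cdot>\<^sub>v unit_vec (card S) k"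
      if i: "i \<in> {1..n}" for i
    proof (rule eq_vecI)
      fix l assume "l < dim_vec (complex_of_real (q powi wt i (e k)) \<cdot>\<^sub>v unit_vec (card S) k)"
      then have l: "l < card S" by simp
      have "coeff (e l) (e k) (uq_cls n q [GenK i]) = m (GenK i) (e l) (e k)"
        using i l k eS fin unfolding uq_cls_def
        by (subst coeff_cls)
          (auto simp: falg_carrier_fmon uq_gens_def mat_poly_def lin_ext_fmon of_bool_def if_distrib[of "\<lambda>x. y * x" for y]
            sum.delta cong: if_cong)
      then show "(\<rho> (uq_cls n q [GenK i]) *\<^sub>v unit_vec (card S) k) $ l =
          (complex_of_real (q powi wt i (e k)) \<cdot>\<^sub>v unit_vec (card S) k) $ l"
        using l k dim[of "uq_cls n q [GenK i]"] i
        by (simp add: entry K_diagonal eS inj row_def scalar_prod_def unit_vec_def if_distrib[of "\<lambda>x. y * x" for y]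
            sum.delta cong: if_cong)
    qed (use dim[of "uq_cls n q [GenK i]"] in simp)
    then show ?thesis by auto
  qed
  then have "set (unit_vecs (card S)) \<subseteq> ?W" by (auto simp: unit_vecs_def)
  then have 1: "V.span (set (unit_vecs (card S))) \<subseteq> V.span ?W" by (intro V.span_is_monotone)
  have 2: "V.span (set (unit_vecs (card S))) = carrier_vec (card S)"
    using V.unit_vecs_basis by (auto simp: V.basis_def)
  have 3: "V.span ?W \<subseteq> carrier_vec (card S)" by (intro V.span_is_subset2) auto
  have "V.span ?W = carrier_vec (card S)" by (rule subset_antisym[OF 3 1[unfolded 2]])
  then have type1: "type1_rep n q (card S) \<rho>" unfolding type1_rep_def by (rule conjI[OF rho])
  have "a \<in> e ` {..<card S}" "b \<in> e ` {..<card S}" using assms e by (simp_all add: bij_betw_def)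
  then obtain i j where ij: "i < card S" "j < card S" "a = e i" "b = e j" by blast
  have "coeff a b = mat_coeff n q \<rho> (unit_vec (card S) i) (unit_vec (card S) j)"
  proof
    fix X
    show "coeff a b X = mat_coeff n q \<rho> (unit_vec (card S) i) (unit_vec (card S) j) X"
      using ij dim[of X] by (cases "X \<in> carrier (Uq n q)") (simp_all add: mat_coeff_def coeff_outside entry)
  qed
  with type1 show ?thesis unfolding Oq_def by (force intro: unit_vec_carrier)
qed

end

section \<open>Direct sums of representations\<close>

lemma uq_repD:
  assumes "uq_rep n q d \<rho>"
  shows "X \<in> carrier (Uq n q) \<Longrightarrow> \<rho> X \<in> carrier_mat d d"
    and "X \<in> carrier (Uq n q) \<Longrightarrow> Y \<in> carrier (Uq n q) \<Longrightarrow> \<rho> (X \<otimes>\<^bsub>Uq n q\<^esub> Y) = \<rho> X * \<rho> Y"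
    and "X \<in> carrier (Uq n q) \<Longrightarrow> Y \<in> carrier (Uq n q) \<Longrightarrow> \<rho> (X \<oplus>\<^bsub>Uq n q\<^esub> Y) = \<rho> X + \<rho> Y"
    and "\<rho> \<one>\<^bsub>Uq n q\<^esub> = 1\<^sub>m d"
    and "X \<in> carrier (Uq n q) \<Longrightarrow> \<rho> (c \<odot>\<^bsub>Uq n q\<^esub> X) = c \<cdot>\<^sub>m \<rho> X"
  using assms by (auto simp: uq_rep_def Ring.ring_hom_def ring_mat_def)

lemma uq_rep_block:
  assumes r1: "uq_rep n q d1 \<rho>1" and r2: "uq_rep n q d2 \<rho>2"
  shows "uq_rep n q (d1 + d2) (\<lambda>X. four_block_mat (\<rho>1 X) (0\<^sub>m d1 d2) (0\<^sub>m d2 d1) (\<rho>2 X))"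
    (is "uq_rep n q _ ?\<rho>")
  unfolding uq_rep_def
proof (intro conjI allI ballI)
  note D1 = uq_repD[OF r1] note D2 = uq_repD[OF r2]
  show "?\<rho> \<in> Ring.ring_hom (Uq n q) (ring_mat TYPE(complex) (d1 + d2) ())"
  proof (rule ring_hom_memI)
    fix X assume X: "X \<in> carrier (Uq n q)"
    show "?\<rho> X \<in> carrier (ring_mat TYPE(complex) (d1 + d2) ())"
      using D1(1)[OF X] D2(1)[OF X] by (simp add: ring_mat_def)
    fix Y assume Y: "Y \<in> carrier (Uq n q)"
    note c = D1(1)[OF X] D1(1)[OF Y] D2(1)[OF X] D2(1)[OF Y]
    show "?\<rho> (X \<otimes>\<^bsub>Uq n q\<^esub> Y) = ?\<rho> X \<otimes>\<^bsub>ring_mat TYPE(complex) (d1 + d2) ()\<^esub> ?\<rho> Y"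
      using c by (simp add: ring_mat_def D1(2)[OF X Y] D2(2)[OF X Y]
          mult_four_block_mat[OF c(1) zero_carrier_mat zero_carrier_mat c(3) c(2) zero_carrier_mat zero_carrier_mat c(4)])
    show "?\<rho> (X \<oplus>\<^bsub>Uq n q\<^esub> Y) = ?\<rho> X \<oplus>\<^bsub>ring_mat TYPE(complex) (d1 + d2) ()\<^esub> ?\<rho> Y"
      using c by (simp add: ring_mat_def D1(3)[OF X Y] D2(3)[OF X Y]
          add_four_block_mat[OF c(1) zero_carrier_mat zero_carrier_mat c(3) c(2) zero_carrier_mat zero_carrier_mat c(4)])
  next
    show "?\<rho> \<one>\<^bsub>Uq n q\<^esub> = \<one>\<^bsub>ring_mat TYPE(complex) (d1 + d2) ()\<^esub>"
      by (simp add: ring_mat_def D1(4) D2(4))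
  qed
  fix c X assume X: "X \<in> carrier (Uq n q)"
  note car = D1(1)[OF X] D2(1)[OF X]
  show "?\<rho> (c \<odot>\<^bsub>Uq n q\<^esub> X) = c \<cdot>\<^sub>m ?\<rho> X"
    using car by (simp add: D1(5)[OF X] D2(5)[OF X]
        smult_four_block_mat[OF car(1) zero_carrier_mat zero_carrier_mat car(2)])
qed

lemma mat_mult_zero_vec: "A \<in> carrier_mat d d \<Longrightarrow> A *\<^sub>v 0\<^sub>v d = (0\<^sub>v d :: complex vec)"
  by (intro eq_vecI) (auto simp: scalar_prod_def)

abbreviation weight_vec :: "nat \<Rightarrow> real \<Rightarrow> nat \<Rightarrow> (uq_gen falg set \<Rightarrow> complex mat) \<Rightarrow> complex vec \<Rightarrow> bool" where
  "weight_vec n q d \<rho> v \<equiv> v \<in> carrier_vec d \<and> (\<exists>\<mu> :: nat \<Rightarrow> int. \<forall>i\<in>{1..n}.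
         \<rho> (uq_cls n q [GenK i]) *\<^sub>v v = of_real (q powi \<mu> i) \<cdot>\<^sub>v v)"

lemma span_linear_image:
  fixes f :: "complex vec \<Rightarrow> complex vec"
  assumes f: "\<And>v. v \<in> carrier_vec d \<Longrightarrow> f v \<in> carrier_vec d'"
    and add: "\<And>v w. v \<in> carrier_vec d \<Longrightarrow> w \<in> carrier_vec d \<Longrightarrow> f (v + w) = f v + f w"
    and smult: "\<And>c v. v \<in> carrier_vec d \<Longrightarrow> f (c \<cdot>\<^sub>v v) = c \<cdot>\<^sub>v f v"
    and W: "W \<subseteq> carrier_vec d" "f ` W \<subseteq> W'" "W' \<subseteq> carrier_vec d'"
    and v: "v \<in> LinearCombinations.module.span class_ring (module_vec TYPE(complex) d) W"
  shows "f v \<in> LinearCombinations.module.span class_ring (module_vec TYPE(complex) d') W'"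
proof -
  interpret V: vec_space "TYPE(complex)" d .
  interpret V': vec_space "TYPE(complex)" d' .
  let ?N = "{v \<in> carrier_vec d. f v \<in> V'.span W'}"
  have zero: "(0 :: complex) \<cdot>\<^sub>v v = 0\<^sub>v k" if "v \<in> carrier_vec k" for v k
    using that by (intro eq_vecI) auto
  have f0: "f (0\<^sub>v d) = 0\<^sub>v d'"
    using smult[of "0\<^sub>v d" 0] f[of "0\<^sub>v d"] by (simp add: zero)
  have sub: "submodule class_ring (V'.span W') (module_vec TYPE(complex) d')"
    using W(3) by (intro V'.span_is_submodule) auto
  have "submodule class_ring ?N (module_vec TYPE(complex) d)"
    using sub by (intro submodule.intro)
      (auto simp: V.module_axioms f0 add smult submodule_def module_vec_simps)
  moreover have "W \<subseteq> ?N" using W V'.in_own_span[of W'] by auto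
  ultimately have "V.span W \<subseteq> ?N" by (intro V.span_is_subset)
  then show ?thesis using v by auto
qed

text \<open>
  Weight vectors of the summands, padded with zeros, are weight vectors of the direct sum.
\<close>

lemma type1_rep_block:
  assumes r1: "type1_rep n q d1 \<rho>1" and r2: "type1_rep n q d2 \<rho>2"
    and K: "\<And>i. i \<in> {1..n} \<Longrightarrow> uq_cls n q [GenK i] \<in> carrier (Uq n q)"
  shows "type1_rep n q (d1 + d2) (\<lambda>X. four_block_mat (\<rho>1 X) (0\<^sub>m d1 d2) (0\<^sub>m d2 d1) (\<rho>2 X))"
    (is "type1_rep n q _ ?\<rho>")
proof -
  have u1: "uq_rep n q d1 \<rho>1" and u2: "uq_rep n q d2 \<rho>2"
    using r1 r2 by (auto simp: type1_rep_def)
  interpret V: vec_space "TYPE(complex)" "d1 + d2" .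
  interpret V1: vec_space "TYPE(complex)" d1 .
  interpret V2: vec_space "TYPE(complex)" d2 .
  let ?W = "{v. weight_vec n q (d1 + d2) ?\<rho> v}"
  let ?W1 = "{v. weight_vec n q d1 \<rho>1 v}" let ?W2 = "{v. weight_vec n q d2 \<rho>2 v}"
  have s1: "V1.span ?W1 = carrier_vec d1" and s2: "V2.span ?W2 = carrier_vec d2"
    using r1 r2 by (auto simp: type1_rep_def)
  have split: "?\<rho> (uq_cls n q [GenK i]) *\<^sub>v (v @\<^sub>v w) = (\<rho>1 (uq_cls n q [GenK i]) *\<^sub>v v) @\<^sub>v (\<rho>2 (uq_cls n q [GenK i]) *\<^sub>v w)"
    if "v \<in> carrier_vec d1" "w \<in> carrier_vec d2" "i \<in> {1..n}" for v w i
    using that K uq_repD(1)[OF u1] uq_repD(1)[OF u2] by (intro mult_mat_vec_split) auto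
  have w1: "v @\<^sub>v 0\<^sub>v d2 \<in> ?W" if "v \<in> ?W1" for v
  proof -
    from that obtain \<mu> :: "nat \<Rightarrow> int" where v: "v \<in> carrier_vec d1"
      and "\<And>i. i \<in> {1..n} \<Longrightarrow> \<rho>1 (uq_cls n q [GenK i]) *\<^sub>v v = of_real (q powi \<mu> i) \<cdot>\<^sub>v v" by auto
    then have "?\<rho> (uq_cls n q [GenK i]) *\<^sub>v (v @\<^sub>v 0\<^sub>v d2) = of_real (q powi \<mu> i) \<cdot>\<^sub>v (v @\<^sub>v 0\<^sub>v d2)" if "i \<in> {1..n}" for i
      using that split[OF v zero_carrier_vec that] mat_mult_zero_vec[OF uq_repD(1)[OF u2 K[OF that]]] by (auto intro!: eq_vecI)
    then show ?thesis using v by auto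
  qed
  have w2: "0\<^sub>v d1 @\<^sub>v v \<in> ?W" if "v \<in> ?W2" for v
  proof -
    from that obtain \<mu> :: "nat \<Rightarrow> int" where v: "v \<in> carrier_vec d2"
      and "\<And>i. i \<in> {1..n} \<Longrightarrow> \<rho>2 (uq_cls n q [GenK i]) *\<^sub>v v = of_real (q powi \<mu> i) \<cdot>\<^sub>v v" by auto
    then have "?\<rho> (uq_cls n q [GenK i]) *\<^sub>v (0\<^sub>v d1 @\<^sub>v v) = of_real (q powi \<mu> i) \<cdot>\<^sub>v (0\<^sub>v d1 @\<^sub>v v)" if "i \<in> {1..n}" for i
      using that split[OF zero_carrier_vec v that] mat_mult_zero_vec[OF uq_repD(1)[OF u1 K[OF that]]] by (auto intro!: eq_vecI)
    then show ?thesis using v by auto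
  qed
  have W: "?W \<subseteq> carrier_vec (d1 + d2)" by auto
  have "V.span ?W = carrier_vec (d1 + d2)"
  proof (rule subset_antisym)
    show "V.span ?W \<subseteq> carrier_vec (d1 + d2)" using W by (intro V.span_is_subset2) auto
    show "carrier_vec (d1 + d2) \<subseteq> V.span ?W"
    proof
      fix v :: "complex vec" assume v: "v \<in> carrier_vec (d1 + d2)"
      define v1 v2 where "v1 = vec_first v d1" and "v2 = vec_last v d2"
      have v12: "v1 \<in> carrier_vec d1" "v2 \<in> carrier_vec d2" by (simp_all add: v1_def v2_def)
      have a: "v1 @\<^sub>v 0\<^sub>v d2 \<in> V.span ?W"
      proof (rule span_linear_image[where f = "\<lambda>v. v @\<^sub>v 0\<^sub>v d2" and d = d1 and W = ?W1])
        show "v1 \<in> V1.span ?W1" using s1 v12 by simp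
      qed (use w1 in \<open>auto intro!: eq_vecI\<close>)
      have b: "0\<^sub>v d1 @\<^sub>v v2 \<in> V.span ?W"
      proof (rule span_linear_image[where f = "\<lambda>v. 0\<^sub>v d1 @\<^sub>v v" and d = d2 and W = ?W2])
        show "v2 \<in> V2.span ?W2" using s2 v12 by simp
      qed (use w2 in \<open>auto intro!: eq_vecI\<close>)
      have "(v1 @\<^sub>v 0\<^sub>v d2) + (0\<^sub>v d1 @\<^sub>v v2) \<in> V.span ?W"
        using V.span_add1[OF _ a b] W by (simp add: module_vec_simps)
      moreover have "(v1 @\<^sub>v 0\<^sub>v d2) + (0\<^sub>v d1 @\<^sub>v v2) = v"
      proof -
        have "v1 @\<^sub>v v2 = v" using v unfolding v1_def v2_def by (rule vec_first_last_append)
        moreover have "(v1 @\<^sub>v 0\<^sub>v d2) + (0\<^sub>v d1 @\<^sub>v v2) = v1 @\<^sub>v v2"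
          using v12 by (auto intro!: eq_vecI)
        ultimately show ?thesis by simp
      qed
      ultimately show "v \<in> V.span ?W" by simp
    qed
  qed
  then show ?thesis unfolding type1_rep_def using uq_rep_block[OF u1 u2] by (intro conjI)
qed


section \<open>The function algebra as a vector space\<close>

lemma in_OqE:
  assumes "a \<in> carrier (Oq n q)"
  obtains d \<rho> \<phi> v where "type1_rep n q d \<rho>" "\<phi> \<in> carrier_vec d" "v \<in> carrier_vec d" "a = mat_coeff n q \<rho> \<phi> v"
  using assms by (auto simp: Oq_def)

lemma in_OqI: "type1_rep n q d \<rho> \<Longrightarrow> \<phi> \<in> carrier_vec d \<Longrightarrow> v \<in> carrier_vec d \<Longrightarrow> mat_coeff n q \<rho> \<phi> v \<in> carrier (Oq n q)"
  by (auto simp: Oq_def)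

lemma uq_cls_closed: "set w \<subseteq> uq_gens n \<Longrightarrow> uq_cls n q w \<in> carrier (Uq n q)"
  unfolding uq_cls_def by (intro uq_class_closed falg_carrier_fmon)

text \<open>
  A sum of matrix coefficients is a matrix coefficient of the direct sum.
\<close>

lemma Oq_add:
  assumes "a \<in> carrier (Oq n q)" "b \<in> carrier (Oq n q)"
  shows "(\<lambda>X. a X + b X) \<in> carrier (Oq n q)"
proof -
  obtain d1 \<rho>1 \<phi>1 v1 where 1: "type1_rep n q d1 \<rho>1" "\<phi>1 \<in> carrier_vec d1" "v1 \<in> carrier_vec d1" "a = mat_coeff n q \<rho>1 \<phi>1 v1"
    using assms(1) by (rule in_OqE)
  obtain d2 \<rho>2 \<phi>2 v2 where 2: "type1_rep n q d2 \<rho>2" "\<phi>2 \<in> carrier_vec d2" "v2 \<in> carrier_vec d2" "b = mat_coeff n q \<rho>2 \<phi>2 v2"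
    using assms(2) by (rule in_OqE)
  have u: "uq_rep n q d1 \<rho>1" "uq_rep n q d2 \<rho>2" using 1 2 by (auto simp: type1_rep_def)
  let ?\<rho> = "\<lambda>X. four_block_mat (\<rho>1 X) (0\<^sub>m d1 d2) (0\<^sub>m d2 d1) (\<rho>2 X)"
  have "(\<lambda>X. a X + b X) = mat_coeff n q ?\<rho> (\<phi>1 @\<^sub>v \<phi>2) (v1 @\<^sub>v v2)"
  proof
    fix X
    show "a X + b X = mat_coeff n q ?\<rho> (\<phi>1 @\<^sub>v \<phi>2) (v1 @\<^sub>v v2) X"
    proof (cases "X \<in> carrier (Uq n q)")
      case True
      have c: "\<rho>1 X \<in> carrier_mat d1 d1" "\<rho>2 X \<in> carrier_mat d2 d2"
        using uq_repD(1)[OF u(1) True] uq_repD(1)[OF u(2) True] .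
      have "(\<phi>1 @\<^sub>v \<phi>2) \<bullet> (?\<rho> X *\<^sub>v (v1 @\<^sub>v v2)) = (\<phi>1 @\<^sub>v \<phi>2) \<bullet> ((\<rho>1 X *\<^sub>v v1) @\<^sub>v (\<rho>2 X *\<^sub>v v2))"
        using c 1 2 by (subst mult_mat_vec_split) auto
      also have "\<dots> = \<phi>1 \<bullet> (\<rho>1 X *\<^sub>v v1) + \<phi>2 \<bullet> (\<rho>2 X *\<^sub>v v2)"
        using c 1 2 by (intro scalar_prod_append) auto
      finally show ?thesis using True by (simp add: mat_coeff_def 1 2)
    qed (simp add: mat_coeff_def 1 2)
  qed
  moreover have "type1_rep n q (d1 + d2) ?\<rho>"
    by (intro type1_rep_block 1 2 uq_cls_closed) (auto simp: uq_gens_def)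
  ultimately show ?thesis using 1 2 by (auto intro!: in_OqI)
qed

lemma Oq_smult:
  assumes "a \<in> carrier (Oq n q)"
  shows "(\<lambda>X. c * a X) \<in> carrier (Oq n q)"
proof -
  obtain d \<rho> \<phi> v where 1: "type1_rep n q d \<rho>" "\<phi> \<in> carrier_vec d" "v \<in> carrier_vec d" "a = mat_coeff n q \<rho> \<phi> v"
    using assms by (rule in_OqE)
  have u: "uq_rep n q d \<rho>" using 1 by (auto simp: type1_rep_def)
  have "(c \<cdot>\<^sub>v \<phi>) \<bullet> (\<rho> X *\<^sub>v v) = c * (\<phi> \<bullet> (\<rho> X *\<^sub>v v))" if "X \<in> carrier (Uq n q)" for X
    using uq_repD(1)[OF u that] 1 by (intro smult_scalar_prod_distrib) auto
  then have "(\<lambda>X. c * a X) = mat_coeff n q \<rho> (c \<cdot>\<^sub>v \<phi>) v"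
    by (auto simp: fun_eq_iff mat_coeff_def 1)
  then show ?thesis using 1 by (auto intro!: in_OqI)
qed

lemma Oq_simps:
  "zero (Oq n q) = (\<lambda>X. 0)" "add (Oq n q) = (\<lambda>a b X. a X + b X)" "module.smult (Oq n q) = (\<lambda>c a X. c * a X)"
  by (simp_all add: Oq_def)

lemma Oq_plus_simps:
  "zero (Oq_plus n q) = (\<lambda>X. 0)" "add (Oq_plus n q) = (\<lambda>a b X. a X + b X)" "module.smult (Oq_plus n q) = (\<lambda>c a X. c * a X)"
  "carrier (Oq_plus n q) = {a \<in> carrier (Oq n q). a \<one>\<^bsub>Uq n q\<^esub> = 0}"
  by (simp_all add: Oq_plus_def Oq_simps oq_counit_def)

lemma Oq_linear:
  assumes "a \<in> carrier (Oq n q)" "X \<in> carrier (Uq n q)" "Y \<in> carrier (Uq n q)"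
  shows "a (X \<oplus>\<^bsub>Uq n q\<^esub> Y) = a X + a Y" and "a (c \<odot>\<^bsub>Uq n q\<^esub> X) = c * a X"
proof -
  obtain d \<rho> \<phi> v where 1: "type1_rep n q d \<rho>" "\<phi> \<in> carrier_vec d" "v \<in> carrier_vec d" "a = mat_coeff n q \<rho> \<phi> v"
    using assms(1) by (rule in_OqE)
  have u: "uq_rep n q d \<rho>" using 1 by (auto simp: type1_rep_def)
  interpret U: assoc_algebra "Uq n q" by (rule assoc_algebra_Uq)
  note c = uq_repD(1)[OF u assms(2)] uq_repD(1)[OF u assms(3)]
  show "a (X \<oplus>\<^bsub>Uq n q\<^esub> Y) = a X + a Y"
    using assms(2,3) c 1
    by (simp add: mat_coeff_def uq_repD(3)[OF u] add_mult_distrib_mat_vec[of _ d d] scalar_prod_add_distrib[of _ d])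
  have "(c \<cdot>\<^sub>m \<rho> X) *\<^sub>v v = c \<cdot>\<^sub>v (\<rho> X *\<^sub>v v)" using c 1 by (intro eq_vecI) auto
  then show "a (c \<odot>\<^bsub>Uq n q\<^esub> X) = c * a X"
    using assms(2) c 1
    by (simp add: mat_coeff_def uq_repD(5)[OF u] scalar_prod_smult_distrib[of _ d])
qed

section \<open>The defining representation and its tensor square\<close>

text \<open>
  The operators \<open>op g\<close> are meant to be closed formulas for the action of the generators. The relations
  then become identities between functions defined by cases.
\<close>

lemma uq_matricesI:
  fixes op :: "uq_gen \<Rightarrow> ('i \<Rightarrow> complex) \<Rightarrow> 'i \<Rightarrow> complex"
  assumes fin: "finite S"
    and op: "\<And>g f a. g \<in> uq_gens n \<Longrightarrow> a \<in> S \<Longrightarrow> (\<Sum>b\<in>S. m g a b * f b) = op g f a"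
    and KK': "\<And>i f a. i \<in> {1..n} \<Longrightarrow> a \<in> S \<Longrightarrow> op (GenK i) (op (GenKinv i) f) a = f a"
    and K'K: "\<And>i f a. i \<in> {1..n} \<Longrightarrow> a \<in> S \<Longrightarrow> op (GenKinv i) (op (GenK i) f) a = f a"
    and KK: "\<And>i j f a. i \<in> {1..n} \<Longrightarrow> j \<in> {1..n} \<Longrightarrow> a \<in> S \<Longrightarrow>
      op (GenK i) (op (GenK j) f) a = op (GenK j) (op (GenK i) f) a"
    and KE: "\<And>i j f a. i \<in> {1..n} \<Longrightarrow> j \<in> {1..n} \<Longrightarrow> a \<in> S \<Longrightarrow>
      op (GenK i) (op (GenE j) f) a = of_real (q powi cartan i j) * op (GenE j) (op (GenK i) f) a"
    and KF: "\<And>i j f a. i \<in> {1..n} \<Longrightarrow> j \<in> {1..n} \<Longrightarrow> a \<in> S \<Longrightarrow>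
      op (GenK i) (op (GenF j) f) a = of_real (q powi (- cartan i j)) * op (GenF j) (op (GenK i) f) a"
    and EF: "\<And>i j f a. i \<in> {1..n} \<Longrightarrow> j \<in> {1..n} \<Longrightarrow> a \<in> S \<Longrightarrow>
      op (GenE i) (op (GenF j) f) a - op (GenF j) (op (GenE i) f) a =
      (if i = j then of_real (1 / (q - 1 / q)) * (op (GenK i) f a - op (GenKinv i) f a) else 0)"
    and serre: "\<And>g i j f a. g = GenE \<or> g = GenF \<Longrightarrow> i \<in> {1..n} \<Longrightarrow> j \<in> {1..n} \<Longrightarrow> i = Suc j \<or> j = Suc i \<Longrightarrow> a \<in> S \<Longrightarrow>
      op (g i) (op (g i) (op (g j) f)) a - of_real (q + 1 / q) * op (g i) (op (g j) (op (g i) f)) a +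
      op (g j) (op (g i) (op (g i) f)) a = 0"
    and far: "\<And>g i j f a. g = GenE \<or> g = GenF \<Longrightarrow> i \<in> {1..n} \<Longrightarrow> j \<in> {1..n} \<Longrightarrow> Suc i < j \<or> Suc j < i \<Longrightarrow> a \<in> S \<Longrightarrow>
      op (g i) (op (g j) f) a = op (g j) (op (g i) f) a"
  shows "uq_matrices n q S m"
proof
  show "finite S" by fact
  fix r a f assume r: "r \<in> uq_relators n q" and a: "a \<in> S"
  have op_cong: "op g f a = op g f' a" if "g \<in> uq_gens n" "a \<in> S" "\<And>b. b \<in> S \<Longrightarrow> f b = f' b" for g f f' a
    using that op[OF that(1,2), of f] op[OF that(1,2), of f'] by simp
  have v1: "act S m (fvar g) f a = op g f a" if "g \<in> uq_gens n" "a \<in> S" for g f a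
    using that by (simp add: act_fvar fin op)
  have v2: "act S m (fvar g * fvar h) f a = op g (op h f) a" if "g \<in> uq_gens n" "h \<in> uq_gens n" "a \<in> S" for g h f a
    using that by (simp add: act_mult fin v1 op_cong[of g a "act S m (fvar h) f" "op h f"])
  have v3: "act S m (fvar g * fvar h * fvar k) f a = op g (op h (op k f)) a"
    if "g \<in> uq_gens n" "h \<in> uq_gens n" "k \<in> uq_gens n" "a \<in> S" for g h k f a
    using that by (simp add: mult.assoc) (simp add: act_mult[of S a m "fvar g"] fin v1 op_cong[OF _ _ v2])
  have c: "act S m (fconst c * p) f a = c * act S m p f a" if "a \<in> S" for c p f a
    using that by (simp add: act_mult fin act_fconst)
  have gens: "GenE i \<in> uq_gens n" "GenF i \<in> uq_gens n" "GenK i \<in> uq_gens n" "GenKinv i \<in> uq_gens n"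
    if "1 \<le> i" "i \<le> n" for i
    using that by (auto simp: uq_gens_def)
  have serre_zero: "act S m (serre q g i j) f a = 0"
    if g: "g = GenE \<or> g = GenF" and ij: "i \<in> {1..n}" "j \<in> {1..n}" "i \<noteq> j" for g i j
  proof -
    have mem: "g i \<in> uq_gens n" "g j \<in> uq_gens n" using g ij gens by auto
    show ?thesis
    proof (cases "i = Suc j \<or> j = Suc i")
      case True
      then have "cartan i j = -1" by (auto simp: cartan_def)
      moreover have "fconst C * x * y * z = fconst C * (x * y * z)" for C and x y z :: "uq_gen falg"
        by (simp add: mult.assoc)
      ultimately show ?thesis using serre[OF g ij(1,2) True a, of f] mem a
        by (simp add: serre_def Let_def act_add act_diff c v3)
    next
      case False
      then have "cartan i j = 0" "Suc i < j \<or> Suc j < i" using ij by (auto simp: cartan_def)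
      then show ?thesis using far[OF g ij(1,2) _ a, of f] mem a
        by (simp add: serre_def Let_def act_diff v2)
    qed
  qed
  from r consider
      i where "i \<in> {1..n}" "r = fvar (GenK i) * fvar (GenKinv i) - 1"
    | i where "i \<in> {1..n}" "r = fvar (GenKinv i) * fvar (GenK i) - 1"
    | i j where "i \<in> {1..n}" "j \<in> {1..n}" "r = fvar (GenK i) * fvar (GenK j) - fvar (GenK j) * fvar (GenK i)"
    | i j where "i \<in> {1..n}" "j \<in> {1..n}"
        "r = fvar (GenK i) * fvar (GenE j) - fconst (of_real (q powi cartan i j)) * fvar (GenE j) * fvar (GenK i)"
    | i j where "i \<in> {1..n}" "j \<in> {1..n}"
        "r = fvar (GenK i) * fvar (GenF j) - fconst (of_real (q powi (- cartan i j))) * fvar (GenF j) * fvar (GenK i)"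
    | i j where "i \<in> {1..n}" "j \<in> {1..n}"
        "r = fvar (GenE i) * fvar (GenF j) - fvar (GenF j) * fvar (GenE i)
         - (if i = j then fconst (of_real (1 / (q - 1 / q))) * (fvar (GenK i) - fvar (GenKinv i)) else 0)"
    | g i j where "g = GenE \<or> g = GenF" "i \<in> {1..n}" "j \<in> {1..n}" "i \<noteq> j" "r = serre q g i j"
    unfolding uq_relators_def Let_def Un_iff mem_Collect_eq by blast
  then show "act S m r f a = 0"
  proof cases
    case 1 then show ?thesis using a by (simp add: act_diff act_1 fin v2 gens KK')
  next
    case 2 then show ?thesis using a by (simp add: act_diff act_1 fin v2 gens K'K)
  next
    case (3 i j) then show ?thesis using a KK[of i j a f] by (simp add: act_diff v2 gens)
  next
    case (4 i j) then show ?thesis using a KE[of i j a f] by (simp add: act_diff v2 gens mult.assoc c)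
  next
    case (5 i j) then show ?thesis using a KF[of i j a f] by (simp add: act_diff v2 gens mult.assoc c)
  next
    case (6 i j) then show ?thesis using a EF[of i j a f] by (auto simp: act_diff v1 v2 gens c act_0)
  next
    case 7 then show ?thesis using serre_zero by blast
  qed
qed

lemma trivial_matrices: "uq_weight_matrices n q {()} (\<lambda>g _ _. counit_gen g) (\<lambda>_ _. 0)"
proof (intro uq_weight_matrices.intro uq_weight_matrices_axioms.intro)
  show "uq_matrices n q {()} (\<lambda>g _ _. counit_gen g)"
    by (rule uq_matricesI[where op = "\<lambda>g f a. counit_gen g * f a"]) (auto simp: cartan_def)
qed auto

text \<open>
  The eigenvalues of \<open>K\<^sub>k\<close> and of its inverse on the basis vectors of the defining representation.
\<close>

definition kap :: "real \<Rightarrow> nat \<Rightarrow> nat \<Rightarrow> complex" where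
  "kap q k c = (if c = Suc k then of_real q else if c = k then of_real (1 / q) else 1)"

definition kapinv :: "real \<Rightarrow> nat \<Rightarrow> nat \<Rightarrow> complex" where
  "kapinv q k c = (if c = Suc k then of_real (1 / q) else if c = k then of_real q else 1)"

lemma cartan_power:
  assumes "q \<noteq> 0"
  shows "complex_of_real (q powi cartan i j) = (if i = j then of_real q * of_real q
      else if i = Suc j \<or> j = Suc i then of_real (1 / q) else 1)"
    and "complex_of_real (q powi (- cartan i j)) = (if i = j then of_real (1 / q) * of_real (1 / q)
      else if i = Suc j \<or> j = Suc i then of_real q else 1)"
  using assms by (auto simp: cartan_def power_int_minus power2_eq_square field_simps)

lemma EF_relationI:
  fixes A B C :: complex
  assumes q: "q \<noteq> 0" "q \<noteq> 1" "q \<noteq> -1" and eq: "(of_real q - of_real (1 / q)) * A = B"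
  shows "A = of_real (1 / (q - 1 / q)) * B"
proof -
  have "q * q \<noteq> 1" using q by (simp add: square_eq_1_iff)
  then have "q - 1 / q \<noteq> 0" using q by (simp add: field_simps)
  then have "complex_of_real (1 / (q - 1 / q)) * (of_real q - of_real (1 / q)) = 1"
    unfolding of_real_diff[symmetric] of_real_mult[symmetric] by simp
  then show ?thesis unfolding eq[symmetric] by (simp only: mult.assoc[symmetric] mult_1_left)
qed

primrec nat_op :: "real \<Rightarrow> uq_gen \<Rightarrow> (nat \<Rightarrow> complex) \<Rightarrow> nat \<Rightarrow> complex" where
  "nat_op q (GenE k) = (\<lambda>f a. if a = Suc k then f k else 0)"
| "nat_op q (GenF k) = (\<lambda>f a. if a = k then f (Suc k) else 0)"
| "nat_op q (GenK k) = (\<lambda>f a. kap q k a * f a)"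
| "nat_op q (GenKinv k) = (\<lambda>f a. kapinv q k a * f a)"

lemma u_gen_K: "u_gen q (GenK k) a b = (if a = b then kap q k a else 0)"
  "u_gen q (GenKinv k) a b = (if a = b then kapinv q k a else 0)"
  by (auto simp: kap_def kapinv_def power_int_minus field_simps)

lemma sum_u_gen:
  assumes "g \<in> uq_gens n" "a \<in> {1..n+1}"
  shows "(\<Sum>b\<in>{1..n+1}. u_gen q g a b * f b) = nat_op q g f a"
  using assms
  by (cases g) (auto simp: u_gen_K uq_gens_def if_distrib[of "\<lambda>x. x * y" for y] sum.delta simp del: u_gen.simps(3,4) cong: if_cong)

lemma natural_matrices:
  assumes q: "q \<noteq> 0" "q \<noteq> 1" "q \<noteq> -1"
  shows "uq_weight_matrices n q {1..n+1} (u_gen q) (\<lambda>k a. of_bool (k + 1 = a) - of_bool (a = k))"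
proof (intro uq_weight_matrices.intro uq_weight_matrices_axioms.intro)
  obtain P Q :: complex where PQ: "of_real q = Q" "of_real (1 / q) = P" and QP: "P * Q = 1" "Q * P = 1" using q by simp
  have QP': "P * (Q * x) = x" "Q * (P * x) = x" for x using QP by (simp_all only: mult.assoc[symmetric] mult_1_left)
  have k: "kap q k c = (if c = Suc k then Q else if c = k then P else 1)"
     "kapinv q k c = (if c = Suc k then P else if c = k then Q else 1)" for k c
    unfolding kap_def kapinv_def PQ by simp_all
  note cartan = cartan_power[OF q(1), unfolded PQ]
  show "uq_matrices n q {1..n+1} (u_gen q)"
  proof (rule uq_matricesI[OF _ sum_u_gen])
    fix i j f and a :: nat
    show "nat_op q (GenE i) (nat_op q (GenF j) f) a - nat_op q (GenF j) (nat_op q (GenE i) f) a =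
      (if i = j then of_real (1 / (q - 1 / q)) * (nat_op q (GenK i) f a - nat_op q (GenKinv i) f a) else 0)"
    proof (cases "i = j")
      case True
      have "(of_real q - of_real (1 / q)) * (nat_op q (GenE i) (nat_op q (GenF i) f) a - nat_op q (GenF i) (nat_op q (GenE i) f) a) =
          nat_op q (GenK i) f a - nat_op q (GenKinv i) f a"
        unfolding PQ by (auto simp: k QP QP' algebra_simps)
      from EF_relationI[OF q this] True show ?thesis by simp
    qed (auto simp: k)
  qed (auto simp: k QP QP' cartan simp del: of_real_power_int)
qed (auto)

text \<open>
  The tensor square of the defining matrices. The two legs of the coproduct of a generator are words
  of length at most one, so their heads determine them.
\<close>

definition sq_gen :: "real \<Rightarrow> uq_gen \<Rightarrow> nat \<times> nat \<Rightarrow> nat \<times> nat \<Rightarrow> complex" where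
  "sq_gen q g x y = (\<Sum>(u, v)\<leftarrow>comult_gen g.
     (if u = [] then of_bool (fst x = fst y) else u_gen q (hd u) (fst x) (fst y)) *
     (if v = [] then of_bool (snd x = snd y) else u_gen q (hd v) (snd x) (snd y)))"

primrec sq_op :: "real \<Rightarrow> uq_gen \<Rightarrow> (nat \<times> nat \<Rightarrow> complex) \<Rightarrow> nat \<times> nat \<Rightarrow> complex" where
  "sq_op q (GenE k) = (\<lambda>f (a, c). (if a = Suc k then kap q k c * f (k, c) else 0) + (if c = Suc k then f (a, k) else 0))"
| "sq_op q (GenF k) = (\<lambda>f (a, c). (if a = k then f (Suc k, c) else 0) + (if c = k then kapinv q k a * f (a, Suc k) else 0))"
| "sq_op q (GenK k) = (\<lambda>f (a, c). kap q k a * kap q k c * f (a, c))"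
| "sq_op q (GenKinv k) = (\<lambda>f (a, c). kapinv q k a * kapinv q k c * f (a, c))"

lemma sum_sq_gen:
  assumes "g \<in> uq_gens n" "x \<in> {1..n+1} \<times> {1..n+1}"
  shows "(\<Sum>y\<in>{1..n+1} \<times> {1..n+1}. sq_gen q g x y * f y) = sq_op q g f x"
proof -
  obtain a c where x: "x = (a, c)" and a: "a \<in> {1..n+1}" and c: "c \<in> {1..n+1}" using assms(2) by auto
  define T where "T = {1..n+1}"
  have finT: "finite T" by (simp add: T_def)
  have aT: "a \<in> T" and cT: "c \<in> T" using a c by (simp_all add: T_def)
  have d: "(\<Sum>b\<in>T. of_bool (a' = b) * h b) = h a'" if "a' \<in> T" for a' :: nat and h :: "nat \<Rightarrow> complex"
    using that finT by (simp add: of_bool_def if_distrib[of "\<lambda>x. x * y" for y] sum.delta cong: if_cong)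
  have two: "(\<Sum>y\<in>T \<times> T. A (fst y) * B (snd y) * f y) = (\<Sum>b\<in>T. A b * (\<Sum>e\<in>T. B e * f (b, e)))"
    for A B
    by (simp add: sum.cartesian_product' sum_distrib_left mult.assoc)
  have gk: "GenK k \<in> uq_gens n" "GenKinv k \<in> uq_gens n" if "k \<in> {1..n}" for k using that by (auto simp: uq_gens_def)
  have u: "(\<Sum>b\<in>T. u_gen q g a' b * h b) = nat_op q g h a'" if "g \<in> uq_gens n" "a' \<in> T" for g a' h
    using sum_u_gen[of g n a' q h] that by (simp add: T_def)
  have "(\<Sum>y\<in>T \<times> T. sq_gen q g x y * f y) = sq_op q g f x"
  proof (cases g)
    case (GenE k)
    then have k: "k \<in> {1..n}" using assms(1) by (auto simp: uq_gens_def)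
    have "(\<Sum>y\<in>T \<times> T. sq_gen q g x y * f y) =
       (\<Sum>y\<in>T \<times> T. u_gen q (GenE k) a (fst y) * u_gen q (GenK k) c (snd y) * f y) +
       (\<Sum>y\<in>T \<times> T. of_bool (a = fst y) * u_gen q (GenE k) c (snd y) * f y)"
      by (simp add: sq_gen_def GenE x sum.distrib distrib_right del: u_gen.simps)
    also have "\<dots> = sq_op q g f x"
      unfolding two[of "u_gen q (GenE k) a" "u_gen q (GenK k) c"] two[of "\<lambda>b. of_bool (a = b)" "u_gen q (GenE k) c"]
      using assms(1) gk[OF k] aT cT GenE by (simp only: u d) (simp add: x)
    finally show ?thesis .
  next
    case (GenF k)
    then have k: "k \<in> {1..n}" using assms(1) by (auto simp: uq_gens_def)
    have "(\<Sum>y\<in>T \<times> T. sq_gen q g x y * f y) =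
       (\<Sum>y\<in>T \<times> T. u_gen q (GenF k) a (fst y) * of_bool (c = snd y) * f y) +
       (\<Sum>y\<in>T \<times> T. u_gen q (GenKinv k) a (fst y) * u_gen q (GenF k) c (snd y) * f y)"
      by (simp add: sq_gen_def GenF x sum.distrib distrib_right del: u_gen.simps)
    also have "\<dots> = sq_op q g f x"
      unfolding two[of "u_gen q (GenF k) a" "\<lambda>b. of_bool (c = b)"] two[of "u_gen q (GenKinv k) a" "u_gen q (GenF k) c"]
      using assms(1) gk[OF k] aT cT GenF by (simp only: u d) (simp add: x)
    finally show ?thesis .
  next
    case (GenK k)
    then show ?thesis unfolding sq_gen_def using assms(1) aT cT two[of "u_gen q (GenK k) a" "u_gen q (GenK k) c"]
      by (simp del: u_gen.simps add: x) (simp only: u nat_op.simps mult.assoc)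
  next
    case (GenKinv k)
    then show ?thesis unfolding sq_gen_def using assms(1) aT cT two[of "u_gen q (GenKinv k) a" "u_gen q (GenKinv k) c"]
      by (simp del: u_gen.simps add: x) (simp only: u nat_op.simps mult.assoc)
  qed  then show ?thesis by (simp add: T_def)
qed

lemma sq_matrices:
  assumes q: "q \<noteq> 0" "q \<noteq> 1" "q \<noteq> -1"
  shows "uq_weight_matrices n q ({1..n+1} \<times> {1..n+1}) (sq_gen q)
    (\<lambda>k (a, c). of_bool (k + 1 = a) - of_bool (a = k) + (of_bool (k + 1 = c) - of_bool (c = k)))"
proof (intro uq_weight_matrices.intro uq_weight_matrices_axioms.intro)
  obtain P Q :: complex where PQ: "of_real q = Q" "of_real (1 / q) = P" and QP: "P * Q = 1" "Q * P = 1" using q by simp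
  have QP': "P * (Q * x) = x" "Q * (P * x) = x" for x using QP by (simp_all only: mult.assoc[symmetric] mult_1_left)
  have k: "kap q k c = (if c = Suc k then Q else if c = k then P else 1)"
     "kapinv q k c = (if c = Suc k then P else if c = k then Q else 1)" for k c
    unfolding kap_def kapinv_def PQ by simp_all
  note cartan = cartan_power[OF q(1), unfolded PQ]
  have sum: "of_real (q + 1 / q) = Q + P" unfolding of_real_add PQ ..
  show "uq_matrices n q ({1..n+1} \<times> {1..n+1}) (sq_gen q)"
  proof (rule uq_matricesI[OF _ sum_sq_gen])
    fix i j f and x :: "nat \<times> nat"
    obtain a c where x: "x = (a, c)" by (cases x)
    show "sq_op q (GenE i) (sq_op q (GenF j) f) x - sq_op q (GenF j) (sq_op q (GenE i) f) x =
      (if i = j then of_real (1 / (q - 1 / q)) * (sq_op q (GenK i) f x - sq_op q (GenKinv i) f x) else 0)"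
    proof (cases "i = j")
      case True
      have "(of_real q - of_real (1 / q)) * (sq_op q (GenE i) (sq_op q (GenF i) f) x - sq_op q (GenF i) (sq_op q (GenE i) f) x) =
          sq_op q (GenK i) f x - sq_op q (GenKinv i) f x"
        unfolding PQ by (auto simp: x k QP QP' algebra_simps)
      from EF_relationI[OF q this] True show ?thesis by simp
    qed (auto simp: x k)
    show "sq_op q (GenK i) (sq_op q (GenE j) f) x = of_real (q powi cartan i j) * sq_op q (GenE j) (sq_op q (GenK i) f) x"
      unfolding cartan by (auto simp: x k QP QP' algebra_simps)
    show "sq_op q (GenK i) (sq_op q (GenF j) f) x = of_real (q powi (- cartan i j)) * sq_op q (GenF j) (sq_op q (GenK i) f) x"
      unfolding cartan by (auto simp: x k QP QP' algebra_simps)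
    fix g assume g: "g = GenE \<or> g = GenF"
    show "sq_op q (g i) (sq_op q (g i) (sq_op q (g j) f)) x - of_real (q + 1 / q) * sq_op q (g i) (sq_op q (g j) (sq_op q (g i) f)) x +
      sq_op q (g j) (sq_op q (g i) (sq_op q (g i) f)) x = 0" if ij: "i = Suc j \<or> j = Suc i"
    proof -
      from ij g consider "i = Suc j" "g = GenE" | "i = Suc j" "g = GenF" | "j = Suc i" "g = GenE" | "j = Suc i" "g = GenF"
        by blast
      then show ?thesis
      proof cases
        case 1 then show ?thesis unfolding sum
          by (cases "a = Suc j"; cases "a = Suc (Suc j)"; cases "c = Suc j"; cases "c = Suc (Suc j)"; cases "a = j"; cases "c = j";
              simp add: x k QP QP' algebra_simps)
      next
        case 2 then show ?thesis unfolding sum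
          by (cases "a = Suc j"; cases "a = Suc (Suc j)"; cases "c = Suc j"; cases "c = Suc (Suc j)"; cases "a = j"; cases "c = j";
              simp add: x k QP QP' algebra_simps)
      next
        case 3 then show ?thesis unfolding sum
          by (cases "a = Suc i"; cases "a = Suc (Suc i)"; cases "c = Suc i"; cases "c = Suc (Suc i)"; cases "a = i"; cases "c = i";
              simp add: x k QP QP' algebra_simps)
      next
        case 4 then show ?thesis unfolding sum
          by (cases "a = Suc i"; cases "a = Suc (Suc i)"; cases "c = Suc i"; cases "c = Suc (Suc i)"; cases "a = i"; cases "c = i";
              simp add: x k QP QP' algebra_simps)
      qed
    qed
    show "sq_op q (g i) (sq_op q (g j) f) x = sq_op q (g j) (sq_op q (g i) f) x" if "Suc i < j \<or> Suc j < i"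
      using that g by (auto simp: x k)
  qed (auto simp: k QP QP' mult.left_commute)
qed (auto simp: sq_gen_def power_int_add power_int_minus power2_eq_square q)

section \<open>Root vectors\<close>

text \<open>
  A representative of the root vector in the free algebra, on which representations can be evaluated.
\<close>

primrec root_poly :: "real \<Rightarrow> nat \<Rightarrow> nat \<Rightarrow> uq_gen falg" where
  "root_poly q 0 i = 0"
| "root_poly q (Suc j) i = (if j \<le> i then fvar (GenE i)
     else fvar (GenE j) * root_poly q j i - fconst (of_real (1 / q)) * (root_poly q j i * fvar (GenE j)))"

lemma root_poly_closed: "1 \<le> i \<Longrightarrow> i \<le> n \<Longrightarrow> j \<le> n + 1 \<Longrightarrow> root_poly q j i \<in> carrier (free_algebra (uq_gens n))"
  by (induction j) (auto intro!: falg_carrier_diff falg_carrier_mult falg_carrier_fconst falg_carrier_fmon falg_carrier_01 simp: uq_gens_def)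

lemma root_vec_class:
  assumes i: "1 \<le> i" "i \<le> n"
  shows "j \<le> n + 1 \<Longrightarrow> root_vec n q j i = uq_class n q (root_poly q j i)"
proof (induction j)
  case 0
  then show ?case by (simp add: uq_class_zero)
next
  case (Suc j)
  interpret Q: algebra_quotient "free_algebra (uq_gens n)" "uq_relators n q" by (rule Uq_quotient)
  note Q_minus = Q.cls_minus[folded Uq_def]
  show ?case
  proof (cases "j \<le> i")
    case True
    then show ?thesis by (simp add: uq_cls_def)
  next
    case False
    then have c: "root_poly q j i \<in> carrier (free_algebra (uq_gens n))" "fvar (GenE j) \<in> carrier (free_algebra (uq_gens n))"
    proof -
      show "root_poly q j i \<in> carrier (free_algebra (uq_gens n))" using Suc i by (intro root_poly_closed) auto
      show "fvar (GenE j) \<in> carrier (free_algebra (uq_gens n))"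
        using Suc False i by (intro falg_carrier_fmon) (auto simp: uq_gens_def)
    qed
    have minus: "x \<ominus>\<^bsub>free_algebra (uq_gens n)\<^esub> y = x - y"
      if "x \<in> carrier (free_algebra (uq_gens n))" "y \<in> carrier (free_algebra (uq_gens n))" for x y
    proof -
      have "\<ominus>\<^bsub>free_algebra (uq_gens n)\<^esub> y = - y"
        using that by (intro Q.Rng.minus_equality) (auto simp: free_algebra_simps falg_carrier)
      then show ?thesis by (simp add: a_minus_def free_algebra_simps)
    qed
    show ?thesis using False Suc c
      by (simp add: qcomm_def uq_cls_def uq_class_simps falg_carrier Q_minus minus)
  qed
qed

lemma root_vec_closed: "(i, j) \<in> pos_roots n \<Longrightarrow> root_vec n q j i \<in> carrier (Uq n q)"
  by (auto simp: pos_roots_def root_vec_class intro!: uq_class_closed root_poly_closed)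

text \<open>
  In the defining representation the root vector \<open>E\<^sub>j\<^sub>i\<close> is a matrix unit.
\<close>

lemma act_root_natural:
  assumes q: "q \<noteq> 0" "q \<noteq> 1" "q \<noteq> -1" and i: "1 \<le> i" and a: "a \<in> {1..n+1}"
  shows "Suc i \<le> j \<Longrightarrow> j \<le> n + 1 \<Longrightarrow> act {1..n+1} (u_gen q) (root_poly q j i) f a = (if a = j then f i else 0)"
proof -
  define S where "S = {1..n+1}"
  have S: "finite S" "a \<in> S" using a by (auto simp: S_def)
  have "Suc i \<le> j \<Longrightarrow> j \<le> n + 1 \<Longrightarrow> a \<in> S \<Longrightarrow> act S (u_gen q) (root_poly q j i) f a = (if a = j then f i else 0)"
  proof (induction j arbitrary: f a rule: nat_induct_at_least)
    case base
    then show ?case using i S sum_u_gen[of "GenE i" n a q f] by (simp add: act_fvar uq_gens_def S_def)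
  next
    case (Suc j)
    have jS: "j \<in> S" "i \<in> S" using Suc.hyps Suc.prems i by (auto simp: S_def)
    have v: "act S (u_gen q) (fvar (GenE j)) f a = (if a = Suc j then f j else 0)" if "a \<in> S" for f a
      using that Suc.hyps Suc.prems i sum_u_gen[of "GenE j" n a q f] by (simp add: act_fvar uq_gens_def S_def)
    have IH: "act S (u_gen q) (root_poly q j i) f a = (if a = j then f i else 0)" if "a \<in> S" for f a
      using Suc that by simp
    have "act S (u_gen q) (root_poly q (Suc j) i) f a =
       act S (u_gen q) (fvar (GenE j)) (act S (u_gen q) (root_poly q j i) f) a -
       of_real (1 / q) * act S (u_gen q) (root_poly q j i) (act S (u_gen q) (fvar (GenE j)) f) a"
      using Suc.hyps Suc.prems S(1) by (simp add: act_diff act_mult act_fconst)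
    also have "\<dots> = (if a = Suc j then f i else 0)"
      using Suc.hyps Suc.prems i jS by (simp add: v IH)
    finally show ?case .
  qed
  then show "Suc i \<le> j \<Longrightarrow> j \<le> n + 1 \<Longrightarrow> ?thesis" using S(2) by (simp add: S_def)
qed

text \<open>
  The coproduct of \<open>E\<^sub>j\<^sub>i\<close>, evaluated in the tensor square: the outer terms come from \<open>E\<^sub>j\<^sub>i \<otimes> K\<close> and \<open>1 \<otimes> E\<^sub>j\<^sub>i\<close>, the
  middle one from the mixed terms \<open>E\<^sub>a\<^sub>i \<otimes> E\<^sub>j\<^sub>a K\<close> with \<open>i < a < j\<close>.
\<close>

lemma act_root_square:
  assumes q: "q \<noteq> 0" "q \<noteq> 1" "q \<noteq> -1" and i: "1 \<le> i"
  shows "Suc i \<le> j \<Longrightarrow> j \<le> n + 1 \<Longrightarrow> a \<in> {1..n+1} \<Longrightarrow> c \<in> {1..n+1} \<Longrightarrow>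
    act ({1..n+1} \<times> {1..n+1}) (sq_gen q) (root_poly q j i) f (a, c) =
      (if a = j then (if c = j then of_real q else if c = i then of_real (1 / q) else 1) * f (i, c) else 0) +
      (if c = j \<and> i < a \<and> a < j then of_real (q - 1 / q) * f (i, a) else 0) +
      (if c = j then f (a, i) else 0)"
proof (induction j arbitrary: f a c rule: nat_induct_at_least)
  case base
  then show ?case using i sum_sq_gen[of "GenE i" n "(a, c)" q f] by (simp add: act_fvar uq_gens_def kap_def)
next
  case (Suc j)
  define T where "T = {1..n+1}"
  define S where "S = T \<times> T"
  have ji: "\<not> j \<le> i" using Suc.hyps by simp
  have S: "finite S" "(a, c) \<in> S" "a \<in> T" "c \<in> T" "i \<in> T" "j \<in> T"
    using Suc.hyps Suc.prems i by (auto simp: S_def T_def)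
  have v: "act S (sq_gen q) (fvar (GenE j)) f (a, c) =
      (if a = Suc j then kap q j c * f (j, c) else 0) + (if c = Suc j then f (a, j) else 0)"
    if "a \<in> T" "c \<in> T" for f a c
    using that Suc.hyps Suc.prems i sum_sq_gen[of "GenE j" n "(a, c)" q f] by (simp add: act_fvar uq_gens_def S_def T_def)
  have IH: "act S (sq_gen q) (root_poly q j i) f (a, c) =
      (if a = j then (if c = j then of_real q else if c = i then of_real (1 / q) else 1) * f (i, c) else 0) +
      (if c = j \<and> i < a \<and> a < j then of_real (q - 1 / q) * f (i, a) else 0) +
      (if c = j then f (a, i) else 0)" if "a \<in> T" "c \<in> T" for f a c
    using Suc that by (simp add: S_def T_def)
  have "act S (sq_gen q) (root_poly q (Suc j) i) f (a, c) =
     act S (sq_gen q) (fvar (GenE j)) (act S (sq_gen q) (root_poly q j i) f) (a, c) -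
     of_real (1 / q) * act S (sq_gen q) (root_poly q j i) (act S (sq_gen q) (fvar (GenE j)) f) (a, c)"
    using S ji by (simp add: act_diff act_mult act_fconst)
  also have "\<dots> = (if a = Suc j then (if c = Suc j then of_real q else if c = i then of_real (1 / q) else 1) * f (i, c) else 0) +
      (if c = Suc j \<and> i < a \<and> a < Suc j then of_real (q - 1 / q) * f (i, a) else 0) +
      (if c = Suc j then f (a, i) else 0)"
    using Suc.hyps S q by (auto simp: v IH kap_def field_simps)
  finally show ?case unfolding S_def T_def .
qed

section \<open>Forms and their pairing with root vectors\<close>

lemma mat_word_counit: "mat_word {()} (\<lambda>g _ _. counit_gen g) w a b = (\<Prod>g\<leftarrow>w. counit_gen g)"
  by (induction w) auto

lemma one_Oq: "\<one>\<^bsub>Oq n q\<^esub> = uq_matrices.coeff n q {()} (\<lambda>g _ _. counit_gen g) () ()"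
proof -
  interpret uq_weight_matrices n q "{()}" "\<lambda>g _ _. counit_gen g" "\<lambda>_ _. 0" by (rule trivial_matrices)
  show ?thesis by (simp add: coeff_def mat_word_counit Oq_def)
qed

lemma one_Oq_closed: "\<one>\<^bsub>Oq n q\<^esub> \<in> carrier (Oq n q)"
  unfolding one_Oq by (rule uq_weight_matrices.coeff_in_Oq[OF trivial_matrices]) auto

lemma one_Oq_one: "\<one>\<^bsub>Oq n q\<^esub> \<one>\<^bsub>Uq n q\<^esub> = 1"
  using uq_matrices.coeff_one[OF uq_weight_matrices.axioms(1)[OF trivial_matrices], of "()" "()"]
  by (simp add: one_Oq)

lemma Oq_zero_closed: "(\<lambda>X. 0) \<in> carrier (Oq n q)"
  using Oq_smult[OF one_Oq_closed, of 0] by simp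

lemma Oq_minus: "a \<in> carrier (Oq n q) \<Longrightarrow> b \<in> carrier (Oq n q) \<Longrightarrow> (\<lambda>X. a X - c * b X) \<in> carrier (Oq n q)"
  using Oq_add[OF _ Oq_smult[of b n q "- c"], of a] by simp

lemma module_Oq_plus: "Module.module (class_ring :: complex ring) (Oq_plus n q)"
proof (rule moduleI)
  show "cring (class_ring :: complex ring)"
    by (rule field.axioms(1)[THEN domain.axioms(1)]) (rule class_field)
  show "abelian_group (Oq_plus n q)"
  proof (rule abelian_groupI)
    fix x assume "x \<in> carrier (Oq_plus n q)"
    then show "\<exists>y\<in>carrier (Oq_plus n q). y \<oplus>\<^bsub>Oq_plus n q\<^esub> x = \<zero>\<^bsub>Oq_plus n q\<^esub>"
      using Oq_smult[of x n q "-1"] by (intro bexI[of _ "\<lambda>X. - x X"]) (auto simp: Oq_plus_simps)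
  qed (auto simp: Oq_plus_simps Oq_zero_closed Oq_add fun_eq_iff algebra_simps)
qed (auto simp: Oq_plus_simps Oq_smult fun_eq_iff algebra_simps)

lemma minus_Oq_plus:
  assumes "b \<in> carrier (Oq_plus n q)"
  shows "a \<ominus>\<^bsub>Oq_plus n q\<^esub> b = (\<lambda>X. a X - b X)"
proof -
  interpret Module.module "class_ring :: complex ring" "Oq_plus n q" by (rule module_Oq_plus)
  have "\<ominus>\<^bsub>Oq_plus n q\<^esub> b = (\<lambda>X. - b X)"
    using Oq_smult[of b n q "-1"] assms by (intro M.minus_equality) (auto simp: Oq_plus_simps)
  then show ?thesis by (simp add: a_minus_def Oq_plus_simps)
qed

abbreviation root :: "nat \<Rightarrow> real \<Rightarrow> nat \<times> nat \<Rightarrow> uq_gen falg set" where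
  "root n q \<alpha> \<equiv> root_vec n q (snd \<alpha>) (fst \<alpha>)"

lemma finite_pos_roots: "finite (pos_roots n)"
  by (rule finite_subset[of _ "{..n+1} \<times> {..n+1}"]) (auto simp: pos_roots_def)

lemma root_closed: "\<alpha> \<in> pos_roots n \<Longrightarrow> root n q \<alpha> \<in> carrier (Uq n q)"
  using root_vec_closed[of "fst \<alpha>" "snd \<alpha>"] by simp

lemma act_root_trivial: "Suc i \<le> j \<Longrightarrow> act {()} (\<lambda>g _ _. counit_gen g) (root_poly q j i) f a = 0"
proof (induction j arbitrary: f rule: nat_induct_at_least)
  case base
  then show ?case by (simp add: act_fvar)
next
  case (Suc j)
  then show ?case by (simp add: act_diff act_mult act_fconst act_fvar)
qed

lemma one_Oq_root: "\<alpha> \<in> pos_roots n \<Longrightarrow> \<one>\<^bsub>Oq n q\<^esub> (root n q \<alpha>) = 0"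
proof -
  assume a: "\<alpha> \<in> pos_roots n"
  interpret uq_weight_matrices n q "{()}" "\<lambda>g _ _. counit_gen g" "\<lambda>_ _. 0" by (rule trivial_matrices)
  have "1 \<le> fst \<alpha>" "fst \<alpha> \<le> n" "snd \<alpha> \<le> n + 1" "Suc (fst \<alpha>) \<le> snd \<alpha>"
    using a by (auto simp: pos_roots_def)
  then show ?thesis
    unfolding one_Oq
    by (simp add: root_vec_class coeff_cls root_poly_closed mat_poly_act act_root_trivial)
qed

lemma T01_vanish_iff:
  assumes x: "x \<in> carrier (Oq n q)"
  shows "(\<forall>X\<in>T01 n q. x X = 0) \<longleftrightarrow> (\<forall>\<alpha>\<in>pos_roots n. x (root n q \<alpha>) = 0)"
proof -
  interpret U: assoc_algebra "Uq n q" by (rule assoc_algebra_Uq)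
  let ?R = "{root_vec n q j i |i j. (i, j) \<in> pos_roots n}"
  have R: "?R \<subseteq> carrier (Uq n q)" by (auto intro: root_vec_closed)
  show ?thesis
  proof
    assume *: "\<forall>X\<in>T01 n q. x X = 0"
    have "?R \<subseteq> T01 n q" unfolding T01_def using U.in_own_span[OF R] .
    then show "\<forall>\<alpha>\<in>pos_roots n. x (root n q \<alpha>) = 0" using * by fastforce
  next
    assume *: "\<forall>\<alpha>\<in>pos_roots n. x (root n q \<alpha>) = 0"
    have x0: "x \<zero>\<^bsub>Uq n q\<^esub> = 0"
      using Oq_linear(2)[OF x U.Rng.zero_closed U.Rng.zero_closed, of 0]
        U.smult_l_null[of "\<zero>\<^bsub>Uq n q\<^esub>"] by simp
    have "submodule (class_ring :: complex ring) {X \<in> carrier (Uq n q). x X = 0} (Uq n q)"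
      by (rule submodule.intro) (auto simp: U.module_axioms Oq_linear[OF x] x0)
    moreover have "?R \<subseteq> {X \<in> carrier (Uq n q). x X = 0}" using * R by fastforce
    ultimately have "T01 n q \<subseteq> {X \<in> carrier (Uq n q). x X = 0}"
      unfolding T01_def by (intro U.span_is_subset)
    then show "\<forall>X\<in>T01 n q. x X = 0" by blast
  qed
qed

lemma I01_iff: "x \<in> I01 n q \<longleftrightarrow> x \<in> carrier (Oq_plus n q) \<and> (\<forall>\<alpha>\<in>pos_roots n. x (root n q \<alpha>) = 0)"
  using T01_vanish_iff[of x n q] by (auto simp: I01_def Oq_plus_simps)

lemma Lambda01_quotient: "vs_quotient (Oq_plus n q) (I01 n q)"
proof (intro vs_quotient.intro vs_quotient_axioms.intro)
  show m: "Module.module (class_ring :: complex ring) (Oq_plus n q)" by (rule module_Oq_plus)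
  interpret Module.module "class_ring :: complex ring" "Oq_plus n q" by (rule m)
  have "(\<lambda>X. 0) \<in> I01 n q" by (simp add: I01_iff Oq_plus_simps Oq_zero_closed)
  then have ne: "I01 n q \<noteq> {}" by blast
  have "additive_subgroup (I01 n q) (Oq_plus n q)"
  proof (rule additive_subgroup.intro, rule M.add.subgroupI)
    fix a assume a: "a \<in> I01 n q"
    then have "\<zero>\<^bsub>Oq_plus n q\<^esub> \<ominus>\<^bsub>Oq_plus n q\<^esub> a = (\<lambda>X. - a X)"
      by (subst minus_Oq_plus) (auto simp: I01_iff Oq_plus_simps)
    moreover have "\<zero>\<^bsub>Oq_plus n q\<^esub> \<ominus>\<^bsub>Oq_plus n q\<^esub> a = \<ominus>\<^bsub>Oq_plus n q\<^esub> a"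
      using a by (simp add: a_minus_def I01_iff)
    ultimately have eq: "\<ominus>\<^bsub>Oq_plus n q\<^esub> a = (\<lambda>X. - a X)" by metis
    show "\<ominus>\<^bsub>Oq_plus n q\<^esub> a \<in> I01 n q"
      unfolding eq using a Oq_smult[of a n q "-1"] by (auto simp: I01_iff Oq_plus_simps)
  qed (auto simp: I01_iff Oq_plus_simps Oq_add Oq_zero_closed ne)
  then show "abelian_subgroup (I01 n q) (Oq_plus n q)"
    by (intro abelian_subgroupI3 M.abelian_group_axioms)
  fix x c assume "x \<in> I01 n q"
  then show "c \<odot>\<^bsub>Oq_plus n q\<^esub> x \<in> I01 n q" by (auto simp: I01_iff Oq_plus_simps Oq_smult)
qed

lemma u_elt_natural: "u_elt n q a b = uq_matrices.coeff n q {1..n+1} (u_gen q) a b"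
  if "q \<noteq> 0" "q \<noteq> 1" "q \<noteq> -1"
proof -
  interpret uq_weight_matrices n q "{1..n+1}" "u_gen q" "\<lambda>k a. of_bool (k + 1 = a) - of_bool (a = k)"
    by (rule natural_matrices[OF that])
  have "u_word n q w a b = mat_word {1..n+1} (u_gen q) w a b" for w
    by (induction w arbitrary: a) auto
  then show ?thesis unfolding u_elt_def coeff_def by (simp only:)
qed

abbreviation u_root :: "nat \<Rightarrow> real \<Rightarrow> nat \<times> nat \<Rightarrow> uq_gen falg set \<Rightarrow> complex" where
  "u_root n q \<alpha> \<equiv> u_elt n q (snd \<alpha>) (fst \<alpha>)"

lemma e01_cls: "e01 n q \<alpha> = cls01 n q (u_root n q \<alpha>)"
  by (simp add: e01_def case_prod_unfold)

text \<open>
  The coordinate functions pair with the root vectors as a dual basis.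
\<close>

lemma u_root:
  assumes q: "q \<noteq> 0" "q \<noteq> 1" "q \<noteq> -1" and a: "\<alpha> \<in> pos_roots n"
  shows "u_root n q \<alpha> \<in> carrier (Oq_plus n q)"
    and "\<beta> \<in> pos_roots n \<Longrightarrow> u_root n q \<alpha> (root n q \<beta>) = of_bool (\<alpha> = \<beta>)"
proof -
  interpret uq_weight_matrices n q "{1..n+1}" "u_gen q" "\<lambda>k a. of_bool (k + 1 = a) - of_bool (a = k)"
    by (rule natural_matrices[OF q])
  have S: "fst \<alpha> \<in> {1..n+1}" "snd \<alpha> \<in> {1..n+1}" "fst \<alpha> \<noteq> snd \<alpha>" using a by (auto simp: pos_roots_def)
  show "u_root n q \<alpha> \<in> carrier (Oq_plus n q)"
    unfolding u_elt_natural[OF q] Oq_plus_simps using coeff_in_Oq[OF S(2,1)] coeff_one[OF S(2,1)] S(3) by simp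
  assume b: "\<beta> \<in> pos_roots n"
  have b': "1 \<le> fst \<beta>" "fst \<beta> \<le> n" "snd \<beta> \<le> n + 1" "Suc (fst \<beta>) \<le> snd \<beta>"
    using b by (auto simp: pos_roots_def)
  have "u_root n q \<alpha> (root n q \<beta>) = mat_poly {1..n+1} (u_gen q) (root_poly q (snd \<beta>) (fst \<beta>)) (snd \<alpha>) (fst \<alpha>)"
    unfolding u_elt_natural[OF q] root_vec_class[OF b'(1,2,3)]
    by (rule coeff_cls[OF root_poly_closed[OF b'(1,2,3)] S(2,1)])
  also have "\<dots> = of_bool (\<alpha> = \<beta>)"
    using S by (simp only: mat_poly_act[OF fin S(1)] act_root_natural[OF q b'(1) S(2) b'(4,3)]) (auto simp: prod_eq_iff)
  finally show "u_root n q \<alpha> (root n q \<beta>) = of_bool (\<alpha> = \<beta>)" .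
qed

lemma coeff_comult:
  assumes "uq_weight_matrices n q S m wt" "a \<in> S" "b \<in> S"
  obtains f g where "oq_comult n q (uq_matrices.coeff n q S m a b) (card S) f g"
proof -
  interpret uq_weight_matrices n q S m wt by fact
  obtain e where e: "bij_betw e {..<card S} S"
    using ex_bij_betw_nat_finite[OF fin] by (auto simp: atLeast0LessThan)
  have "oq_comult n q (coeff a b) (card S) (\<lambda>k. coeff a (e k)) (\<lambda>k. coeff (e k) b)"
    unfolding oq_comult_def
  proof (intro conjI allI impI ballI)
    fix k assume "k < card S"
    then have "e k \<in> S" using e by (auto simp: bij_betw_def)
    then show "coeff a (e k) \<in> carrier (Oq n q)" "coeff (e k) b \<in> carrier (Oq n q)"
      using assms by (auto intro: coeff_in_Oq)
  next
    fix X Y assume "X \<in> carrier (Uq n q)" "Y \<in> carrier (Uq n q)"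
    then show "coeff a b (X \<otimes>\<^bsub>Uq n q\<^esub> Y) = (\<Sum>k<card S. coeff a (e k) X * coeff (e k) b Y)"
      using assms sum.reindex_bij_betw[OF e, of "\<lambda>c. coeff a c X * coeff c b Y"] by (simp add: coeff_mult)
  qed
  then show thesis by (rule that)
qed

section \<open>Coefficients of the tensor square that vanish on the tangent space\<close>

abbreviation sq_coeff :: "nat \<Rightarrow> real \<Rightarrow> nat \<times> nat \<Rightarrow> nat \<times> nat \<Rightarrow> uq_gen falg set \<Rightarrow> complex" where
  "sq_coeff n q \<equiv> uq_matrices.coeff n q ({1..n+1} \<times> {1..n+1}) (sq_gen q)"

text \<open>
  The functional is the product \<open>u\<^sub>l\<^sub>k u\<^sub>j\<^sub>i\<close>. It vanishes on the tangent space, since each term of the action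
  of a root vector changes the indices in a way that the order of the two roots excludes.
\<close>

lemma sq_coeff_root:
  assumes q: "q \<noteq> 0" "q \<noteq> 1" "q \<noteq> -1"
    and r: "(i, j) \<in> pos_roots n" "(k, l) \<in> pos_roots n" "\<not> root_less (i, j) (k, l)" "\<gamma> \<in> pos_roots n"
  shows "sq_coeff n q (l, j) (k, i) (root n q \<gamma>) = 0"
proof -
  interpret uq_weight_matrices n q "{1..n+1} \<times> {1..n+1}" "sq_gen q"
    "\<lambda>k (a, c). of_bool (k + 1 = a) - of_bool (a = k) + (of_bool (k + 1 = c) - of_bool (c = k))"
    by (rule sq_matrices[OF q])
  have b: "1 \<le> fst \<gamma>" "fst \<gamma> \<le> n" "snd \<gamma> \<le> n + 1" "Suc (fst \<gamma>) \<le> snd \<gamma>"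
    using r(4) by (auto simp: pos_roots_def)
  have S: "(l, j) \<in> {1..n+1} \<times> {1..n+1}" "(k, i) \<in> {1..n+1} \<times> {1..n+1}" using r by (auto simp: pos_roots_def)
  then have l: "l \<in> {1..n+1}" and j: "j \<in> {1..n+1}" by auto
  have "sq_coeff n q (l, j) (k, i) (root n q \<gamma>) =
      act ({1..n+1} \<times> {1..n+1}) (sq_gen q) (root_poly q (snd \<gamma>) (fst \<gamma>)) (\<lambda>y. of_bool (y = (k, i))) (l, j)"
    unfolding root_vec_class[OF b(1,2,3)] coeff_cls[OF root_poly_closed[OF b(1,2,3)] S] by (rule mat_poly_act[OF fin S(2)])
  also have "\<dots> = 0"
    unfolding act_root_square[OF q b(1,4,3) l j] using r by (auto simp: pos_roots_def root_less_def)
  finally show ?thesis .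
qed

text \<open>
  The coefficients of the relation that \<open>u\<^sub>l\<^sub>k u\<^sub>j\<^sub>i\<close> contributes: a combination of \<open>e\<^sub>\<beta> \<and> e\<^sub>\<alpha>\<close>, \<open>e\<^sub>\<alpha> \<and> e\<^sub>\<beta>\<close> and, when
  \<open>\<beta> = (i, j)\<close> lies strictly inside \<open>\<alpha> = (k, l)\<close>, the product of the forms with exchanged end points.
\<close>

lemma sq_coeff_root_root:
  assumes q: "q \<noteq> 0" "q \<noteq> 1" "q \<noteq> -1"
    and r: "(i, j) \<in> pos_roots n" "(k, l) \<in> pos_roots n" "\<not> root_less (i, j) (k, l)"
    and mn: "\<mu> \<in> pos_roots n" "\<nu> \<in> pos_roots n"
  shows "sq_coeff n q (l, j) (k, i) (root n q \<mu> \<otimes>\<^bsub>Uq n q\<^esub> root n q \<nu>) =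
    (if \<mu> = (i, j) \<and> \<nu> = (k, l) then (if i = k then of_real (1 / q) else 1) else 0) +
    (if \<mu> = (k, l) \<and> \<nu> = (i, j) then (if j = l then of_real q else if j = k then of_real (1 / q) else 1) else 0) +
    (if k < i \<and> j < l \<and> \<mu> = (i, l) \<and> \<nu> = (k, j) then of_real (q - 1 / q) else 0)"
proof -
  interpret uq_weight_matrices n q "{1..n+1} \<times> {1..n+1}" "sq_gen q"
    "\<lambda>k (a, c). of_bool (k + 1 = a) - of_bool (a = k) + (of_bool (k + 1 = c) - of_bool (c = k))"
    by (rule sq_matrices[OF q])
  obtain m1 m2 n1 n2 where mu: "\<mu> = (m1, m2)" and nu: "\<nu> = (n1, n2)" by (cases \<mu>; cases \<nu>)
  have b: "1 \<le> m1" "m1 \<le> n" "m2 \<le> n + 1" "Suc m1 \<le> m2" and b': "1 \<le> n1" "n1 \<le> n" "n2 \<le> n + 1" "Suc n1 \<le> n2"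
    using mn by (auto simp: pos_roots_def mu nu)
  have S: "(l, j) \<in> {1..n+1} \<times> {1..n+1}" "(k, i) \<in> {1..n+1} \<times> {1..n+1}" using r by (auto simp: pos_roots_def)
  then have l: "l \<in> {1..n+1}" and j: "j \<in> {1..n+1}" by auto
  note c = root_poly_closed[OF b(1,2,3)] root_poly_closed[OF b'(1,2,3)]
  have "sq_coeff n q (l, j) (k, i) (root n q \<mu> \<otimes>\<^bsub>Uq n q\<^esub> root n q \<nu>) =
      mat_poly ({1..n+1} \<times> {1..n+1}) (sq_gen q) (root_poly q m2 m1 * root_poly q n2 n1) (l, j) (k, i)"
    unfolding mu nu fst_conv snd_conv root_vec_class[OF b(1,2,3)] root_vec_class[OF b'(1,2,3)] uq_class_simps(2)[OF c]
    by (rule coeff_cls[OF falg_carrier_mult[OF c] S])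
  also have "\<dots> = act ({1..n+1} \<times> {1..n+1}) (sq_gen q) (root_poly q m2 m1)
      (act ({1..n+1} \<times> {1..n+1}) (sq_gen q) (root_poly q n2 n1) (\<lambda>y. of_bool (y = (k, i)))) (l, j)"
    unfolding mat_poly_act[OF fin S(2)] by (rule act_mult[OF fin S(1)])
  also have "\<dots> =
    (if \<mu> = (i, j) \<and> \<nu> = (k, l) then (if i = k then of_real (1 / q) else 1) else 0) +
    (if \<mu> = (k, l) \<and> \<nu> = (i, j) then (if j = l then of_real q else if j = k then of_real (1 / q) else 1) else 0) +
    (if k < i \<and> j < l \<and> \<mu> = (i, l) \<and> \<nu> = (k, j) then of_real (q - 1 / q) else 0)"
  proof -
    have m: "m1 \<in> {1..n+1}" "m2 \<in> {1..n+1}" using b by auto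
    note [[linarith_neq_limit = 0]]
    define g where "g = act ({1..n+1} \<times> {1..n+1}) (sq_gen q) (root_poly q n2 n1) (\<lambda>y. of_bool (y = (k, i)))"
    define D :: complex where "D = of_real (q - 1 / q)"
    have o: "i < j" "k < l" "j \<le> l" "j = l \<Longrightarrow> i \<le> k" using r by (auto simp: pos_roots_def root_less_def)
    then have ne: "j \<noteq> i" "l \<noteq> i" "l \<noteq> k" by auto
    have g1: "g (m1, j) = (if k < i \<and> m1 = i \<and> n1 = k \<and> n2 = j then D else 0) + (if m1 = k \<and> n1 = i \<and> n2 = j then 1 else 0)"
      unfolding g_def D_def using ne o(1) by (subst act_root_square[OF q b'(1,4,3) m(1) j], fold D_def)
      (cases "n2 = j"; cases "m1 = i"; cases "n1 = k"; cases "m1 = k"; cases "n1 = i"; simp)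
    have g2: "g (l, m1) = (if m1 = i \<and> n1 = k \<and> n2 = l then (if i = k then of_real (1 / q) else 1) else 0)"
      unfolding g_def using ne by (subst act_root_square[OF q b'(1,4,3) l m(1)])
      (cases "n2 = l"; cases "m1 = i"; cases "n1 = k"; simp)
    have "act ({1..n+1} \<times> {1..n+1}) (sq_gen q) (root_poly q m2 m1) g (l, j) =
        (if l = m2 then (if j = m2 then of_real q else if j = m1 then of_real (1 / q) else 1) * g (m1, j) else 0) +
        (if j = m2 then g (l, m1) else 0)"
    proof -
      have no: "\<not> (j = m2 \<and> m1 < l \<and> l < m2)" using o(3) by linarith
      show ?thesis by (subst act_root_square[OF q b(1,4,3) l j]) (simp only: no if_False add_0_right)
    qed
    also have "\<dots> = (if m1 = i \<and> m2 = j \<and> n1 = k \<and> n2 = l then (if i = k then of_real (1 / q) else 1) else 0) +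
      (if m1 = k \<and> m2 = l \<and> n1 = i \<and> n2 = j then (if j = l then of_real q else if j = k then of_real (1 / q) else 1) else 0) +
      (if k < i \<and> j < l \<and> m1 = i \<and> m2 = l \<and> n1 = k \<and> n2 = j then D else 0)"
    proof -
      have "(if l = m2 then (if j = m2 then of_real q else if j = m1 then of_real (1 / q) else 1) * g (m1, j) else 0) =
        (if m1 = k \<and> m2 = l \<and> n1 = i \<and> n2 = j then (if j = l then of_real q else if j = k then of_real (1 / q) else 1) else 0) +
        (if k < i \<and> j < l \<and> m1 = i \<and> m2 = l \<and> n1 = k \<and> n2 = j then D else 0)"
      proof (cases "l = m2 \<and> n2 = j")
        case True
        consider "m1 = i" "n1 = k" | "m1 = k" "n1 = i" | "\<not> (m1 = i \<and> n1 = k)" "\<not> (m1 = k \<and> n1 = i)" by blast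
        then show ?thesis
        proof cases
          case 1
          have "j \<noteq> l" if "k < i" using o(4) that by auto
          with 1 True ne o(3) show ?thesis unfolding g1 by (cases "k < i"; cases "i = k"; cases "j = l"; simp)
        next
          case 2
          with True show ?thesis unfolding g1 by (cases "k < i"; cases "i = k"; simp)
        next
          case 3
          then have f: "\<not> (k < i \<and> m1 = i \<and> n1 = k \<and> n2 = j)" "\<not> (m1 = k \<and> n1 = i \<and> n2 = j)"
            "\<not> (m1 = k \<and> m2 = l \<and> n1 = i \<and> n2 = j)"
            "\<not> (k < i \<and> j < l \<and> m1 = i \<and> m2 = l \<and> n1 = k \<and> n2 = j)" by blast+
          show ?thesis by (simp only: g1 f if_False add_0_right mult_zero_right if_cancel)
        qed
      next
        case False
        then have f: "\<not> (m1 = k \<and> m2 = l \<and> n1 = i \<and> n2 = j)"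
            "\<not> (k < i \<and> j < l \<and> m1 = i \<and> m2 = l \<and> n1 = k \<and> n2 = j)" by blast+
        show ?thesis
        proof (cases "l = m2")
          case True
          with False have "n2 \<noteq> j" by blast
          then show ?thesis by (simp only: g1 f simp_thms if_False add_0_right mult_zero_right if_cancel)
        qed (simp only: f simp_thms if_False add_0_right)
      qed
      moreover have "(if j = m2 then g (l, m1) else 0) =
        (if m1 = i \<and> m2 = j \<and> n1 = k \<and> n2 = l then (if i = k then of_real (1 / q) else 1) else 0)"
        unfolding g2 by (cases "j = m2"; simp)
      ultimately show ?thesis by simp
    qed
    finally show ?thesis unfolding g_def D_def mu nu prod.inject by (simp only: conj_assoc)
  qed
  finally show ?thesis .
qed

section \<open>Straightening relations between root vectors\<close>

locale uq_representation =
  fixes n q d \<rho>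
  assumes rep: "uq_rep n q d \<rho>" and q: "q \<noteq> 0" "q \<noteq> 1" "q \<noteq> -1"
begin

text \<open>
  Setting \<open>E\<^sub>k\<close> to zero for \<open>k\<close> outside \<open>{1..n}\<close> preserves the Serre relations and makes them valid for all
  indices.
\<close>

definition En :: "nat \<Rightarrow> endo" where
  "En k = (if k \<in> {1..n} then mat_endo (\<rho> (uq_cls n q [GenE k])) else 0)"

lemma rho_mult: "X \<in> carrier (Uq n q) \<Longrightarrow> Y \<in> carrier (Uq n q) \<Longrightarrow>
    mat_endo (\<rho> (X \<otimes>\<^bsub>Uq n q\<^esub> Y)) = mat_endo (\<rho> X) * mat_endo (\<rho> Y)"
  using uq_repD(1)[OF rep] by (simp add: uq_repD(2)[OF rep] mat_endo_mult[of _ d])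

lemma rho_add: "X \<in> carrier (Uq n q) \<Longrightarrow> Y \<in> carrier (Uq n q) \<Longrightarrow>
    mat_endo (\<rho> (X \<oplus>\<^bsub>Uq n q\<^esub> Y)) = mat_endo (\<rho> X) + mat_endo (\<rho> Y)"
  using uq_repD(1)[OF rep] by (simp add: uq_repD(3)[OF rep] mat_endo_add[of _ d])

lemma rho_smult: "X \<in> carrier (Uq n q) \<Longrightarrow>
    mat_endo (\<rho> (of_real r \<odot>\<^bsub>Uq n q\<^esub> X)) = r *\<^sub>R mat_endo (\<rho> X)"
  by (simp add: uq_repD(5)[OF rep] mat_endo_smult)

definition ev :: "uq_gen falg \<Rightarrow> endo" where
  "ev p = mat_endo (\<rho> (uq_class n q p))"

abbreviation F where "F \<equiv> carrier (free_algebra (uq_gens n))"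

lemma ev_mult: "x \<in> F \<Longrightarrow> y \<in> F \<Longrightarrow> ev (x * y) = ev x * ev y"
  by (simp add: ev_def uq_class_simps(2)[symmetric] rho_mult uq_class_closed)

lemma ev_add: "x \<in> F \<Longrightarrow> y \<in> F \<Longrightarrow> ev (x + y) = ev x + ev y"
  by (simp add: ev_def uq_class_simps(1)[symmetric] rho_add uq_class_closed)

lemma ev_fconst: "x \<in> F \<Longrightarrow> ev (fconst (of_real r) * x) = r *\<^sub>R ev x"
  by (simp add: ev_def uq_class_simps(3)[symmetric] rho_smult uq_class_closed)

lemma ev_diff: "x \<in> F \<Longrightarrow> y \<in> F \<Longrightarrow> ev (x - y) = ev x - ev y"
  using ev_add[of "x - y" y] by (simp add: falg_carrier_diff)

lemma ev_relator:
  assumes "x \<in> uq_relators n q"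
  shows "ev x = 0"
proof -
  have x: "x \<in> F" using assms uq_relators_carrier by blast
  interpret U: assoc_algebra "Uq n q" by (rule assoc_algebra_Uq)
  have "uq_class n q (x + x) = uq_class n q x"
    using uq_class_simps(1)[OF x x, of q] by (simp add: uq_class_relator[OF assms])
  then have "ev x = ev (x + x)" by (simp add: ev_def)
  then show ?thesis using ev_add[OF x x] by simp
qed

lemma E_in_F: "k \<in> {1..n} \<Longrightarrow> fvar (GenE k) \<in> F"
  by (intro falg_carrier_fmon) (auto simp: uq_gens_def)

lemma En_ev: "k \<in> {1..n} \<Longrightarrow> En k = ev (fvar (GenE k))"
  by (simp add: En_def ev_def uq_cls_def)

lemma serre_relator: "i \<in> {1..n} \<Longrightarrow> j \<in> {1..n} \<Longrightarrow> i \<noteq> j \<Longrightarrow> ev (serre q GenE i j) = 0"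
  by (rule ev_relator) (auto simp: uq_relators_def Let_def)

lemma En_adjacent:
  assumes "cartan i j = -1"
  shows "En i * En i * En j - (q + 1 / q) *\<^sub>R (En i * En j * En i) + En j * En i * En i = 0"
proof (cases "i \<in> {1..n} \<and> j \<in> {1..n}")
  case True
  then have ij: "i \<in> {1..n}" "j \<in> {1..n}" "i \<noteq> j" using assms by (auto simp: cartan_def)
  let ?x = "fvar (GenE i)" and ?y = "fvar (GenE j)"
  have F: "?x \<in> F" "?y \<in> F" using ij E_in_F by auto
  have "serre q GenE i j = ?x * ?x * ?y - fconst (of_real (q + 1 / q)) * (?x * ?y * ?x) + ?y * ?x * ?x"
    using assms by (simp add: serre_def Let_def mult.assoc)
  then have "ev (serre q GenE i j) = ev ?x * ev ?x * ev ?y - (q + 1 / q) *\<^sub>R (ev ?x * ev ?y * ev ?x) + ev ?y * ev ?x * ev ?x"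
    by (simp add: F ev_add ev_diff ev_fconst falg_carrier del: of_real_add of_real_divide)
      (simp add: F ev_mult falg_carrier)
  then show ?thesis using serre_relator[OF ij] ij by (simp add: En_ev)
qed (auto simp: En_def)

lemma En_far: 
  assumes "Suc i < j"
  shows "En i * En j = En j * En i"
proof (cases "i \<in> {1..n} \<and> j \<in> {1..n}")
  case True
  then have ij: "i \<in> {1..n}" "j \<in> {1..n}" "i \<noteq> j" using assms by auto
  let ?x = "fvar (GenE i)" and ?y = "fvar (GenE j)"
  have F: "?x \<in> F" "?y \<in> F" using ij E_in_F by auto
  have "serre q GenE i j = ?x * ?y - ?y * ?x"
    using assms by (simp add: serre_def Let_def cartan_def)
  then have "ev (serre q GenE i j) = ev ?x * ev ?y - ev ?y * ev ?x"
    using F by (simp add: ev_diff ev_mult falg_carrier)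
  then show ?thesis using serre_relator[OF ij] ij by (simp add: En_ev)
qed (auto simp: En_def)

sublocale X: serre_generators q En
  using q En_far En_adjacent[of i "Suc i" for i] En_adjacent[of "Suc i" i for i]
  by unfold_locales (auto simp: cartan_def)

lemma ev_root:
  assumes i: "1 \<le> i" "i \<le> n"
  shows "Suc i \<le> j \<Longrightarrow> j \<le> n + 1 \<Longrightarrow> ev (root_poly q j i) = X.X i j"
proof (induction j rule: nat_induct_at_least)
  case base
  then show ?case using i by (simp add: X.X_simple En_ev)
next
  case (Suc j)
  then have F: "fvar (GenE j) \<in> F" "root_poly q j i \<in> F" using i by (auto intro!: E_in_F root_poly_closed)
  from Suc have "ev (root_poly q (Suc j) i) = ev (fvar (GenE j) * root_poly q j i - fconst (of_real (1 / q)) * (root_poly q j i * fvar (GenE j)))"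
    by simp
  also have "\<dots> = ev (fvar (GenE j)) * ev (root_poly q j i) - (1 / q) *\<^sub>R (ev (root_poly q j i) * ev (fvar (GenE j)))"
    by (simp add: F ev_diff ev_fconst falg_carrier del: of_real_divide) (simp add: F ev_mult)
  also have "\<dots> = X.X i (Suc j)" using Suc i by (simp add: X.X_step En_ev)
  finally show ?case .
qed

lemma rho_root: "(i, j) \<in> pos_roots n \<Longrightarrow> mat_endo (\<rho> (root_vec n q j i)) = X.X i j"
  using ev_root[of i j] by (auto simp: pos_roots_def ev_def root_vec_class)


lemma root_relation:
  assumes "(k, l) \<in> pos_roots n" "(i, j) \<in> pos_roots n" "root_less (k, l) (i, j)"
  shows "X.X k l * X.X i j = (if k = i then q else 1) *\<^sub>R (if l = j then q else 1) *\<^sub>R (if k = j then 1 / q else 1) *\<^sub>R (X.X i j * X.X k l)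
    + (if i < k \<and> k < j \<and> j < l then (q - 1 / q) *\<^sub>R (X.X k j * X.X i l) else 0) +
    (if k = j then X.X i l else 0)"
proof -
  have o: "k < l" "i < j" "j < l \<or> (l = j \<and> i < k)" using assms by (auto simp: pos_roots_def root_less_def)
  consider "l = j" "i < k" | "j < k" | "j = k" | "k = i" "j < l" | "k < i" "j < l" | "i < k" "k < j" "j < l"
    using o by (metis linorder_neqE_nat)
  then show ?thesis
  proof cases
    case 1
    then show ?thesis using o X.X_same_end[of i k j] by simp
  next
    case 2
    then show ?thesis using o X.X_X_far[of i j k l] by simp
  next
    case 3
    then show ?thesis using o X.X_split[of i j l] by simp
  next
    case 4
    then show ?thesis using o X.X_same_start[of k j l] by simp
  next
    case 5
    then show ?thesis using o X.X_nested[of k i j l] by simp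
  next
    case 6
    then show ?thesis using o X.X_crossing[of i k j l] X.X_nested[of i k j l]
      by (simp add: diff_eq_eq)
  qed
qed

end

lemma mat_coeff_endo:
  assumes "uq_rep n q d \<rho>" "\<phi> \<in> carrier_vec d" "v \<in> carrier_vec d" "X \<in> carrier (Uq n q)"
  shows "mat_coeff n q \<rho> \<phi> v X = (\<Sum>i<d. \<phi> $ i * Rep_endo (mat_endo (\<rho> X)) (\<lambda>j. v $ j) i)"
  using uq_repD(1)[OF assms(1,4)] assms(2-4)
  by (simp add: mat_coeff_def mat_endo.rep_eq scalar_prod_def atLeast0LessThan)

text \<open>
  A matrix coefficient of a representation inherits the commutation relations of root vectors. The
  linear term, which occurs when the two roots add up to a root, is a value on the tangent space and
  hence zero.
\<close>

lemma Oq_root_relation: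
  assumes q: "q \<noteq> 0" "q \<noteq> 1" "q \<noteq> -1" and x: "x \<in> carrier (Oq n q)"
    and r: "\<alpha> \<in> pos_roots n" "\<beta> \<in> pos_roots n" "root_less \<alpha> \<beta>"
    and x0: "\<And>\<gamma>. \<gamma> \<in> pos_roots n \<Longrightarrow> x (root n q \<gamma>) = 0"
  shows "x (root n q \<alpha> \<otimes>\<^bsub>Uq n q\<^esub> root n q \<beta>) = swap_coeff q \<beta> \<alpha> * x (root n q \<beta> \<otimes>\<^bsub>Uq n q\<^esub> root n q \<alpha>) +
    (if fst \<beta> < fst \<alpha> \<and> fst \<alpha> < snd \<beta> \<and> snd \<beta> < snd \<alpha>
     then of_real (q - 1 / q) * x (root n q (fst \<alpha>, snd \<beta>) \<otimes>\<^bsub>Uq n q\<^esub> root n q (fst \<beta>, snd \<alpha>)) else 0)"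
proof -
  obtain d \<rho> \<phi> v where 1: "type1_rep n q d \<rho>" "\<phi> \<in> carrier_vec d" "v \<in> carrier_vec d" "x = mat_coeff n q \<rho> \<phi> v"
    using x by (rule in_OqE)
  have rep: "uq_rep n q d \<rho>" using 1 by (auto simp: type1_rep_def)
  interpret uq_representation n q d \<rho> using rep q by unfold_locales
  interpret U: assoc_algebra "Uq n q" by (rule assoc_algebra_Uq)
  obtain k l i j where ab: "\<alpha> = (k, l)" "\<beta> = (i, j)" by (cases \<alpha>; cases \<beta>)
  define L where "L e = (\<Sum>a<d. \<phi> $ a * Rep_endo e (\<lambda>j. v $ j) a)" for e
  have L_add: "L (e + e') = L e + L e'" for e e'
    by (simp add: L_def plus_endo.rep_eq algebra_simps sum.distrib)
  have L_scale: "L (c *\<^sub>R e) = of_real c * L e" for c e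
    by (simp add: L_def scaleR_endo.rep_eq sum_distrib_left mult.left_commute)
  have xL: "x Y = L (mat_endo (\<rho> Y))" if "Y \<in> carrier (Uq n q)" for Y
    using that 1 rep by (simp add: L_def mat_coeff_endo)
  have xr: "x (root n q (a, b)) = L (X.X a b)" if "(a, b) \<in> pos_roots n" for a b
    using that by (simp add: xL root_vec_closed rho_root)
  have xrr: "x (root n q (a, b) \<otimes>\<^bsub>Uq n q\<^esub> root n q (a', b')) = L (X.X a b * X.X a' b')"
    if "(a, b) \<in> pos_roots n" "(a', b') \<in> pos_roots n" for a b a' b'
    using that by (simp add: xL root_vec_closed rho_mult rho_root)
  have m: "(k, l) \<in> pos_roots n" "(i, j) \<in> pos_roots n" "root_less (k, l) (i, j)" using r ab by auto
  have T: "L (X.X i l) = 0" if "k = j"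
    using x0[of "(i, l)"] xr[of i l] m that by (simp add: pos_roots_def)
  have nz: "(k, j) \<in> pos_roots n \<and> (i, l) \<in> pos_roots n" if "i < k \<and> k < j \<and> j < l"
    using m that by (auto simp: pos_roots_def)
  have L0: "L 0 = 0" by (simp add: L_def zero_endo.rep_eq)
  have sc: "swap_coeff q (i, j) (k, l) = of_real (if k = i then q else 1) * of_real (if l = j then q else 1) *
      of_real (if k = j then 1 / q else 1)" by (simp add: swap_coeff_def)
  have T': "L (if k = j then X.X i l else 0) = 0" by (simp add: T L0)
  have C: "L (if i < k \<and> k < j \<and> j < l then (q - 1 / q) *\<^sub>R (X.X k j * X.X i l) else 0) =
      (if i < k \<and> k < j \<and> j < l then of_real (q - 1 / q) * L (X.X k j * X.X i l) else 0)"
    by (simp add: L_scale L0 del: of_real_diff of_real_divide)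
  have C': "(if i < k \<and> k < j \<and> j < l then of_real (q - 1 / q) * L (X.X k j * X.X i l) else 0) =
      (if i < k \<and> k < j \<and> j < l then of_real (q - 1 / q) * x (root n q (k, j) \<otimes>\<^bsub>Uq n q\<^esub> root n q (i, l)) else 0)"
    using nz xrr by auto
  show ?thesis
    unfolding ab fst_conv snd_conv C'[unfolded fst_conv snd_conv, symmetric]
    unfolding xrr[OF m(1,2), unfolded fst_conv snd_conv] xrr[OF m(2,1), unfolded fst_conv snd_conv] root_relation[OF m]
    by (simp only: L_add L_scale sc T' C mult.assoc add_0_right)
qed

section \<open>Combinatorics of increasing words\<close>

abbreviation increasing :: "nat \<Rightarrow> (nat \<times> nat) list \<Rightarrow> bool" where
  "increasing n w \<equiv> set w \<subseteq> pos_roots n \<and> sorted_wrt root_less w"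

text \<open>
  Larger second entries come first, then larger first entries: a numbering that turns the order of
  roots into the order of natural numbers.
\<close>

definition root_key :: "nat \<Rightarrow> nat \<times> nat \<Rightarrow> nat" where
  "root_key n \<alpha> = (n + 2 - snd \<alpha>) * (n + 2) + (n + 2 - fst \<alpha>)"

lemma root_less_key:
  assumes "\<alpha> \<in> pos_roots n" "\<beta> \<in> pos_roots n"
  shows "root_less \<alpha> \<beta> \<longleftrightarrow> root_key n \<alpha> < root_key n \<beta>"
proof -
  have less: "root_key n \<alpha> < root_key n \<beta>" if "\<alpha> \<in> pos_roots n" "\<beta> \<in> pos_roots n" "root_less \<alpha> \<beta>" for \<alpha> \<beta>
  proof (cases "snd \<alpha> = snd \<beta>")
    case True
    then show ?thesis using that by (auto simp: root_less_def pos_roots_def root_key_def)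
  next
    case False
    then have "Suc (n + 2 - snd \<alpha>) \<le> n + 2 - snd \<beta>" using that by (auto simp: root_less_def pos_roots_def)
    then have "Suc (n + 2 - snd \<alpha>) * (n + 2) \<le> (n + 2 - snd \<beta>) * (n + 2)" by (rule mult_le_mono1)
    then have "(n + 2) + (n + 2 - snd \<alpha>) * (n + 2) \<le> (n + 2 - snd \<beta>) * (n + 2)" by (simp only: mult_Suc)
    moreover have "n + 2 - fst \<alpha> < n + 2" using that by (auto simp: pos_roots_def)
    ultimately show ?thesis unfolding root_key_def by linarith
  qed
  have "root_less \<alpha> \<beta> \<or> \<alpha> = \<beta> \<or> root_less \<beta> \<alpha>" by (auto simp: root_less_def)
  then show ?thesis using less[OF assms] less[OF assms(2,1)] by auto
qed

lemma inj_root_key: "inj_on (root_key n) (pos_roots n)"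
proof (rule inj_onI)
  fix \<alpha> \<beta> assume "\<alpha> \<in> pos_roots n" "\<beta> \<in> pos_roots n" "root_key n \<alpha> = root_key n \<beta>"
  then have "\<not> root_less \<alpha> \<beta>" "\<not> root_less \<beta> \<alpha>" using root_less_key by auto
  then show "\<alpha> = \<beta>" by (auto simp: root_less_def)
qed

lemma increasing_key: "set w \<subseteq> pos_roots n \<Longrightarrow> sorted_wrt root_less w \<longleftrightarrow> sorted_wrt (<) (map (root_key n) w)"
proof (induction w)
  case (Cons \<alpha> w)
  then have "root_less \<alpha> \<beta> \<longleftrightarrow> root_key n \<alpha> < root_key n \<beta>" if "\<beta> \<in> set w" for \<beta>
    using that by (intro root_less_key) auto
  with Cons show ?case by simp
qed simp

lemma bij_increasing_sets: "bij_betw set {w. increasing n w} (Pow (pos_roots n))"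
proof (rule bij_betw_imageI)
  show "inj_on set {w. increasing n w}"
  proof (rule inj_onI)
    fix v w assume v: "v \<in> {w. increasing n w}" and w: "w \<in> {w. increasing n w}" and eq: "set v = set w"
    have "sorted_wrt (<) (map (root_key n) v)" "sorted_wrt (<) (map (root_key n) w)"
      using v w increasing_key by auto
    then have "map (root_key n) v = map (root_key n) w"
      using eq by (intro strict_sorted_equal) auto
    then show "v = w" using v w inj_root_key by (metis (no_types, lifting) inj_on_map_eq_map inj_on_subset mem_Collect_eq Un_least)
  qed
  have "A \<in> set ` {w. increasing n w}" if "A \<subseteq> pos_roots n" for A
  proof -
    let ?g = "inv_into (pos_roots n) (root_key n)"
    have fin: "finite A" using that finite_pos_roots by (rule finite_subset)
    define w where "w = map ?g (sorted_list_of_set (root_key n ` A))"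
    have "set w = ?g ` root_key n ` A" using fin by (simp add: w_def)
    also have "\<dots> = A" using inj_root_key that by (rule inv_into_image_cancel)
    finally have s: "set w = A" .
    have "map (root_key n) w = map (\<lambda>x. x) (sorted_list_of_set (root_key n ` A))"
      unfolding w_def map_map using fin that by (intro map_cong refl) (auto intro: f_inv_into_f)
    then have "sorted_wrt (<) (map (root_key n) w)" by simp
    then have "increasing n w" using s that increasing_key[of w n] by auto
    then show ?thesis using s by auto
  qed
  then show "set ` {w. increasing n w} = Pow (pos_roots n)" by auto
qed

lemma finite_increasing: "finite {w. increasing n w}"
  using bij_betw_finite[OF bij_increasing_sets[of n]] finite_pos_roots by simp

lemma card_increasing: "card {w. increasing n w} = 2 ^ card (pos_roots n)"
  using bij_betw_same_card[OF bij_increasing_sets[of n]] by (simp add: card_Pow finite_pos_roots)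

lemma increasing_distinct: "increasing n w \<Longrightarrow> distinct w"
  using increasing_key[of w n] by (metis distinct_map strict_sorted_iff)

lemma card_increasing_length: "card {w. length w = k \<and> increasing n w} = card (pos_roots n) choose k"
proof -
  have "bij_betw set {w. length w = k \<and> increasing n w} {A. A \<subseteq> pos_roots n \<and> card A = k}"
  proof (rule bij_betw_imageI)
    show "inj_on set {w. length w = k \<and> increasing n w}"
      using bij_increasing_sets[of n] unfolding bij_betw_def by (auto elim: inj_on_subset)
    have "A \<in> set ` {w. length w = k \<and> increasing n w}" if A: "A \<subseteq> pos_roots n" "card A = k" for A
    proof -
      from A bij_increasing_sets[of n] obtain w where "increasing n w" "set w = A"
        unfolding bij_betw_def by (metis (no_types, lifting) Pow_iff image_iff mem_Collect_eq)
      with A increasing_distinct[of w n] show ?thesis by (auto simp: distinct_card[symmetric])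
    qed
    then show "set ` {w. length w = k \<and> increasing n w} = {A. A \<subseteq> pos_roots n \<and> card A = k}"
      by (auto simp: distinct_card increasing_distinct)
  qed
  then have "card {w. length w = k \<and> increasing n w} = card {A. A \<subseteq> pos_roots n \<and> card A = k}"
    by (rule bij_betw_same_card)
  also have "\<dots> = card (pos_roots n) choose k" by (rule n_subsets[OF finite_pos_roots])
  finally show ?thesis .
qed

section \<open>The straightening rules are confluent\<close>

abbreviation root_lt :: "nat \<Rightarrow> nat \<times> nat \<Rightarrow> nat \<times> nat \<Rightarrow> bool" where
  "root_lt n \<alpha> \<beta> \<equiv> \<alpha> \<in> pos_roots n \<and> \<beta> \<in> pos_roots n \<and> root_less \<alpha> \<beta>"

abbreviation reducible :: "nat \<Rightarrow> nat \<times> nat \<Rightarrow> nat \<times> nat \<Rightarrow> bool" where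
  "reducible n \<beta> \<alpha> \<equiv> \<beta> \<in> pos_roots n \<and> \<alpha> \<in> pos_roots n \<and> \<not> root_less \<beta> \<alpha>"

lemma straighten_sum:
  fixes G :: "nat \<times> nat \<Rightarrow> nat \<times> nat \<Rightarrow> complex"
  shows "(\<Sum>(s, x, y)\<leftarrow>straighten q (i, j) (k, l). s * G x y) =
    (if (i, j) = (k, l) then 0 else - swap_coeff q (i, j) (k, l) * G (k, l) (i, j) -
       (if k < i \<and> j < l then of_real (q - 1 / q) * G (i, l) (k, j) else 0))"
  by (simp add: straighten_def algebra_simps)

lemma straighten_rewriting:
  assumes q: "q \<noteq> 0"
  shows "quadratic_rewriting (root_lt n) (reducible n) (straighten q)"
proof
  have "{(\<alpha>, \<beta>). root_lt n \<alpha> \<beta>} \<subseteq> measure (root_key n)" using root_less_key by auto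
  then show "wf {(\<alpha>, \<beta>). root_lt n \<alpha> \<beta>}" by (rule wf_subset[rotated]) simp
next
  fix x y c x' y' assume "reducible n x y" "(c, x', y') \<in> set (straighten q x y)"
  then show "root_lt n x' x"
    by (cases x; cases y) (auto simp: straighten_def root_less_def pos_roots_def split: if_splits)
next
  fix x y z and F :: "nat \<times> nat \<Rightarrow> nat \<times> nat \<Rightarrow> nat \<times> nat \<Rightarrow> complex"
  assume xy: "reducible n x y" and yz: "reducible n y z"
    and H1: "\<And>a b c. root_lt n a x \<or> a = x \<and> root_lt n b y \<Longrightarrow> reducible n a b \<Longrightarrow>
         F a b c = (\<Sum>(s, a', b')\<leftarrow>straighten q a b. s * F a' b' c)"
    and H2: "\<And>a b c. root_lt n a x \<or> a = x \<and> root_lt n b y \<Longrightarrow> reducible n b c \<Longrightarrow>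
         F a b c = (\<Sum>(s, b', c')\<leftarrow>straighten q b c. s * F a b' c')"
  obtain i1 j1 i2 j2 i3 j3 where xyz: "x = (i1, j1)" "y = (i2, j2)" "z = (i3, j3)"
    by (cases x; cases y; cases z)
  \<comment> \<open>Every increasing pair formed from a first and a second entry of the three roots is a positive root, so all
    words that occur in the resolution of the overlap consist of positive roots.\<close>
  show "(\<Sum>(s, x', y')\<leftarrow>straighten q x y. s * F x' y' z) = (\<Sum>(s, y', z')\<leftarrow>straighten q y z. s * F x y' z')"
    unfolding xyz straighten_sum
  proof (rule overlap[where P = "pos_roots n"])
    show "(i, j) \<in> pos_roots n" if "i \<in> {i1, i2, i3}" "j \<in> {j1, j2, j3}" "i < j" for i j
      using that xy yz by (auto simp: xyz pos_roots_def)
    have mem: "(i1, j1) \<in> pos_roots n" "(i2, j2) \<in> pos_roots n" using xy by (auto simp: xyz)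
    show "F (i, j) (k, l) (m, s) = (if (i, j) = (k, l) then 0 else - swap_coeff q (i, j) (k, l) * F (k, l) (i, j) (m, s) -
        (if k < i \<and> j < l then of_real (q - 1 / q) * F (i, l) (k, j) (m, s) else 0))"
      if "root_less (i, j) (i1, j1) \<or> (i, j) = (i1, j1) \<and> root_less (k, l) (i2, j2)"
        "(i, j) \<in> pos_roots n" "(k, l) \<in> pos_roots n" "\<not> root_less (i, j) (k, l)" for i j k l m s
      using H1[of "(i, j)" "(k, l)" "(m, s)"] that mem unfolding xyz straighten_sum by auto
    show "F (m, s) (i, j) (k, l) = (if (i, j) = (k, l) then 0 else - swap_coeff q (i, j) (k, l) * F (m, s) (k, l) (i, j) -
        (if k < i \<and> j < l then of_real (q - 1 / q) * F (m, s) (i, l) (k, j) else 0))"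
      if "root_less (m, s) (i1, j1) \<or> (m, s) = (i1, j1) \<and> root_less (i, j) (i2, j2)" "(m, s) \<in> pos_roots n"
        "(i, j) \<in> pos_roots n" "(k, l) \<in> pos_roots n" "\<not> root_less (i, j) (k, l)" for i j k l m s
      using H2[of "(m, s)" "(i, j)" "(k, l)"] that mem unfolding xyz straighten_sum by auto
  qed (use q xy yz in \<open>auto simp: xyz pos_roots_def\<close>)
qed

section \<open>Functions on words that respect the straightening rules\<close>

text \<open>
  The rules must hold in every context \<open>u, v\<close>. Such functions are the ones that will descend to
  functionals on the exterior algebra.
\<close>

definition straightening_invariant :: "nat \<Rightarrow> real \<Rightarrow> ((nat \<times> nat) list \<Rightarrow> complex) \<Rightarrow> bool" where
  "straightening_invariant n q G \<longleftrightarrow> (\<forall>u v \<beta> \<alpha>. reducible n \<beta> \<alpha> \<longrightarrow>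
     G (u @ \<beta> # \<alpha> # v) = (\<Sum>(s, \<gamma>, \<delta>)\<leftarrow>straighten q \<beta> \<alpha>. s * G (u @ \<gamma> # \<delta> # v)))"

text \<open>
  Exchanging the second entries turns crossing pairs of roots into nested ones and back.
\<close>

lemma bij_quads:
  fixes f :: "nat \<times> nat \<Rightarrow> nat \<times> nat \<Rightarrow> nat \<times> nat \<Rightarrow> nat \<times> nat \<Rightarrow> complex"
  shows "(\<Sum>(\<alpha>, \<beta>)\<in>{(\<alpha>, \<beta>). root_lt n \<alpha> \<beta> \<and> fst \<beta> < fst \<alpha> \<and> fst \<alpha> < snd \<beta> \<and> snd \<beta> < snd \<alpha>}.
      f (fst \<alpha>, snd \<beta>) (fst \<beta>, snd \<alpha>) \<alpha> \<beta>) =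
    (\<Sum>(\<alpha>, \<beta>)\<in>{(\<alpha>, \<beta>). root_lt n \<alpha> \<beta> \<and> fst \<alpha> < fst \<beta> \<and> snd \<beta> < snd \<alpha>}.
      f \<beta> \<alpha> (fst \<beta>, snd \<alpha>) (fst \<alpha>, snd \<beta>))"
  by (rule sum.reindex_bij_witness[where j = "\<lambda>(\<alpha>, \<beta>). ((fst \<beta>, snd \<alpha>), (fst \<alpha>, snd \<beta>))"
        and i = "\<lambda>(\<alpha>, \<beta>). ((fst \<beta>, snd \<alpha>), (fst \<alpha>, snd \<beta>))"])
    (auto simp: pos_roots_def root_less_def)

text \<open>
  For a pair of distinct roots in the right order, express the two entries of the sum in the
  opposite orders through each other, once by the relations of root vectors and once by the
  straightening rules. The multiples given by \<open>swap_coeff\<close> cancel. What remains is a sum over crossing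
  pairs minus a sum over nested pairs, and these agree after exchanging second entries. The
  diagonal entries vanish by the rule for equal roots.
\<close>

lemma relation_sum_zero:
  assumes q: "q \<noteq> 0" "q \<noteq> 1" "q \<noteq> -1" and x: "x \<in> I01 n q" and G: "straightening_invariant n q G"
  shows "(\<Sum>\<alpha>\<in>pos_roots n. \<Sum>\<beta>\<in>pos_roots n.
     x (root n q \<alpha> \<otimes>\<^bsub>Uq n q\<^esub> root n q \<beta>) * G (u @ \<alpha> # \<beta> # v)) = 0"
proof -
  let ?P = "pos_roots n"
  define X where "X \<alpha> \<beta> = x (root n q \<alpha> \<otimes>\<^bsub>Uq n q\<^esub> root n q \<beta>)" for \<alpha> \<beta>
  define g where "g \<alpha> \<beta> = G (u @ \<alpha> # \<beta> # v)" for \<alpha> \<beta>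
  define D :: complex where "D = of_real (q - 1 / q)"
  define L where "L = {(\<alpha>, \<beta>). root_lt n \<alpha> \<beta>}"
  let ?cr = "\<lambda>\<alpha> \<beta>. fst \<beta> < fst \<alpha> \<and> fst \<alpha> < snd \<beta> \<and> snd \<beta> < (snd \<alpha> :: nat)"
  let ?ne = "\<lambda>\<alpha> \<beta>. fst \<alpha> < fst \<beta> \<and> snd \<beta> < (snd \<alpha> :: nat)"
  have finL: "finite L" by (rule finite_subset[of _ "?P \<times> ?P"]) (auto simp: L_def finite_pos_roots)
  have g_diag: "g \<alpha> \<alpha> = 0" if "\<alpha> \<in> ?P" for \<alpha>
  proof -
    have "reducible n \<alpha> \<alpha>" using that by (auto simp: root_less_def)
    then have "g \<alpha> \<alpha> = (\<Sum>(s, \<gamma>, \<delta>)\<leftarrow>straighten q \<alpha> \<alpha>. s * g \<gamma> \<delta>)"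
      using G unfolding straightening_invariant_def g_def by blast
    then show ?thesis by (simp add: straighten_def)
  qed
  have g_swap: "g \<beta> \<alpha> = - swap_coeff q \<beta> \<alpha> * g \<alpha> \<beta> - (if ?ne \<alpha> \<beta> then D * g (fst \<beta>, snd \<alpha>) (fst \<alpha>, snd \<beta>) else 0)"
    if "(\<alpha>, \<beta>) \<in> L" for \<alpha> \<beta>
  proof -
    have "reducible n \<beta> \<alpha>" using that by (auto simp: root_less_def L_def)
    moreover have "\<beta> \<noteq> \<alpha>" using that by (auto simp: root_less_def L_def)
    ultimately have "g \<beta> \<alpha> = (\<Sum>(s, \<gamma>, \<delta>)\<leftarrow>straighten q \<beta> \<alpha>. s * g \<gamma> \<delta>)"
      using G unfolding straightening_invariant_def g_def by blast
    then show ?thesis using \<open>\<beta> \<noteq> \<alpha>\<close> straighten_sum[of g q "fst \<beta>" "snd \<beta>" "fst \<alpha>" "snd \<alpha>"] by (simp add: D_def)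
  qed
  have xO: "x \<in> carrier (Oq n q)" using x by (simp add: I01_iff Oq_plus_simps)
  have X_swap: "X \<alpha> \<beta> = swap_coeff q \<beta> \<alpha> * X \<beta> \<alpha> + (if ?cr \<alpha> \<beta> then D * X (fst \<alpha>, snd \<beta>) (fst \<beta>, snd \<alpha>) else 0)"
    if "(\<alpha>, \<beta>) \<in> L" for \<alpha> \<beta>
    unfolding X_def D_def using that x by (intro Oq_root_relation[OF q xO]) (auto simp: L_def I01_iff)
  have "(\<Sum>\<alpha>\<in>?P. \<Sum>\<beta>\<in>?P. X \<alpha> \<beta> * g \<alpha> \<beta>) = (\<Sum>(\<alpha>, \<beta>)\<in>?P \<times> ?P. X \<alpha> \<beta> * g \<alpha> \<beta>)"
    by (simp add: sum.cartesian_product)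
  also have "\<dots> = (\<Sum>(\<alpha>, \<beta>)\<in>L \<union> prod.swap ` L. X \<alpha> \<beta> * g \<alpha> \<beta>)"
  proof (rule sum.mono_neutral_right)
    show "L \<union> prod.swap ` L \<subseteq> ?P \<times> ?P" by (auto simp: L_def)
    have "\<alpha> = \<beta>" if "(\<alpha>, \<beta>) \<in> ?P \<times> ?P - (L \<union> prod.swap ` L)" for \<alpha> \<beta>
    proof -
      have "(\<beta>, \<alpha>) \<notin> L" "(\<alpha>, \<beta>) \<notin> L" using that by force+
      then show ?thesis using that by (auto simp: L_def root_less_def)
    qed
    then show "\<forall>z\<in>?P \<times> ?P - (L \<union> prod.swap ` L). (case z of (\<alpha>, \<beta>) \<Rightarrow> X \<alpha> \<beta> * g \<alpha> \<beta>) = 0"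
      using g_diag by fastforce
  qed (simp add: finite_pos_roots)
  also have "\<dots> = (\<Sum>(\<alpha>, \<beta>)\<in>L. X \<alpha> \<beta> * g \<alpha> \<beta>) + (\<Sum>(\<alpha>, \<beta>)\<in>prod.swap ` L. X \<alpha> \<beta> * g \<alpha> \<beta>)"
    using finL by (intro sum.union_disjoint) (auto simp: L_def root_less_def)
  also have "(\<Sum>(\<alpha>, \<beta>)\<in>prod.swap ` L. X \<alpha> \<beta> * g \<alpha> \<beta>) = (\<Sum>(\<alpha>, \<beta>)\<in>L. X \<beta> \<alpha> * g \<beta> \<alpha>)"
    by (subst sum.reindex) (auto simp: case_prod_unfold inj_on_def prod_eq_iff)
  also have "(\<Sum>(\<alpha>, \<beta>)\<in>L. X \<alpha> \<beta> * g \<alpha> \<beta>) + (\<Sum>(\<alpha>, \<beta>)\<in>L. X \<beta> \<alpha> * g \<beta> \<alpha>) =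
     (\<Sum>(\<alpha>, \<beta>)\<in>L. (if ?cr \<alpha> \<beta> then D * X (fst \<alpha>, snd \<beta>) (fst \<beta>, snd \<alpha>) * g \<alpha> \<beta> else 0) -
       (if ?ne \<alpha> \<beta> then D * X \<beta> \<alpha> * g (fst \<beta>, snd \<alpha>) (fst \<alpha>, snd \<beta>) else 0))"
    unfolding sum.distrib[symmetric]
  proof (intro sum.cong refl)
    fix z assume z: "z \<in> L"
    obtain \<alpha> \<beta> where ab: "z = (\<alpha>, \<beta>)" by (cases z)
    show "(case z of (\<alpha>, \<beta>) \<Rightarrow> X \<alpha> \<beta> * g \<alpha> \<beta>) + (case z of (\<alpha>, \<beta>) \<Rightarrow> X \<beta> \<alpha> * g \<beta> \<alpha>) =
      (case z of (\<alpha>, \<beta>) \<Rightarrow> (if ?cr \<alpha> \<beta> then D * X (fst \<alpha>, snd \<beta>) (fst \<beta>, snd \<alpha>) * g \<alpha> \<beta> else 0) -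
       (if ?ne \<alpha> \<beta> then D * X \<beta> \<alpha> * g (fst \<beta>, snd \<alpha>) (fst \<alpha>, snd \<beta>) else 0))"
      unfolding ab prod.case X_swap[OF z[unfolded ab]] g_swap[OF z[unfolded ab]]
      by (simp only: split: if_split) (auto simp: algebra_simps)
  qed
  also have "\<dots> = (\<Sum>(\<alpha>, \<beta>)\<in>{(\<alpha>, \<beta>). root_lt n \<alpha> \<beta> \<and> ?cr \<alpha> \<beta>}. D * X (fst \<alpha>, snd \<beta>) (fst \<beta>, snd \<alpha>) * g \<alpha> \<beta>) -
     (\<Sum>(\<alpha>, \<beta>)\<in>{(\<alpha>, \<beta>). root_lt n \<alpha> \<beta> \<and> ?ne \<alpha> \<beta>}. D * X \<beta> \<alpha> * g (fst \<beta>, snd \<alpha>) (fst \<alpha>, snd \<beta>))"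
  proof -
    have "(\<Sum>(\<alpha>, \<beta>)\<in>L. if Q \<alpha> \<beta> then h \<alpha> \<beta> else 0) = (\<Sum>(\<alpha>, \<beta>)\<in>{(\<alpha>, \<beta>). root_lt n \<alpha> \<beta> \<and> Q \<alpha> \<beta>}. h \<alpha> \<beta> :: complex)" for Q h
      using finL by (intro sum.mono_neutral_cong_right) (auto simp: L_def split: if_splits)
    from this[of ?cr "\<lambda>\<alpha> \<beta>. D * X (fst \<alpha>, snd \<beta>) (fst \<beta>, snd \<alpha>) * g \<alpha> \<beta>"]
      this[of ?ne "\<lambda>\<alpha> \<beta>. D * X \<beta> \<alpha> * g (fst \<beta>, snd \<alpha>) (fst \<alpha>, snd \<beta>)"]
    show ?thesis by (simp add: case_prod_unfold sum_subtractf)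
  qed
  also have "\<dots> = 0" using bij_quads[where n = n and f = "\<lambda>a b c d. D * X a b * g c d"] by simp
  finally show ?thesis by (simp add: X_def g_def)
qed

section \<open>Values of forms at root vectors\<close>

lemma form_val_exists:
  assumes "v \<in> carrier (Lambda01 n q)"
  obtains a where "a \<in> carrier (Oq_plus n q)" "v = cls01 n q a"
proof -
  interpret vs_quotient "Oq_plus n q" "I01 n q" by (rule Lambda01_quotient)
  show thesis using assms coset_cases that unfolding Lambda01_def cls01_def by blast
qed

text \<open>
  All representatives of the form \<open>v\<close> take the same value at the root vector, because the elements of
  \<open>I\<close> vanish there.
\<close>

definition form_val :: "nat \<Rightarrow> real \<Rightarrow> form01 \<Rightarrow> nat \<times> nat \<Rightarrow> complex" where
  "form_val n q v \<alpha> = the_elem ((\<lambda>a. a (root n q \<alpha>)) ` v)"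

lemma form_val_cls01:
  assumes a: "a \<in> carrier (Oq_plus n q)" and \<alpha>: "\<alpha> \<in> pos_roots n"
  shows "form_val n q (cls01 n q a) \<alpha> = a (root n q \<alpha>)"
proof -
  interpret vs_quotient "Oq_plus n q" "I01 n q" by (rule Lambda01_quotient)
  have "b (root n q \<alpha>) = a (root n q \<alpha>)" if "b \<in> cls01 n q a" for b
  proof -
    from that obtain j where "j \<in> I01 n q" "b = (\<lambda>X. j X + a X)"
      by (auto simp: cls01_def a_r_coset_def r_coset_def Oq_plus_simps)
    then show ?thesis using \<alpha> by (simp add: I01_iff)
  qed
  then have "(\<lambda>b. b (root n q \<alpha>)) ` cls01 n q a = (\<lambda>_. a (root n q \<alpha>)) ` cls01 n q a"
    by (rule image_cong[OF refl])
  also have "\<dots> = {a (root n q \<alpha>)}"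
    using J.a_rcos_self[OF a] by (auto simp: cls01_def)
  finally show ?thesis by (simp add: form_val_def)
qed

lemma cls01_simps:
  assumes "a \<in> carrier (Oq_plus n q)"
  shows "cls01 n q a \<in> carrier (Lambda01 n q)"
    and "b \<in> carrier (Oq_plus n q) \<Longrightarrow> cls01 n q a \<oplus>\<^bsub>Lambda01 n q\<^esub> cls01 n q b = cls01 n q (\<lambda>X. a X + b X)"
    and "c \<odot>\<^bsub>Lambda01 n q\<^esub> cls01 n q a = cls01 n q (\<lambda>X. c * a X)"
proof -
  interpret vs_quotient "Oq_plus n q" "I01 n q" by (rule Lambda01_quotient)
  show "cls01 n q a \<in> carrier (Lambda01 n q)"
    "b \<in> carrier (Oq_plus n q) \<Longrightarrow> cls01 n q a \<oplus>\<^bsub>Lambda01 n q\<^esub> cls01 n q b = cls01 n q (\<lambda>X. a X + b X)"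
    "c \<odot>\<^bsub>Lambda01 n q\<^esub> cls01 n q a = cls01 n q (\<lambda>X. c * a X)"
    using coset_closed[OF assms] coset_add[OF assms] coset_smult[OF assms]
    unfolding Lambda01_def cls01_def by (simp_all add: Oq_plus_simps)
qed

lemma cls01_eqI:
  assumes "a \<in> carrier (Oq_plus n q)" "b \<in> carrier (Oq_plus n q)"
    and "\<And>\<alpha>. \<alpha> \<in> pos_roots n \<Longrightarrow> a (root n q \<alpha>) = b (root n q \<alpha>)"
  shows "cls01 n q a = cls01 n q b"
proof -
  interpret vs_quotient "Oq_plus n q" "I01 n q" by (rule Lambda01_quotient)
  have "(\<lambda>X. a X - b X) \<in> I01 n q"
    using assms Oq_minus[of a n q b 1] by (auto simp: I01_iff Oq_plus_simps)
  then show ?thesis unfolding cls01_def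
    by (intro coset_eqI assms(1,2)) (simp add: minus_Oq_plus[OF assms(2)])
qed

lemma Oq_plus_closed:
  "a \<in> carrier (Oq_plus n q) \<Longrightarrow> b \<in> carrier (Oq_plus n q) \<Longrightarrow> (\<lambda>X. a X + b X) \<in> carrier (Oq_plus n q)"
  "a \<in> carrier (Oq_plus n q) \<Longrightarrow> (\<lambda>X. c * a X) \<in> carrier (Oq_plus n q)"
  by (auto simp: Oq_plus_simps Oq_add Oq_smult)

lemma Lambda01_closed:
  assumes "v \<in> carrier (Lambda01 n q)"
  shows "w \<in> carrier (Lambda01 n q) \<Longrightarrow> v \<oplus>\<^bsub>Lambda01 n q\<^esub> w \<in> carrier (Lambda01 n q)"
    and "c \<odot>\<^bsub>Lambda01 n q\<^esub> v \<in> carrier (Lambda01 n q)"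
  using assms by (auto elim!: form_val_exists simp: cls01_simps Oq_plus_closed)

lemma form_val_linear:
  assumes "v \<in> carrier (Lambda01 n q)" "\<alpha> \<in> pos_roots n"
  shows "w \<in> carrier (Lambda01 n q) \<Longrightarrow> form_val n q (v \<oplus>\<^bsub>Lambda01 n q\<^esub> w) \<alpha> = form_val n q v \<alpha> + form_val n q w \<alpha>"
    and "form_val n q (c \<odot>\<^bsub>Lambda01 n q\<^esub> v) \<alpha> = c * form_val n q v \<alpha>"
  using assms by (auto elim!: form_val_exists simp: cls01_simps Oq_plus_closed form_val_cls01)

lemma plus_part_closed:
  assumes "a \<in> carrier (Oq n q)"
  shows "plus_part n q a \<in> carrier (Oq_plus n q)"
  using Oq_minus[OF assms one_Oq_closed, of "oq_counit n q a"]
  by (simp add: plus_part_def Oq_plus_simps one_Oq_one oq_counit_def)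

lemma plus_part_root: "\<alpha> \<in> pos_roots n \<Longrightarrow> plus_part n q a (root n q \<alpha>) = a (root n q \<alpha>)"
  by (simp add: plus_part_def one_Oq_root)

section \<open>Multilinear functionals on words of forms\<close>

text \<open>
  The multilinear extension of \<open>G\<close> from words of roots to words of forms, in which the root \<open>\<alpha>\<close> stands for
  the form dual to it. The second word is the part that has already been expanded.
\<close>

primrec expand :: "nat \<Rightarrow> real \<Rightarrow> ((nat \<times> nat) list \<Rightarrow> complex) \<Rightarrow> form01 list \<Rightarrow> (nat \<times> nat) list \<Rightarrow> complex" where
  "expand n q G [] u = G u"
| "expand n q G (v # vs) u = (\<Sum>\<alpha>\<in>pos_roots n. form_val n q v \<alpha> * expand n q G vs (u @ [\<alpha>]))"

lemma expand_append: "expand n q G (vs @ ws) u = expand n q (expand n q G ws) vs u"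
  by (induction vs arbitrary: u) auto

lemma sum_sum_list_mult:
  fixes f :: "'a \<Rightarrow> complex" and h :: "'b \<Rightarrow> 'c \<Rightarrow> 'a \<Rightarrow> complex"
  shows "(\<Sum>x\<in>A. f x * (\<Sum>(s, b, c)\<leftarrow>xs. s * h b c x)) = (\<Sum>(s, b, c)\<leftarrow>xs. s * (\<Sum>x\<in>A. f x * h b c x))"
proof (induction xs)
  case (Cons y xs)
  then show ?case
    by (cases y) (simp add: distrib_left sum.distrib sum_distrib_left mult.left_commute)
qed simp

text \<open>
  Expanding letters on the right only changes the right context, and the rules hold in every context.
\<close>

lemma invariant_expand:
  assumes "straightening_invariant n q G"
  shows "straightening_invariant n q (expand n q G vs)"
proof (induction vs)
  case Nil
  then show ?case using assms by (simp add: straightening_invariant_def)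
next
  case (Cons v vs)
  show ?case
    unfolding straightening_invariant_def
  proof (intro allI impI)
    fix u w \<beta> \<alpha> assume "reducible n \<beta> \<alpha>"
    then have "expand n q G vs (u @ \<beta> # \<alpha> # w @ [\<epsilon>]) = (\<Sum>(s, \<gamma>, \<delta>)\<leftarrow>straighten q \<beta> \<alpha>. s * expand n q G vs (u @ \<gamma> # \<delta> # w @ [\<epsilon>]))" for \<epsilon>
      using Cons.IH unfolding straightening_invariant_def by blast
    then show "expand n q G (v # vs) (u @ \<beta> # \<alpha> # w) = (\<Sum>(s, \<gamma>, \<delta>)\<leftarrow>straighten q \<beta> \<alpha>. s * expand n q G (v # vs) (u @ \<gamma> # \<delta> # w))"
      by (simp add: sum_sum_list_mult)
  qed
qed

lemma lin_ext_fmon_mult: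
  "lin_ext f (fmon w * p) = lin_ext (\<lambda>v. f (w @ v)) p" "lin_ext f (p * fmon w) = lin_ext (\<lambda>v. f (v @ w)) p"
proof -
  have "p \<in> carrier (free_algebra UNIV)" by (rule free_algebra_UNIV)
  then have "lin_ext f (fmon w * p) = lin_ext (\<lambda>v. f (w @ v)) p \<and> lin_ext f (p * fmon w) = lin_ext (\<lambda>v. f (v @ w)) p"
  proof (induction rule: falg_induct)
    case (monom c v)
    have 1: "fmon w * (fconst c * fmon v) = fconst c * fmon (w @ v)" "fconst c * fmon v * fmon w = fconst c * fmon (v @ w)"
      by (simp_all add: fmon_append fconst_mult_right mult.assoc)
    show ?case unfolding 1 by (simp add: lin_ext_monom)
  qed (simp_all add: lin_ext_0 lin_ext_add distrib_left distrib_right)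
  then show "lin_ext f (fmon w * p) = lin_ext (\<lambda>v. f (w @ v)) p" "lin_ext f (p * fmon w) = lin_ext (\<lambda>v. f (v @ w)) p" by auto
qed

lemma lin_ext_linear: "lin_ext (\<lambda>w. \<Sum>i\<in>A. c i * f i w) p = (\<Sum>i\<in>A. c i * lin_ext (f i) p)"
  unfolding lin_ext_def by (simp add: sum_distrib_left mult.left_commute sum.swap[of _ A])

text \<open>
  The functionals of all invariant functions are used at once: multiplying a polynomial by a word on
  the right replaces one invariant function by another, so only the common kernel is an ideal.
\<close>

definition null_polys :: "nat \<Rightarrow> real \<Rightarrow> form01 falg set" where
  "null_polys n q = {p \<in> carrier (free_algebra (carrier (Lambda01 n q))).
     \<forall>G u. straightening_invariant n q G \<longrightarrow> lin_ext (\<lambda>vs. expand n q G vs u) p = 0}"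

lemma lin_ext_expand_left:
  assumes "\<And>u. lin_ext (\<lambda>vs. expand n q G vs u) p = 0"
  shows "lin_ext (\<lambda>vs. expand n q G (w @ vs) u) p = 0"
  by (induction w arbitrary: u) (simp_all add: assms lin_ext_linear)

text \<open>
  Multiplication by a word of forms on the left lengthens the expanded prefix, and multiplication on the right
  replaces \<open>G\<close> by its expansion, which is again invariant.
\<close>

lemma ideal_null_polys: "ideal (null_polys n q) (free_algebra (carrier (Lambda01 n q)))"
proof (rule idealI)
  let ?F = "free_algebra (carrier (Lambda01 n q))"
  interpret F: assoc_algebra ?F by (rule assoc_algebra_free)
  show "ring ?F" by (rule F.Rng.ring_axioms)
  show "subgroup (null_polys n q) (add_monoid ?F)"
  proof (rule F.Rng.add.subgroupI)
    have "0 \<in> null_polys n q" by (simp add: null_polys_def lin_ext_0 falg_carrier)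
    then show "null_polys n q \<noteq> {}" by blast
    fix p assume p: "p \<in> null_polys n q"
    then have "\<ominus>\<^bsub>?F\<^esub> p = - p"
      by (intro F.Rng.minus_equality) (auto simp: free_algebra_simps falg_carrier null_polys_def)
    then show "\<ominus>\<^bsub>?F\<^esub> p \<in> null_polys n q"
      using p by (auto simp: null_polys_def lin_ext_minus falg_carrier)
  qed (auto simp: null_polys_def free_algebra_simps falg_carrier lin_ext_add)
  fix p x assume p: "p \<in> null_polys n q" and x: "x \<in> carrier ?F"
  from p have pF: "p \<in> carrier ?F" by (simp add: null_polys_def)
  have "lin_ext (\<lambda>vs. expand n q G vs u) (x * p) = 0 \<and> lin_ext (\<lambda>vs. expand n q G vs u) (p * x) = 0"
    if G: "straightening_invariant n q G" for G u
    using x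
  proof (induction rule: falg_induct)
    case (monom c w)
    have "lin_ext (\<lambda>vs. expand n q G (w @ vs) u) p = 0"
      using p G by (intro lin_ext_expand_left) (simp add: null_polys_def)
    moreover have "lin_ext (\<lambda>vs. expand n q (expand n q G w) vs u) p = 0"
      using p invariant_expand[OF G, of w] by (simp add: null_polys_def)
    moreover have "fconst c * fmon w * p = fconst c * (fmon w * p)" "p * (fconst c * fmon w) = fconst c * (p * fmon w)"
      by (simp_all add: mult.assoc fconst_mult_right)
    ultimately show ?case
      by (simp add: lin_ext_fconst_mult lin_ext_fmon_mult expand_append)
  qed (simp_all add: lin_ext_0 lin_ext_add distrib_left distrib_right)
  then show "x \<otimes>\<^bsub>?F\<^esub> p \<in> null_polys n q" "p \<otimes>\<^bsub>?F\<^esub> x \<in> null_polys n q"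
    using x pF by (auto simp: null_polys_def free_algebra_simps falg_carrier)
qed

lemma tensor_relators_null: "tensor_relators (Lambda01 n q) \<subseteq> null_polys n q"
proof
  fix r assume "r \<in> tensor_relators (Lambda01 n q)"
  then consider v w where "r = fvar (v \<oplus>\<^bsub>Lambda01 n q\<^esub> w) - fvar v - fvar w" "v \<in> carrier (Lambda01 n q)" "w \<in> carrier (Lambda01 n q)"
    | c v where "r = fvar (c \<odot>\<^bsub>Lambda01 n q\<^esub> v) - fconst c * fvar v" "v \<in> carrier (Lambda01 n q)"
    unfolding tensor_relators_def by blast
  then show "r \<in> null_polys n q"
  proof cases
    case (1 v w)
    then have "lin_ext (\<lambda>vs. expand n q G vs u) r = 0" for G u
      by (simp add: lin_ext_diff lin_ext_fmon form_val_linear distrib_right sum.distrib)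
    then show ?thesis using 1 by (simp add: null_polys_def falg_carrier Lambda01_closed)
  next
    case (2 c v)
    then have "lin_ext (\<lambda>vs. expand n q G vs u) r = 0" for G u
      by (simp add: lin_ext_diff lin_ext_fmon lin_ext_monom form_val_linear sum_distrib_left mult.assoc)
    then show ?thesis using 2 by (simp add: null_polys_def falg_carrier Lambda01_closed)
  qed
qed

text \<open>
  Evaluating the forms turns the coproduct of \<open>x\<close> into the values of \<open>x\<close> on products of root vectors.
\<close>

lemma I2_null:
  assumes q: "q \<noteq> 0" "q \<noteq> 1" "q \<noteq> -1" and x: "x \<in> I01 n q" and ab: "oq_comult n q x m a b"
  shows "(\<Sum>k<m. fvar (cls01 n q (plus_part n q (a k))) * fvar (cls01 n q (plus_part n q (b k)))) \<in> null_polys n q"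
proof -
  let ?c = "\<lambda>f. cls01 n q (plus_part n q f)"
  have cl: "plus_part n q (a k) \<in> carrier (Oq_plus n q)" "plus_part n q (b k) \<in> carrier (Oq_plus n q)" if "k < m" for k
    using ab that by (auto simp: oq_comult_def intro: plus_part_closed)
  have val: "form_val n q (?c (a k)) \<alpha> = a k (root n q \<alpha>)" "form_val n q (?c (b k)) \<alpha> = b k (root n q \<alpha>)"
    if "k < m" "\<alpha> \<in> pos_roots n" for k \<alpha>
    using cl[OF that(1)] that(2) by (simp_all add: form_val_cls01 plus_part_root)
  have mem: "(\<Sum>k\<in>A. fvar (?c (a k)) * fvar (?c (b k))) \<in> carrier (free_algebra (carrier (Lambda01 n q)))" if "A \<subseteq> {..<m}" for A
    using finite_subset[OF that finite_lessThan] that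
    by (induction A rule: finite_induct) (use cl in \<open>auto intro!: falg_carrier_add falg_carrier_mult falg_carrier_fmon falg_carrier_01 cls01_simps\<close>)
  have "lin_ext (\<lambda>vs. expand n q G vs u) (\<Sum>k<m. fvar (?c (a k)) * fvar (?c (b k))) = 0" if G: "straightening_invariant n q G" for G u
  proof -
    have "lin_ext (\<lambda>vs. expand n q G vs u) (\<Sum>k<m. fvar (?c (a k)) * fvar (?c (b k))) =
        (\<Sum>k<m. \<Sum>\<alpha>\<in>pos_roots n. \<Sum>\<beta>\<in>pos_roots n. a k (root n q \<alpha>) * b k (root n q \<beta>) * G (u @ \<alpha> # \<beta> # []))"
      by (simp add: lin_ext_sum fmon_append[symmetric] lin_ext_fmon val sum_distrib_left mult.assoc)
    also have "\<dots> = (\<Sum>\<alpha>\<in>pos_roots n. \<Sum>\<beta>\<in>pos_roots n. (\<Sum>k<m. a k (root n q \<alpha>) * b k (root n q \<beta>)) * G (u @ \<alpha> # \<beta> # []))"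
      by (subst sum.swap) (intro sum.cong refl, subst sum.swap, simp add: sum_distrib_right)
    also have "\<dots> = (\<Sum>\<alpha>\<in>pos_roots n. \<Sum>\<beta>\<in>pos_roots n. x (root n q \<alpha> \<otimes>\<^bsub>Uq n q\<^esub> root n q \<beta>) * G (u @ \<alpha> # \<beta> # []))"
      using ab root_closed by (intro sum.cong refl) (simp add: oq_comult_def)
    also have "\<dots> = 0" by (rule relation_sum_zero[OF q x G])
    finally show ?thesis .
  qed
  then show ?thesis using mem[of "{..<m}"] by (simp add: null_polys_def)
qed

section \<open>The exterior algebra\<close>

locale quantum_parameter =
  fixes n :: nat and q :: real
  assumes q: "q \<noteq> 0" "q \<noteq> 1" "q \<noteq> -1"
begin

abbreviation (input) "L1 \<equiv> Lambda01 n q"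
abbreviation (input) "FA \<equiv> free_algebra (carrier (Lambda01 n q))"
abbreviation (input) "TA \<equiv> tensor_algebra (Lambda01 n q)"
abbreviation (input) "EA \<equiv> ext_algebra n q"
abbreviation (input) "tcls \<equiv> alg_cls (free_algebra (carrier (Lambda01 n q))) (tensor_relators (Lambda01 n q))"
abbreviation (input) "ecls \<equiv> alg_cls (tensor_algebra (Lambda01 n q)) (I2 n q)"

lemma T_quotient: "algebra_quotient FA (tensor_relators L1)"
  using tensor_relators_null[of n q]
  by (intro algebra_quotient.intro algebra_quotient_axioms.intro assoc_algebra_free) (auto simp: null_polys_def)

lemmas TA_assoc = algebra_quotient.assoc_algebra_Q[OF T_quotient, folded tensor_algebra_def]
lemmas tcls_closed = algebra_quotient.cls_closed[OF T_quotient, folded tensor_algebra_def]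
lemmas tcls_cases = algebra_quotient.cls_cases[OF T_quotient, folded tensor_algebra_def]
lemmas tcls_simps =
  algebra_quotient.cls_add[OF T_quotient, folded tensor_algebra_def, unfolded free_algebra_simps]
  algebra_quotient.cls_mult[OF T_quotient, folded tensor_algebra_def, unfolded free_algebra_simps]
  algebra_quotient.cls_smult[OF T_quotient, folded tensor_algebra_def, unfolded free_algebra_simps]
lemmas tcls_one = algebra_quotient.cls_one[OF T_quotient, folded tensor_algebra_def, unfolded free_algebra_simps]
lemmas tcls_zero = algebra_quotient.cls_zero[OF T_quotient, folded tensor_algebra_def, unfolded free_algebra_simps]
lemmas tcls_relator = algebra_quotient.cls_relator[OF T_quotient, folded tensor_algebra_def]

lemma falg_carrier_sum: "(\<And>i. i \<in> A \<Longrightarrow> f i \<in> carrier (free_algebra X)) \<Longrightarrow> (\<Sum>i\<in>A. f i) \<in> carrier (free_algebra X)"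
  by (induction A rule: infinite_finite_induct) (auto intro: falg_carrier_add falg_carrier_01)

lemma tcls_sum:
  assumes "finite A" "\<And>i. i \<in> A \<Longrightarrow> f i \<in> carrier FA"
  shows "finsum TA (\<lambda>i. tcls (f i)) A = tcls (\<Sum>i\<in>A. f i)"
proof -
  interpret T: assoc_algebra TA by (rule TA_assoc)
  from assms show ?thesis
  proof (induction A rule: finite_induct)
    case empty
    then show ?case by (simp add: tcls_zero)
  next
    case (insert a A)
    then show ?case by (simp add: tcls_closed tcls_simps falg_carrier_sum)
  qed
qed

lemma fvar_cls: "a \<in> carrier (Oq_plus n q) \<Longrightarrow> fvar (cls01 n q a) \<in> carrier FA"
  by (intro falg_carrier_fmon) (simp add: cls01_simps)

text \<open>
  The relations can be represented in the free algebra, where they are compared with the null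
  polynomials.
\<close>

lemma I2_element:
  assumes "oq_comult n q x m a b"
  shows "finsum TA (\<lambda>k. tensor_incl L1 (cls01 n q (plus_part n q (a k))) \<otimes>\<^bsub>TA\<^esub> tensor_incl L1 (cls01 n q (plus_part n q (b k)))) {..<m} =
    tcls (\<Sum>k<m. fvar (cls01 n q (plus_part n q (a k))) * fvar (cls01 n q (plus_part n q (b k))))"
proof -
  interpret T: assoc_algebra TA by (rule TA_assoc)
  have c: "fvar (cls01 n q (plus_part n q (a k))) \<in> carrier FA" "fvar (cls01 n q (plus_part n q (b k))) \<in> carrier FA" if "k < m" for k
    using assms that by (auto simp: oq_comult_def intro!: fvar_cls plus_part_closed)
  have "finsum TA (\<lambda>k. tensor_incl L1 (cls01 n q (plus_part n q (a k))) \<otimes>\<^bsub>TA\<^esub> tensor_incl L1 (cls01 n q (plus_part n q (b k)))) {..<m} =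
    finsum TA (\<lambda>k. tcls (fvar (cls01 n q (plus_part n q (a k))) * fvar (cls01 n q (plus_part n q (b k))))) {..<m}"
    using c by (intro T.Rng.finsum_cong') (auto simp: tensor_incl_def tcls_simps intro!: tcls_closed falg_carrier_mult)
  also have "\<dots> = tcls (\<Sum>k<m. fvar (cls01 n q (plus_part n q (a k))) * fvar (cls01 n q (plus_part n q (b k))))"
    using c by (intro tcls_sum) (auto intro!: falg_carrier_mult)
  finally show ?thesis .
qed

lemma I2_cases:
  assumes "y \<in> I2 n q"
  obtains x m a b where "x \<in> I01 n q" "oq_comult n q x m a b"
    "y = tcls (\<Sum>k<m. fvar (cls01 n q (plus_part n q (a k))) * fvar (cls01 n q (plus_part n q (b k))))"
  using assms I2_element unfolding I2_def Let_def by blast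

lemma E_quotient: "algebra_quotient TA (I2 n q)"
proof (intro algebra_quotient.intro algebra_quotient_axioms.intro TA_assoc subsetI)
  fix y assume "y \<in> I2 n q"
  then obtain x m a b where "x \<in> I01 n q" "oq_comult n q x m a b"
    and y: "y = tcls (\<Sum>k<m. fvar (cls01 n q (plus_part n q (a k))) * fvar (cls01 n q (plus_part n q (b k))))"
    by (rule I2_cases)
  then have "(\<Sum>k<m. fvar (cls01 n q (plus_part n q (a k))) * fvar (cls01 n q (plus_part n q (b k)))) \<in> null_polys n q"
    by (intro I2_null[OF q])
  then show "y \<in> carrier TA" unfolding y by (intro tcls_closed) (simp add: null_polys_def)
qed

lemmas EA_assoc = algebra_quotient.assoc_algebra_Q[OF E_quotient, folded ext_algebra_def]
lemmas ecls_closed = algebra_quotient.cls_closed[OF E_quotient, folded ext_algebra_def]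
lemmas ecls_cases = algebra_quotient.cls_cases[OF E_quotient, folded ext_algebra_def]
lemmas ecls_simps =
  algebra_quotient.cls_add[OF E_quotient, folded ext_algebra_def]
  algebra_quotient.cls_mult[OF E_quotient, folded ext_algebra_def]
  algebra_quotient.cls_smult[OF E_quotient, folded ext_algebra_def]
lemmas ecls_one = algebra_quotient.cls_one[OF E_quotient, folded ext_algebra_def]
lemmas ecls_zero = algebra_quotient.cls_zero[OF E_quotient, folded ext_algebra_def]
lemmas ecls_relator = algebra_quotient.cls_relator[OF E_quotient, folded ext_algebra_def]

text \<open>
  The class in the exterior algebra of a polynomial in forms: two quotients in succession.
\<close>

definition ec :: "form01 falg \<Rightarrow> ext_form" where
  "ec p = ecls (tcls p)"

lemma ec_closed: "p \<in> carrier FA \<Longrightarrow> ec p \<in> carrier EA"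
  by (simp add: ec_def ecls_closed tcls_closed)

lemma ec_cases:
  assumes "y \<in> carrier EA"
  obtains p where "p \<in> carrier FA" "y = ec p"
  using assms by (elim ecls_cases tcls_cases) (auto simp: ec_def)

lemma ec_simps:
  assumes "p \<in> carrier FA"
  shows "r \<in> carrier FA \<Longrightarrow> ec p \<oplus>\<^bsub>EA\<^esub> ec r = ec (p + r)"
    and "r \<in> carrier FA \<Longrightarrow> ec p \<otimes>\<^bsub>EA\<^esub> ec r = ec (p * r)"
    and "c \<odot>\<^bsub>EA\<^esub> ec p = ec (fconst c * p)"
  using assms by (simp_all add: ec_def ecls_simps tcls_simps tcls_closed)

lemma ec_one: "\<one>\<^bsub>EA\<^esub> = ec 1"
  by (simp add: ec_def ecls_one tcls_one)

lemma ec_zero: "\<zero>\<^bsub>EA\<^esub> = ec 0"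
  by (simp add: ec_def ecls_zero tcls_zero)

lemma ext_incl_ec: "ext_incl n q v = ec (fvar v)"
  by (simp add: ext_incl_def ec_def tensor_incl_def)

lemma wedge_ec: "set vs \<subseteq> carrier L1 \<Longrightarrow> wedge n q vs = ec (fmon vs)"
proof (induction vs)
  case Nil
  then show ?case by (simp add: wedge_def ec_one fmon_Nil)
next
  case (Cons v vs)
  then show ?case by (simp add: wedge_def ext_incl_ec ec_simps falg_carrier_fmon fmon_Cons[of v vs])
qed

text \<open>
  The exterior algebra is a quotient of a quotient. The null polynomials contain the relators of the first and
  representatives of those of the second, so their image in the tensor algebra is an ideal that
  contains all quadratic relations.
\<close>

lemma ec_null:
  assumes p: "p \<in> carrier FA" and "ec p = \<zero>\<^bsub>EA\<^esub>"
  shows "p \<in> null_polys n q"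
proof -
  interpret TQ: algebra_quotient FA "tensor_relators L1" by (rule T_quotient)
  interpret EQ: algebra_quotient TA "I2 n q" by (rule E_quotient)
  interpret N: ideal "null_polys n q" FA by (rule ideal_null_polys)
  have J1: "Idl\<^bsub>FA\<^esub> (tensor_relators L1) \<subseteq> null_polys n q"
    using tensor_relators_null by (intro TQ.Rng.genideal_minimal ideal_null_polys)
  have NF: "r \<in> carrier FA" if "r \<in> null_polys n q" for r using that unfolding null_polys_def by blast
  have lift: "r \<in> null_polys n q" if "r \<in> carrier FA" "r' \<in> null_polys n q" "tcls r = tcls r'" for r r'
  proof -
    have "r \<ominus>\<^bsub>FA\<^esub> r' \<in> null_polys n q" using TQ.cls_eqD[OF that(1) NF[OF that(2)] that(3)] J1 by blast
    then have "(r \<ominus>\<^bsub>FA\<^esub> r') \<oplus>\<^bsub>FA\<^esub> r' \<in> null_polys n q" using that(2) by (rule N.a_closed)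
    moreover have "(r \<ominus>\<^bsub>FA\<^esub> r') \<oplus>\<^bsub>FA\<^esub> r' = r" using that(1) NF[OF that(2)]
      by (simp add: a_minus_def TQ.Rng.a_assoc TQ.Rng.l_neg)
    ultimately show ?thesis by simp
  qed
  have "ideal (tcls ` null_polys n q) TA"
  proof (rule idealI)
    show "ring TA" by (rule EQ.Rng.ring_axioms)
    show "subgroup (tcls ` null_polys n q) (add_monoid TA)"
    proof (rule EQ.Rng.add.subgroupI)
      show "tcls ` null_polys n q \<subseteq> carrier TA" using NF by (auto intro: tcls_closed)
      show "tcls ` null_polys n q \<noteq> {}" using N.zero_closed by blast
      fix y assume "y \<in> tcls ` null_polys n q"
      then obtain r where r: "r \<in> null_polys n q" "y = tcls r" by blast
      have "\<ominus>\<^bsub>TA\<^esub> y = tcls (\<ominus>\<^bsub>FA\<^esub> r)"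
        using r NF[OF r(1)] TQ.Rng.l_neg[OF NF[OF r(1)]]
        by (intro EQ.Rng.minus_equality) (simp_all add: tcls_closed tcls_simps tcls_zero free_algebra_simps)
      then show "\<ominus>\<^bsub>TA\<^esub> y \<in> tcls ` null_polys n q" using N.a_inv_closed[OF r(1)] by blast
      fix z assume "z \<in> tcls ` null_polys n q"
      then obtain s where s: "s \<in> null_polys n q" "z = tcls s" by blast
      show "y \<oplus>\<^bsub>TA\<^esub> z \<in> tcls ` null_polys n q"
        using r s NF N.a_closed[OF r(1) s(1)] by (auto simp: tcls_simps free_algebra_simps)
    qed
    fix y z assume "y \<in> tcls ` null_polys n q" "z \<in> carrier TA"
    then obtain r s where r: "r \<in> null_polys n q" "y = tcls r" and s: "s \<in> carrier FA" "z = tcls s"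
      by (auto elim: tcls_cases)
    show "z \<otimes>\<^bsub>TA\<^esub> y \<in> tcls ` null_polys n q" "y \<otimes>\<^bsub>TA\<^esub> z \<in> tcls ` null_polys n q"
      using r s NF N.I_l_closed[OF r(1) s(1)] N.I_r_closed[OF r(1) s(1)] by (auto simp: tcls_simps free_algebra_simps)
  qed
  moreover have "I2 n q \<subseteq> tcls ` null_polys n q"
    using I2_null[OF q] by (auto elim!: I2_cases)
  ultimately have "Idl\<^bsub>TA\<^esub> (I2 n q) \<subseteq> tcls ` null_polys n q" by (intro EQ.Rng.genideal_minimal)
  moreover have "tcls p \<in> Idl\<^bsub>TA\<^esub> (I2 n q)"
    using assms EQ.cls_eq_zero_iff[OF tcls_closed[OF p]] by (simp add: ec_def ext_algebra_def)
  ultimately obtain r where "r \<in> null_polys n q" "tcls p = tcls r" by blast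
  then show ?thesis using lift p by blast
qed


section \<open>Independence of the increasing words\<close>

sublocale R: quadratic_rewriting "root_lt n" "reducible n" "straighten q"
  by (rule straighten_rewriting[OF q(1)])

sublocale E: assoc_algebra "ext_algebra n q"
  by (rule EA_assoc)

lemma invariant_nf: "straightening_invariant n q (\<lambda>w. R.nf w \<gamma>)"
  unfolding straightening_invariant_def by (intro allI impI R.nf_step)

text \<open>
  The coefficient of the increasing word \<open>\<gamma>\<close>. By \<open>ec_null\<close> the choice of the representing polynomial does
  not matter.
\<close>

definition coord :: "(nat \<times> nat) list \<Rightarrow> ext_form \<Rightarrow> complex" where
  "coord \<gamma> y = lin_ext (\<lambda>vs. expand n q (\<lambda>w. R.nf w \<gamma>) vs []) (SOME p. p \<in> carrier FA \<and> y = ec p)"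

lemma coord_ec:
  assumes p: "p \<in> carrier FA"
  shows "coord \<gamma> (ec p) = lin_ext (\<lambda>vs. expand n q (\<lambda>w. R.nf w \<gamma>) vs []) p"
proof -
  define r where "r = (SOME r. r \<in> carrier FA \<and> ec p = ec r)"
  have r: "r \<in> carrier FA \<and> ec p = ec r" unfolding r_def by (rule someI[of _ p]) (simp add: p)
  have neg: "fconst (- 1) * p = - p"
  proof -
    have "fconst (- 1) * p + fconst 1 * p = fconst (- 1 + 1) * p" by (simp only: distrib_right fconst_add[symmetric])
    then show ?thesis by (simp add: fconst_0 fconst_1 eq_neg_iff_add_eq_0)
  qed
  have "ec (r - p) = ec r \<oplus>\<^bsub>EA\<^esub> (- 1) \<odot>\<^bsub>EA\<^esub> ec p"
    using p conjunct1[OF r] by (simp add: ec_simps falg_carrier neg)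
  also have "\<dots> = ec p \<oplus>\<^bsub>EA\<^esub> (- 1) \<odot>\<^bsub>EA\<^esub> ec p" using r by simp
  also have "\<dots> = \<zero>\<^bsub>EA\<^esub>" using p by (simp add: ec_simps falg_carrier neg ec_zero)
  finally have "r - p \<in> null_polys n q" using p r by (intro ec_null) (auto intro: falg_carrier_diff)
  then have "lin_ext (\<lambda>vs. expand n q (\<lambda>w. R.nf w \<gamma>) vs []) (r - p) = 0"
    using invariant_nf by (simp add: null_polys_def)
  then show ?thesis by (simp add: coord_def r_def[symmetric] lin_ext_diff)
qed

lemma coord_add: "y \<in> carrier EA \<Longrightarrow> z \<in> carrier EA \<Longrightarrow> coord \<gamma> (y \<oplus>\<^bsub>EA\<^esub> z) = coord \<gamma> y + coord \<gamma> z"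
  by (elim ec_cases) (simp add: ec_simps coord_ec falg_carrier lin_ext_add)

lemma coord_smult: "y \<in> carrier EA \<Longrightarrow> coord \<gamma> (c \<odot>\<^bsub>EA\<^esub> y) = c * coord \<gamma> y"
  by (elim ec_cases) (simp add: ec_simps coord_ec falg_carrier lin_ext_fconst_mult)

lemma coord_zero: "coord \<gamma> \<zero>\<^bsub>EA\<^esub> = 0"
  by (simp add: ec_zero coord_ec falg_carrier lin_ext_0)

lemma coord_finsum:
  "finite A \<Longrightarrow> f \<in> A \<rightarrow> carrier EA \<Longrightarrow> coord \<gamma> (finsum EA f A) = (\<Sum>i\<in>A. coord \<gamma> (f i))"
proof (induction A rule: finite_induct)
  case empty
  then show ?case by (simp add: coord_zero)
next
  case (insert a A)
  then have "f \<in> A \<rightarrow> carrier EA" "f a \<in> carrier EA" by auto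
  with insert show ?case by (simp add: coord_add)
qed

abbreviation "ew \<equiv> \<lambda>w. wedge n q (map (e01 n q) w)"

lemma e01_closed: "\<alpha> \<in> pos_roots n \<Longrightarrow> e01 n q \<alpha> \<in> carrier L1"
  unfolding e01_cls by (intro cls01_simps u_root[OF q])

lemma e01_word_closed: "set w \<subseteq> pos_roots n \<Longrightarrow> set (map (e01 n q) w) \<subseteq> carrier L1"
  using e01_closed by auto

lemma form_val_e01: "\<alpha> \<in> pos_roots n \<Longrightarrow> \<beta> \<in> pos_roots n \<Longrightarrow> form_val n q (e01 n q \<alpha>) \<beta> = of_bool (\<alpha> = \<beta>)"
  unfolding e01_cls by (simp add: form_val_cls01 u_root[OF q])

lemma expand_e01: "set w \<subseteq> pos_roots n \<Longrightarrow> expand n q G (map (e01 n q) w) u = G (u @ w)"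
proof (induction w arbitrary: u)
  case (Cons \<alpha> w)
  then have "expand n q G (map (e01 n q) (\<alpha> # w)) u = (\<Sum>\<beta>\<in>pos_roots n. of_bool (\<alpha> = \<beta>) * G (u @ \<beta> # w))"
    by (simp add: form_val_e01)
  also have "\<dots> = G (u @ \<alpha> # w)"
    using Cons.prems finite_pos_roots
    by (simp add: of_bool_def if_distrib[of "\<lambda>x. x * y" for y] sum.delta cong: if_cong)
  finally show ?case .
qed simp

lemma coord_ew: "set w \<subseteq> pos_roots n \<Longrightarrow> coord \<gamma> (ew w) = R.nf w \<gamma>"
  using e01_word_closed[of w]
  by (simp add: wedge_ec coord_ec falg_carrier_fmon lin_ext_fmon expand_e01 del: set_map)

lemma nf_increasing:
  assumes "increasing n w"
  shows "R.nf w \<gamma> = of_bool (w = \<gamma>)"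
proof (rule R.nf_irreducible)
  fix p
  show "\<not> R.redex w p"
  proof
    assume "R.redex w p"
    then have "Suc p < length w" "\<not> root_less (w ! p) (w ! Suc p)" by (auto simp: R.redex_def)
    then show False using assms sorted_wrt_nth_less[of root_less w p "Suc p"] by auto
  qed
qed

lemma ew_closed: "set w \<subseteq> pos_roots n \<Longrightarrow> ew w \<in> carrier EA"
  using e01_word_closed[of w] by (simp add: wedge_ec ec_closed falg_carrier_fmon del: set_map)

lemma inj_ew: "inj_on ew {w. increasing n w}"
proof (rule inj_onI)
  fix v w assume v: "v \<in> {w. increasing n w}" and w: "w \<in> {w. increasing n w}" and eq: "ew v = ew w"
  have "coord v (ew v) = coord v (ew w)" using eq by simp
  then show "v = w" using v w by (simp add: coord_ew nf_increasing split: if_splits)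
qed

text \<open>
  On increasing words the functionals \<open>coord \<gamma>\<close> take the values of a dual basis.
\<close>

lemma ew_independent: "\<not> E.lin_dep (ew ` {w. increasing n w})"
proof (rule E.finite_lin_indpt2)
  show "finite (ew ` {w. increasing n w})" using finite_increasing by simp
  show "ew ` {w. increasing n w} \<subseteq> carrier EA" using ew_closed by auto
  fix a assume a: "E.lincomb a (ew ` {w. increasing n w}) = \<zero>\<^bsub>EA\<^esub>"
  show "\<forall>v\<in>ew ` {w. increasing n w}. a v = \<zero>\<^bsub>(class_ring :: complex ring)\<^esub>"
  proof
    fix v assume "v \<in> ew ` {w. increasing n w}"
    then obtain \<gamma> where \<gamma>: "increasing n \<gamma>" "v = ew \<gamma>" by auto
    have "0 = coord \<gamma> (E.lincomb a (ew ` {w. increasing n w}))" using a by (simp add: coord_zero)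
    also have "\<dots> = (\<Sum>y\<in>ew ` {w. increasing n w}. coord \<gamma> (a y \<odot>\<^bsub>EA\<^esub> y))"
      unfolding E.lincomb_def using finite_increasing ew_closed by (intro coord_finsum) auto
    also have "\<dots> = (\<Sum>w\<in>{w. increasing n w}. coord \<gamma> (a (ew w) \<odot>\<^bsub>EA\<^esub> ew w))"
      by (rule sum.reindex[OF inj_ew, unfolded o_def])
    also have "\<dots> = (\<Sum>w\<in>{w. increasing n w}. if w = \<gamma> then a (ew w) else 0)"
      by (intro sum.cong refl) (auto simp: coord_smult ew_closed coord_ew nf_increasing)
    also have "\<dots> = a v" using \<gamma> finite_increasing by simp
    finally show "a v = \<zero>\<^bsub>(class_ring :: complex ring)\<^esub>" by simp
  qed
qed

section \<open>Quadratic relations in the exterior algebra\<close>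

text \<open>
  Equality in the exterior algebra, stated for representing polynomials so that sums and products
  can be computed in the free algebra.
\<close>

definition ec_eq :: "form01 falg \<Rightarrow> form01 falg \<Rightarrow> bool" where
  "ec_eq p r \<longleftrightarrow> p \<in> carrier FA \<and> r \<in> carrier FA \<and> ec p = ec r"

lemma ec_eq_refl: "p \<in> carrier FA \<Longrightarrow> ec_eq p p"
  by (simp add: ec_eq_def)

lemma ec_eq_trans: "ec_eq p r \<Longrightarrow> ec_eq r s \<Longrightarrow> ec_eq p s"
  by (simp add: ec_eq_def)

lemma ec_eq_sym: "ec_eq p r \<Longrightarrow> ec_eq r p"
  by (simp add: ec_eq_def)

lemma ec_eq_add: "ec_eq p p' \<Longrightarrow> ec_eq r r' \<Longrightarrow> ec_eq (p + r) (p' + r')"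
  by (auto simp: ec_eq_def falg_carrier ec_simps(1)[symmetric])

lemma ec_eq_mult: "ec_eq p p' \<Longrightarrow> ec_eq r r' \<Longrightarrow> ec_eq (p * r) (p' * r')"
  by (auto simp: ec_eq_def falg_carrier ec_simps(2)[symmetric])

lemma ec_eq_sum: "(\<And>i. i \<in> A \<Longrightarrow> ec_eq (f i) (g i)) \<Longrightarrow> ec_eq (\<Sum>i\<in>A. f i) (\<Sum>i\<in>A. g i)"
  by (induction A rule: infinite_finite_induct) (auto intro: ec_eq_add ec_eq_refl falg_carrier_01)

lemma ec_eq_relator:
  assumes "p - r \<in> tensor_relators L1" "p \<in> carrier FA" "r \<in> carrier FA"
  shows "ec_eq p r"
proof -
  have "tcls p = tcls ((p - r) + r)" by simp
  also have "\<dots> = tcls (p - r) \<oplus>\<^bsub>TA\<^esub> tcls r"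
    using assms by (simp only: tcls_simps falg_carrier_diff)
  also have "\<dots> = tcls (0 + r)"
    unfolding tcls_relator[OF assms(1)] tcls_zero using assms(3) by (simp only: tcls_simps falg_carrier_01)
  finally show ?thesis using assms by (simp add: ec_eq_def ec_def)
qed

lemma ec_eq_form_add:
  assumes "v \<in> carrier L1" "w \<in> carrier L1"
  shows "ec_eq (fvar (v \<oplus>\<^bsub>L1\<^esub> w)) (fvar v + fvar w)"
proof (rule ec_eq_relator)
  show "fvar (v \<oplus>\<^bsub>L1\<^esub> w) - (fvar v + fvar w) \<in> tensor_relators L1"
    unfolding tensor_relators_def using assms by (auto simp: diff_diff_eq)
qed (use assms in \<open>auto intro!: falg_carrier_add falg_carrier_fmon Lambda01_closed\<close>)

lemma ec_eq_form_smult: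
  assumes "v \<in> carrier L1"
  shows "ec_eq (fvar (c \<odot>\<^bsub>L1\<^esub> v)) (fconst c * fvar v)"
proof (rule ec_eq_relator)
  show "fvar (c \<odot>\<^bsub>L1\<^esub> v) - fconst c * fvar v \<in> tensor_relators L1"
    unfolding tensor_relators_def using assms by auto
qed (use assms in \<open>auto intro!: falg_carrier_mult falg_carrier_fconst falg_carrier_fmon Lambda01_closed\<close>)

lemma ec_eq_form_sum:
  assumes "finite A" "A \<subseteq> pos_roots n"
  shows "(\<lambda>X. \<Sum>\<alpha>\<in>A. c \<alpha> * u_root n q \<alpha> X) \<in> carrier (Oq_plus n q) \<and>
    ec_eq (fvar (cls01 n q (\<lambda>X. \<Sum>\<alpha>\<in>A. c \<alpha> * u_root n q \<alpha> X))) (\<Sum>\<alpha>\<in>A. fconst (c \<alpha>) * fvar (e01 n q \<alpha>))"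
  using assms
proof (induction A rule: finite_induct)
  case empty
  have z: "(\<lambda>X. 0) \<in> carrier (Oq_plus n q)" by (simp add: Oq_plus_simps Oq_zero_closed)
  have "ec_eq (fvar (0 \<odot>\<^bsub>L1\<^esub> cls01 n q (\<lambda>X. 0))) (fconst 0 * fvar (cls01 n q (\<lambda>X. 0)))"
    using z by (intro ec_eq_form_smult cls01_simps)
  then show ?case using z by (simp add: cls01_simps fconst_0)
next
  case (insert \<alpha> A)
  let ?s = "\<lambda>X. \<Sum>\<alpha>\<in>A. c \<alpha> * u_root n q \<alpha> X" and ?t = "\<lambda>X. c \<alpha> * u_root n q \<alpha> X"
  have \<alpha>: "\<alpha> \<in> pos_roots n" using insert by simp
  have t: "?t \<in> carrier (Oq_plus n q)" using u_root(1)[OF q \<alpha>] by (rule Oq_plus_closed)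
  have s: "?s \<in> carrier (Oq_plus n q)" using insert by simp
  have sX: "(\<lambda>X. \<Sum>\<alpha>\<in>insert \<alpha> A. c \<alpha> * u_root n q \<alpha> X) = (\<lambda>X. ?t X + ?s X)"
    using insert(1,2) by simp
  have sE: "(\<Sum>\<alpha>\<in>insert \<alpha> A. fconst (c \<alpha>) * fvar (e01 n q \<alpha>)) =
      fconst (c \<alpha>) * fvar (e01 n q \<alpha>) + (\<Sum>\<alpha>\<in>A. fconst (c \<alpha>) * fvar (e01 n q \<alpha>))"
    using insert(1,2) by simp
  have sC: "cls01 n q (\<lambda>X. ?t X + ?s X) = (c \<alpha> \<odot>\<^bsub>L1\<^esub> e01 n q \<alpha>) \<oplus>\<^bsub>L1\<^esub> cls01 n q ?s"
    using t s by (simp add: e01_cls cls01_simps u_root[OF q \<alpha>])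
  have e1: "ec_eq (fvar ((c \<alpha> \<odot>\<^bsub>L1\<^esub> e01 n q \<alpha>) \<oplus>\<^bsub>L1\<^esub> cls01 n q ?s)) (fvar (c \<alpha> \<odot>\<^bsub>L1\<^esub> e01 n q \<alpha>) + fvar (cls01 n q ?s))"
    using s \<alpha> by (intro ec_eq_form_add Lambda01_closed e01_closed cls01_simps)
  have e2: "ec_eq (fvar (c \<alpha> \<odot>\<^bsub>L1\<^esub> e01 n q \<alpha>) + fvar (cls01 n q ?s))
      (fconst (c \<alpha>) * fvar (e01 n q \<alpha>) + (\<Sum>\<alpha>\<in>A. fconst (c \<alpha>) * fvar (e01 n q \<alpha>)))"
    using insert \<alpha> by (intro ec_eq_add ec_eq_form_smult e01_closed) auto
  have "ec_eq (fvar (cls01 n q (\<lambda>X. ?t X + ?s X)))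
      (fconst (c \<alpha>) * fvar (e01 n q \<alpha>) + (\<Sum>\<alpha>\<in>A. fconst (c \<alpha>) * fvar (e01 n q \<alpha>)))"
    unfolding sC using e1 e2 by (rule ec_eq_trans)
  then show ?case unfolding sX sE using Oq_plus_closed(1)[OF t s] by blast
qed

text \<open>
  Both sides take the same values on all root vectors, and forms are determined by these values.
\<close>

lemma ec_eq_form:
  assumes a: "a \<in> carrier (Oq_plus n q)"
  shows "ec_eq (fvar (cls01 n q a)) (\<Sum>\<alpha>\<in>pos_roots n. fconst (a (root n q \<alpha>)) * fvar (e01 n q \<alpha>))"
proof -
  let ?s = "\<lambda>X. \<Sum>\<alpha>\<in>pos_roots n. a (root n q \<alpha>) * u_root n q \<alpha> X"
  note S = ec_eq_form_sum[OF finite_pos_roots order_refl, of "\<lambda>\<alpha>. a (root n q \<alpha>)"]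
  have "cls01 n q a = cls01 n q ?s"
  proof (rule cls01_eqI[OF a conjunct1[OF S]])
    fix \<beta> assume \<beta>: "\<beta> \<in> pos_roots n"
    have "?s (root n q \<beta>) = (\<Sum>\<alpha>\<in>pos_roots n. if \<alpha> = \<beta> then a (root n q \<alpha>) else 0)"
      using \<beta> by (intro sum.cong refl) (simp add: u_root[OF q])
    then show "a (root n q \<beta>) = ?s (root n q \<beta>)" using \<beta> finite_pos_roots by simp
  qed
  then show ?thesis using S by simp
qed

text \<open>
  Insert the expansion of both tensor factors in the dual basis into the relation of \<open>x\<close>; the coproduct
  of \<open>x\<close> reassembles to its values on products of root vectors.
\<close>

lemma ec_eq_pairing:
  assumes x: "x \<in> I01 n q" and ab: "oq_comult n q x m a b"
  shows "ec_eq 0 (\<Sum>\<alpha>\<in>pos_roots n. \<Sum>\<beta>\<in>pos_roots n.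
    fconst (x (root n q \<alpha> \<otimes>\<^bsub>Uq n q\<^esub> root n q \<beta>)) * (fvar (e01 n q \<alpha>) * fvar (e01 n q \<beta>)))"
proof -
  let ?c = "\<lambda>f. cls01 n q (plus_part n q f)" and ?e = "\<lambda>\<alpha>. fvar (e01 n q \<alpha>)" and ?P = "pos_roots n"
  let ?p = "\<Sum>k<m. fvar (?c (a k)) * fvar (?c (b k))"
  have cl: "plus_part n q (a k) \<in> carrier (Oq_plus n q)" "plus_part n q (b k) \<in> carrier (Oq_plus n q)" if "k < m" for k
    using ab that by (auto simp: oq_comult_def intro: plus_part_closed)
  have pF: "?p \<in> carrier FA" using cl by (intro falg_carrier_sum falg_carrier_mult fvar_cls) auto
  have "tcls ?p \<in> I2 n q"
    unfolding I2_def Let_def using x ab I2_element[OF ab] by (auto intro!: exI)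
  then have "ecls (tcls ?p) = \<zero>\<^bsub>EA\<^esub>" by (rule ecls_relator)
  then have z1: "ec_eq 0 ?p" using pF by (simp add: ec_eq_def falg_carrier_01 ec_zero[symmetric]) (simp add: ec_def)
  have z2: "ec_eq ?p (\<Sum>k<m. (\<Sum>\<alpha>\<in>?P. fconst (a k (root n q \<alpha>)) * ?e \<alpha>) * (\<Sum>\<beta>\<in>?P. fconst (b k (root n q \<beta>)) * ?e \<beta>))"
  proof (intro ec_eq_sum ec_eq_mult)
    fix k assume "k \<in> {..<m}"
    then have k: "k < m" by simp
    show "ec_eq (fvar (?c (a k))) (\<Sum>\<alpha>\<in>?P. fconst (a k (root n q \<alpha>)) * ?e \<alpha>)"
      using ec_eq_form[OF cl(1)[OF k]] by (simp add: plus_part_root cong: sum.cong)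
    show "ec_eq (fvar (?c (b k))) (\<Sum>\<alpha>\<in>?P. fconst (b k (root n q \<alpha>)) * ?e \<alpha>)"
      using ec_eq_form[OF cl(2)[OF k]] by (simp add: plus_part_root cong: sum.cong)
  qed
  have z3: "(\<Sum>k<m. (\<Sum>\<alpha>\<in>?P. fconst (a k (root n q \<alpha>)) * ?e \<alpha>) * (\<Sum>\<beta>\<in>?P. fconst (b k (root n q \<beta>)) * ?e \<beta>)) =
     (\<Sum>\<alpha>\<in>?P. \<Sum>\<beta>\<in>?P. fconst (x (root n q \<alpha> \<otimes>\<^bsub>Uq n q\<^esub> root n q \<beta>)) * (?e \<alpha> * ?e \<beta>))"
  proof -
    have fs: "fconst (\<Sum>k\<in>A. s k) = (\<Sum>k\<in>A. fconst (s k))" for A and s :: "nat \<Rightarrow> complex"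
      by (induction A rule: infinite_finite_induct) (simp_all add: fconst_0 fconst_add[symmetric])
    have mm: "(fconst c * y) * (fconst d * z) = fconst (c * d) * (y * z)" for c d and y z :: "form01 falg"
      by (simp only: mult.assoc[of "fconst c" y] fconst_mult_right[of y d z]) (simp only: mult.assoc[symmetric] fconst_mult)
    have "(\<Sum>k<m. (\<Sum>\<alpha>\<in>?P. fconst (a k (root n q \<alpha>)) * ?e \<alpha>) * (\<Sum>\<beta>\<in>?P. fconst (b k (root n q \<beta>)) * ?e \<beta>)) =
      (\<Sum>k<m. \<Sum>\<alpha>\<in>?P. \<Sum>\<beta>\<in>?P. fconst (a k (root n q \<alpha>) * b k (root n q \<beta>)) * (?e \<alpha> * ?e \<beta>))"
      by (simp add: sum_product mm)
    also have "\<dots> = (\<Sum>\<alpha>\<in>?P. \<Sum>\<beta>\<in>?P. \<Sum>k<m. fconst (a k (root n q \<alpha>) * b k (root n q \<beta>)) * (?e \<alpha> * ?e \<beta>))"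
      by (subst sum.swap) (intro sum.cong refl sum.swap)
    also have "\<dots> = (\<Sum>\<alpha>\<in>?P. \<Sum>\<beta>\<in>?P. fconst (x (root n q \<alpha> \<otimes>\<^bsub>Uq n q\<^esub> root n q \<beta>)) * (?e \<alpha> * ?e \<beta>))"
      using ab root_closed by (intro sum.cong refl) (simp add: oq_comult_def fs sum_distrib_right)
    finally show ?thesis .
  qed
  show ?thesis using ec_eq_trans[OF z1 z2] unfolding z3 .
qed


lemma fconst_minus: "fconst (- c) = - fconst c"
proof -
  have "fconst (- c) + fconst c = 0" by (simp add: fconst_add fconst_0)
  then show ?thesis by (simp add: eq_neg_iff_add_eq_0)
qed

lemma sum_single_pair:
  fixes h :: "'i \<Rightarrow> 'i \<Rightarrow> 'x falg"
  assumes "finite P" "a \<in> P" "b \<in> P"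
  shows "(\<Sum>\<mu>\<in>P. \<Sum>\<nu>\<in>P. fconst (if \<mu> = a \<and> \<nu> = b then c else 0) * h \<mu> \<nu>) = fconst c * h a b"
proof -
  have "(\<Sum>\<mu>\<in>P. \<Sum>\<nu>\<in>P. fconst (if \<mu> = a \<and> \<nu> = b then c else 0) * h \<mu> \<nu>) =
      (\<Sum>\<mu>\<in>P. if \<mu> = a then (\<Sum>\<nu>\<in>P. if \<nu> = b then fconst c * h a b else 0) else 0)"
    by (intro sum.cong refl) (auto simp: fconst_0 intro!: sum.cong sum.neutral)
  then show ?thesis using assms by simp
qed

text \<open>
  The relation contributed by \<open>u\<^sub>l\<^sub>k u\<^sub>j\<^sub>i\<close> has the coefficient \<open>1/q\<close> or \<open>1\<close> at \<open>e\<^sub>\<beta> \<and> e\<^sub>\<alpha>\<close>, and dividing by it gives the rule.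
  For \<open>\<beta> = \<alpha>\<close> the relation is \<open>(1/q + q) e\<^sub>\<alpha> \<and> e\<^sub>\<alpha> = 0\<close>, with a nonzero factor since \<open>q\<close> is real.
\<close>

lemma ec_eq_straighten:
  assumes r: "reducible n \<beta> \<alpha>"
  shows "ec_eq (fvar (e01 n q \<beta>) * fvar (e01 n q \<alpha>))
    (\<Sum>(s, \<gamma>, \<delta>)\<leftarrow>straighten q \<beta> \<alpha>. fconst s * (fvar (e01 n q \<gamma>) * fvar (e01 n q \<delta>)))"
proof -
  obtain i j k l where ab: "\<beta> = (i, j)" "\<alpha> = (k, l)" by (cases \<beta>; cases \<alpha>)
  have P: "(i, j) \<in> pos_roots n" "(k, l) \<in> pos_roots n" and nl: "\<not> root_less (i, j) (k, l)" using r by (auto simp: ab)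
  have lt: "i < j" "k < l" using P by (auto simp: pos_roots_def)
  define T where "T = {1..n+1}"
  have T: "l \<in> T" "j \<in> T" "k \<in> T" "i \<in> T" using P by (auto simp: pos_roots_def T_def)
  define x where "x = sq_coeff n q (l, j) (k, i)"
  have S: "(l, j) \<in> {1..n+1} \<times> {1..n+1}" "(k, i) \<in> {1..n+1} \<times> {1..n+1}" using T by (auto simp: T_def)
  interpret W: uq_weight_matrices n q "{1..n+1} \<times> {1..n+1}" "sq_gen q"
    "\<lambda>k (a, c). of_bool (k + 1 = a) - of_bool (a = k) + (of_bool (k + 1 = c) - of_bool (c = k))"
    by (rule sq_matrices[OF q])
  have x: "x \<in> I01 n q"
    using W.coeff_in_Oq[OF S] W.coeff_one[OF S] lt sq_coeff_root[OF q P nl]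
    unfolding I01_iff Oq_plus_simps x_def by auto
  obtain f g where fg: "oq_comult n q x (card ({1..n+1} \<times> {1..n+1})) f g"
    using coeff_comult[OF sq_matrices[OF q] S] unfolding x_def by blast
  define h where "h \<mu> \<nu> = fvar (e01 n q \<mu>) * fvar (e01 n q \<nu>)" for \<mu> \<nu>
  have hF: "h \<mu> \<nu> \<in> carrier FA" if "\<mu> \<in> pos_roots n" "\<nu> \<in> pos_roots n" for \<mu> \<nu>
    unfolding h_def using that by (intro falg_carrier_mult falg_carrier_fmon) (auto intro: e01_closed)
  define lam kap D :: complex where "lam = (if i = k then of_real (1 / q) else 1)"
    and "kap = (if j = l then of_real q else if j = k then of_real (1 / q) else 1)"
    and "D = of_real (q - 1 / q)"
  let ?c = "k < i \<and> j < l"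
  have cP: "(i, l) \<in> pos_roots n" "(k, j) \<in> pos_roots n" if ?c using P that by (auto simp: pos_roots_def)
  define Z where "Z = fconst lam * h (i, j) (k, l) + fconst kap * h (k, l) (i, j) + (if ?c then fconst D * h (i, l) (k, j) else 0)"
  have Z: "ec_eq 0 Z"
  proof -
    have "ec_eq 0 (\<Sum>\<mu>\<in>pos_roots n. \<Sum>\<nu>\<in>pos_roots n. fconst (x (root n q \<mu> \<otimes>\<^bsub>Uq n q\<^esub> root n q \<nu>)) * h \<mu> \<nu>)"
      using ec_eq_pairing[OF x fg] by (simp only: h_def)
    also have "(\<Sum>\<mu>\<in>pos_roots n. \<Sum>\<nu>\<in>pos_roots n. fconst (x (root n q \<mu> \<otimes>\<^bsub>Uq n q\<^esub> root n q \<nu>)) * h \<mu> \<nu>) =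
      (\<Sum>\<mu>\<in>pos_roots n. \<Sum>\<nu>\<in>pos_roots n. fconst (if \<mu> = (i, j) \<and> \<nu> = (k, l) then lam else 0) * h \<mu> \<nu> +
        fconst (if \<mu> = (k, l) \<and> \<nu> = (i, j) then kap else 0) * h \<mu> \<nu> +
        (if ?c then fconst (if \<mu> = (i, l) \<and> \<nu> = (k, j) then D else 0) * h \<mu> \<nu> else 0))"
    proof (intro sum.cong refl)
      fix \<mu> \<nu> assume "\<mu> \<in> pos_roots n" "\<nu> \<in> pos_roots n"
      then have "x (root n q \<mu> \<otimes>\<^bsub>Uq n q\<^esub> root n q \<nu>) = (if \<mu> = (i, j) \<and> \<nu> = (k, l) then lam else 0) +
        (if \<mu> = (k, l) \<and> \<nu> = (i, j) then kap else 0) + (if ?c \<and> \<mu> = (i, l) \<and> \<nu> = (k, j) then D else 0)"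
        unfolding x_def lam_def kap_def D_def by (simp only: sq_coeff_root_root[OF q P nl] conj_assoc)
      then show "fconst (x (root n q \<mu> \<otimes>\<^bsub>Uq n q\<^esub> root n q \<nu>)) * h \<mu> \<nu> =
        fconst (if \<mu> = (i, j) \<and> \<nu> = (k, l) then lam else 0) * h \<mu> \<nu> +
        fconst (if \<mu> = (k, l) \<and> \<nu> = (i, j) then kap else 0) * h \<mu> \<nu> +
        (if ?c then fconst (if \<mu> = (i, l) \<and> \<nu> = (k, j) then D else 0) * h \<mu> \<nu> else 0)"
        by (cases ?c) (simp_all only: fconst_add[symmetric] distrib_right fconst_0 simp_thms if_True if_False add_0_right mult_zero_left)
    qed
    also have "\<dots> = Z"
    proof (cases ?c)
      case True
      show ?thesis
        unfolding Z_def by (simp only: True simp_thms if_True sum.distrib sum_single_pair[OF finite_pos_roots] P cP[OF True])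
    next
      case False
      show ?thesis
        unfolding Z_def
        by (simp only: False if_False add_0_right sum.distrib sum_single_pair[OF finite_pos_roots] P)
    qed
    finally show ?thesis .
  qed
  have scale: "ec_eq L R" if "L = R + fconst t * Z" "R \<in> carrier FA" for L R t
  proof -
    have "ec_eq (R + fconst t * 0) (R + fconst t * Z)"
      using that(2) by (intro ec_eq_add ec_eq_mult Z ec_eq_refl falg_carrier_fconst)
    then show ?thesis using that(1) by (simp add: ec_eq_sym)
  qed
  have cancel: "fconst s * (fconst t * y) = fconst (s * t) * y" for s t and y :: "form01 falg"
    by (simp add: mult.assoc[symmetric] fconst_mult)
  show ?thesis
  proof (cases "\<beta> = \<alpha>")
    case True
    have pos: "1 / q + q \<noteq> 0"
    proof
      assume "1 / q + q = 0"
      then have "1 + q * q = 0" using q by (simp add: field_simps)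
      then show False using zero_le_square[of q] by linarith
    qed
    have "lam + kap = of_real (1 / q + q)" using True by (simp add: lam_def kap_def ab)
    then have c0: "lam + kap \<noteq> 0" using pos by (simp only: of_real_eq_0_iff) simp
    have "h \<beta> \<alpha> = 0 + fconst (1 / (lam + kap)) * Z"
    proof -
      have "Z = fconst (lam + kap) * h \<beta> \<alpha>"
        using True by (simp add: Z_def ab fconst_add[symmetric] distrib_right)
      then have "fconst (1 / (lam + kap)) * Z = fconst (1 / (lam + kap) * (lam + kap)) * h \<beta> \<alpha>" by (simp only: cancel)
      also have "\<dots> = h \<beta> \<alpha>" using c0 by (simp add: fconst_1)
      finally show ?thesis by simp
    qed
    then have "ec_eq (h \<beta> \<alpha>) 0" by (rule scale) (rule falg_carrier_01)
    then show ?thesis using True by (simp add: h_def straighten_def)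
  next
    case False
    define R where "R = - (fconst (swap_coeff q \<beta> \<alpha>) * h \<alpha> \<beta>) - (if ?c then fconst D * h (i, l) (k, j) else 0)"
    have lam1: "1 / lam * lam = 1" using q by (simp add: lam_def)
    have sw: "1 / lam * kap = swap_coeff q \<beta> \<alpha>" using lt by (auto simp: lam_def kap_def swap_coeff_def ab)
    \<comment> \<open>For nested roots \<open>i \<noteq> k\<close>, so the divisor is \<open>1\<close>.\<close>
    have lamD: "1 / lam * D = D" if ?c using that by (simp add: lam_def)
    have "h \<beta> \<alpha> = R + fconst (1 / lam) * Z"
    proof -
      have "fconst (1 / lam) * Z = fconst (1 / lam * lam) * h \<beta> \<alpha> + fconst (1 / lam * kap) * h \<alpha> \<beta> +
          (if ?c then fconst (1 / lam * D) * h (i, l) (k, j) else 0)"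
        unfolding Z_def ab by (cases ?c) (simp_all only: simp_thms if_True if_False distrib_left cancel mult_zero_right)
      also have "\<dots> = h \<beta> \<alpha> + fconst (swap_coeff q \<beta> \<alpha>) * h \<alpha> \<beta> + (if ?c then fconst D * h (i, l) (k, j) else 0)"
        unfolding sw lam1 by (cases ?c) (simp_all only: simp_thms if_True if_False lamD fconst_1 mult_1_left)
      finally show ?thesis by (simp add: R_def)
    qed
    moreover have "R \<in> carrier FA"
      unfolding R_def using P cP
      by (auto simp: ab intro!: falg_carrier_diff falg_carrier_minus falg_carrier_mult falg_carrier_fconst hF falg_carrier_01)
    ultimately have "ec_eq (h \<beta> \<alpha>) R" by (rule scale)
    moreover have "(\<Sum>(s, \<gamma>, \<delta>)\<leftarrow>straighten q \<beta> \<alpha>. fconst s * h \<gamma> \<delta>) = R"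
      using False by (auto simp: straighten_def ab R_def D_def fconst_minus simp del: of_real_diff)
    ultimately show ?thesis by (simp add: h_def)
  qed
qed

section \<open>Spanning by the increasing words\<close>

definition polys_over :: "ext_form set \<Rightarrow> form01 falg set" where
  "polys_over W = {p \<in> carrier FA. ec p \<in> E.span W}"

lemma submodule_span: "W \<subseteq> carrier EA \<Longrightarrow> submodule (class_ring :: complex ring) (E.span W) EA"
  by (rule E.span_is_submodule)

lemma polys_over_zero: "W \<subseteq> carrier EA \<Longrightarrow> 0 \<in> polys_over W"
  using submodule.zero_closed[OF submodule_span, of W] by (simp add: polys_over_def falg_carrier_01 ec_zero)

lemma polys_over_add: "W \<subseteq> carrier EA \<Longrightarrow> p \<in> polys_over W \<Longrightarrow> r \<in> polys_over W \<Longrightarrow> p + r \<in> polys_over W"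
  using submodule.m_closed[OF submodule_span, of W "ec p" "ec r"] by (simp add: polys_over_def falg_carrier_add ec_simps)

lemma polys_over_smult: "W \<subseteq> carrier EA \<Longrightarrow> p \<in> polys_over W \<Longrightarrow> fconst c * p \<in> polys_over W"
  using submodule.smult_closed[OF submodule_span, of W c "ec p"]
  by (simp add: polys_over_def falg_carrier_mult falg_carrier_fconst ec_simps)

lemma polys_over_sum: "W \<subseteq> carrier EA \<Longrightarrow> (\<And>i. i \<in> A \<Longrightarrow> f i \<in> polys_over W) \<Longrightarrow> (\<Sum>i\<in>A. f i) \<in> polys_over W"
  by (induction A rule: infinite_finite_induct) (auto intro: polys_over_zero polys_over_add)

lemma polys_over_sum_list:
  "W \<subseteq> carrier EA \<Longrightarrow> (\<And>x. x \<in> set xs \<Longrightarrow> f x \<in> polys_over W) \<Longrightarrow> (\<Sum>x\<leftarrow>xs. f x) \<in> polys_over W"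
  by (induction xs) (auto intro: polys_over_zero polys_over_add)

lemma polys_over_ec_eq: "ec_eq p r \<Longrightarrow> r \<in> polys_over W \<Longrightarrow> p \<in> polys_over W"
  by (simp add: polys_over_def ec_eq_def)

definition basis_words :: "nat \<Rightarrow> ext_form set" where
  "basis_words k = ew ` {w. length w = k \<and> increasing n w}"

lemma basis_words_closed: "basis_words k \<subseteq> carrier EA"
  using ew_closed by (auto simp: basis_words_def)

abbreviation "ep \<equiv> \<lambda>w. fmon (map (e01 n q) w)"

lemma ep_closed: "set w \<subseteq> pos_roots n \<Longrightarrow> ep w \<in> carrier FA"
  by (rule falg_carrier_fmon[OF e01_word_closed])

lemma no_redex_increasing:
  assumes "set w \<subseteq> pos_roots n" "\<And>p. \<not> R.redex w p"
  shows "increasing n w"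
proof -
  have "root_less (w ! p) (w ! Suc p)" if "Suc p < length w" for p
  proof -
    have "w ! p \<in> pos_roots n" "w ! Suc p \<in> pos_roots n"
      using that assms(1) nth_mem[of p w] nth_mem[of "Suc p" w] by (meson Suc_lessD subsetD)+
    then show ?thesis using assms(2)[of p] that by (auto simp: R.redex_def)
  qed
  moreover have "transp root_less" by (auto simp: transp_def root_less_def)
  ultimately have "sorted_wrt root_less w" by (simp add: sorted_wrt_iff_nth_Suc_transp)
  then show ?thesis using assms(1) by simp
qed

lemma sum_list_triple_mult:
  fixes f :: "'i \<Rightarrow> 'j \<Rightarrow> 'k \<Rightarrow> 'r :: semiring_0"
  shows "p * ((\<Sum>(s, x, y)\<leftarrow>xs. f s x y) * r) = (\<Sum>(s, x, y)\<leftarrow>xs. p * (f s x y * r))"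
  by (induction xs) (auto simp: distrib_left distrib_right)

text \<open>
  Straightening preserves the length and lowers the word, and a word without redex is increasing.
\<close>

lemma monomial_span:
  "set w \<subseteq> pos_roots n \<Longrightarrow> ep w \<in> polys_over (basis_words (length w))"
proof (induction w rule: wf_induct_rule[OF R.wf_word_less])
  case (1 w)
  show ?case
  proof (cases "\<exists>p. R.redex w p")
    case False
    then have "increasing n w" using 1(2) by (intro no_redex_increasing) auto
    then have "ew w \<in> basis_words (length w)" by (auto simp: basis_words_def)
    then have "ew w \<in> E.span (basis_words (length w))" using E.in_own_span[OF basis_words_closed] by blast
    then show ?thesis
      using 1(2) ep_closed[OF 1(2)] wedge_ec[OF e01_word_closed[OF 1(2)]] by (simp add: polys_over_def)
  next
    case True
    then obtain u \<beta> \<alpha> v where w: "w = u @ \<beta> # \<alpha> # v" and r: "reducible n \<beta> \<alpha>" by (auto elim: R.redexD)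
    have uv: "set u \<subseteq> pos_roots n" "set v \<subseteq> pos_roots n" using 1(2) by (auto simp: w)
    let ?e = "\<lambda>\<alpha>. fvar (e01 n q \<alpha>)" and ?xs = "straighten q \<beta> \<alpha>"
    have two: "ep (\<gamma> # \<delta> # v) = (?e \<gamma> * ?e \<delta>) * ep v" for \<gamma> \<delta>
      by (simp only: list.map fmon_Cons[of "e01 n q \<gamma>" "e01 n q \<delta> # map (e01 n q) v"]
          fmon_Cons[of "e01 n q \<delta>" "map (e01 n q) v"] mult.assoc)
    have "ep w = ep u * ((?e \<beta> * ?e \<alpha>) * ep v)"
      by (simp only: w map_append fmon_append two)
    also have "ec_eq \<dots> (ep u * ((\<Sum>(s, \<gamma>, \<delta>)\<leftarrow>?xs. fconst s * (?e \<gamma> * ?e \<delta>)) * ep v))"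
      using uv by (intro ec_eq_mult ec_eq_refl ep_closed ec_eq_straighten r)
    also have "ep u * ((\<Sum>(s, \<gamma>, \<delta>)\<leftarrow>?xs. fconst s * (?e \<gamma> * ?e \<delta>)) * ep v) =
        (\<Sum>(s, \<gamma>, \<delta>)\<leftarrow>?xs. fconst s * ep (u @ \<gamma> # \<delta> # v))"
    proof -
      have "ep u * (fconst s * (?e \<gamma> * ?e \<delta>) * ep v) = fconst s * ep (u @ \<gamma> # \<delta> # v)" for s \<gamma> \<delta>
        by (simp only: map_append fmon_append two mult.assoc fconst_mult_right)
      then show ?thesis by (simp only: sum_list_triple_mult)
    qed
    finally have eq: "ec_eq (ep w) (\<Sum>(s, \<gamma>, \<delta>)\<leftarrow>?xs. fconst s * ep (u @ \<gamma> # \<delta> # v))" .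
    have "(\<Sum>(s, \<gamma>, \<delta>)\<leftarrow>?xs. fconst s * ep (u @ \<gamma> # \<delta> # v)) \<in> polys_over (basis_words (length w))"
    proof (rule polys_over_sum_list[OF basis_words_closed])
      fix t assume t: "t \<in> set ?xs"
      obtain s \<gamma> \<delta> where st: "t = (s, \<gamma>, \<delta>)" by (cases t)
      have less: "root_lt n \<gamma> \<beta>" using R.decreasing[OF r] t by (simp add: st)
      have \<delta>: "\<delta> \<in> pos_roots n" using t r by (cases \<beta>; cases \<alpha>) (auto simp: st straighten_def pos_roots_def split: if_splits)
      have "ep (u @ \<gamma> # \<delta> # v) \<in> polys_over (basis_words (length (u @ \<gamma> # \<delta> # v)))"
        using uv less \<delta> by (intro 1(1)) (auto simp: w intro: R.word_less_replace)
      then show "(case t of (s, \<gamma>, \<delta>) \<Rightarrow> fconst s * ep (u @ \<gamma> # \<delta> # v)) \<in> polys_over (basis_words (length w))"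
        by (simp add: st w polys_over_smult[OF basis_words_closed])
    qed
    with eq show ?thesis by (rule polys_over_ec_eq)
  qed
qed

text \<open>
  The forms are replaced one after the other by combinations of the dual basis; the word \<open>w\<close> collects
  the roots that have been chosen.
\<close>

lemma wedge_span:
  "set w \<subseteq> pos_roots n \<Longrightarrow> set vs \<subseteq> carrier L1 \<Longrightarrow>
    ep w * fmon vs \<in> polys_over (basis_words (length w + length vs))"
proof (induction vs arbitrary: w)
  case Nil
  then show ?case using monomial_span by (simp add: fmon_Nil)
next
  case (Cons v vs)
  let ?e = "\<lambda>\<alpha>. fvar (e01 n q \<alpha>)"
  have "v \<in> carrier L1" using Cons.prems by simp
  then obtain a where a: "a \<in> carrier (Oq_plus n q)" "v = cls01 n q a" by (rule form_val_exists)
  let ?s = "\<Sum>\<alpha>\<in>pos_roots n. fconst (a (root n q \<alpha>)) * ?e \<alpha>"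
  have "ep w * fmon (v # vs) = ep w * (fvar v * fmon vs)" by (simp only: fmon_Cons[of v vs])
  also have "ec_eq \<dots> (ep w * (?s * fmon vs))"
    unfolding a(2) using Cons.prems by (intro ec_eq_mult ec_eq_refl ep_closed ec_eq_form a(1) falg_carrier_fmon) auto
  also have "ep w * (?s * fmon vs) = (\<Sum>\<alpha>\<in>pos_roots n. fconst (a (root n q \<alpha>)) * (ep (w @ [\<alpha>]) * fmon vs))"
    by (simp add: sum_distrib_left sum_distrib_right fmon_append mult.assoc fconst_mult_right)
  finally have eq: "ec_eq (ep w * fmon (v # vs)) (\<Sum>\<alpha>\<in>pos_roots n. fconst (a (root n q \<alpha>)) * (ep (w @ [\<alpha>]) * fmon vs))" .
  have "(\<Sum>\<alpha>\<in>pos_roots n. fconst (a (root n q \<alpha>)) * (ep (w @ [\<alpha>]) * fmon vs)) \<in> polys_over (basis_words (length w + length (v # vs)))"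
  proof (intro polys_over_sum polys_over_smult basis_words_closed)
    fix \<alpha> assume "\<alpha> \<in> pos_roots n"
    then show "ep (w @ [\<alpha>]) * fmon vs \<in> polys_over (basis_words (length w + length (v # vs)))"
      using Cons.IH[of "w @ [\<alpha>]"] Cons.prems by simp
  qed
  with eq show ?case by (rule polys_over_ec_eq)
qed

lemma forms_span: "set vs \<subseteq> carrier L1 \<Longrightarrow> wedge n q vs \<in> E.span (basis_words (length vs))"
  using wedge_span[of "[]" vs] by (simp add: fmon_Nil polys_over_def wedge_ec)

lemma all_words_span: "E.span (ew ` {w. increasing n w}) = carrier EA"
proof
  have cl: "ew ` {w. increasing n w} \<subseteq> carrier EA" using ew_closed by auto
  show "E.span (ew ` {w. increasing n w}) \<subseteq> carrier EA" by (rule E.span_is_subset2[OF cl])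
  show "carrier EA \<subseteq> E.span (ew ` {w. increasing n w})"
  proof
    fix y assume "y \<in> carrier EA"
    then obtain p where p: "p \<in> carrier FA" "y = ec p" by (rule ec_cases)
    from p(1) have "p \<in> polys_over (ew ` {w. increasing n w})"
    proof (induction rule: falg_induct)
      case (monom c vs)
      have "E.span (basis_words (length vs)) \<subseteq> E.span (ew ` {w. increasing n w})"
        by (intro E.span_is_monotone) (auto simp: basis_words_def)
      then have "fmon vs \<in> polys_over (ew ` {w. increasing n w})"
        using forms_span[OF monom] monom by (auto simp: polys_over_def wedge_ec falg_carrier_fmon)
      then show ?case by (rule polys_over_smult[OF cl])
    qed (use cl in \<open>auto intro: polys_over_zero polys_over_add\<close>)
    then show "y \<in> E.span (ew ` {w. increasing n w})" using p by (simp add: polys_over_def)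
  qed
qed

lemma ext_degree_span: "ext_degree n q k = EA\<lparr>carrier := E.span (basis_words k)\<rparr>"
proof -
  let ?W = "{wedge n q vs | vs. length vs = k \<and> set vs \<subseteq> carrier L1}"
  have W: "?W \<subseteq> carrier EA" by (auto simp: wedge_ec intro!: ec_closed falg_carrier_fmon)
  have "E.span ?W = E.span (basis_words k)"
  proof
    show "E.span ?W \<subseteq> E.span (basis_words k)"
      using forms_span by (intro E.span_is_subset submodule_span basis_words_closed) auto
    show "E.span (basis_words k) \<subseteq> E.span ?W"
    proof (rule E.span_is_monotone)
      have "ew w \<in> ?W" if "length w = k" "increasing n w" for w
        using that e01_word_closed[of w] by (intro CollectI exI[of _ "map (e01 n q) w"]) auto
      then show "basis_words k \<subseteq> ?W" unfolding basis_words_def by blast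
    qed
  qed
  then show ?thesis by (simp add: ext_degree_def)
qed

lemma card_basis_words: "card (basis_words k) = card (pos_roots n) choose k" "finite (basis_words k)"
proof -
  have inj: "inj_on ew {w. length w = k \<and> increasing n w}" using inj_ew by (rule inj_on_subset) auto
  show "card (basis_words k) = card (pos_roots n) choose k"
    unfolding basis_words_def card_image[OF inj] by (rule card_increasing_length)
  show "finite (basis_words k)"
    unfolding basis_words_def by (intro finite_imageI finite_subset[OF _ finite_increasing[of n]]) auto
qed

lemma ext_degree_basis:
  "vectorspace.basis class_ring (ext_degree n q k) (basis_words k) \<and>
   vectorspace.fin_dim class_ring (ext_degree n q k) \<and>
   vectorspace.dim class_ring (ext_degree n q k) = card (pos_roots n) choose k"
proof -
  have sub: "submodule (class_ring :: complex ring) (E.span (basis_words k)) EA"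
    by (rule submodule_span[OF basis_words_closed])
  have own: "basis_words k \<subseteq> E.span (basis_words k)" by (rule E.in_own_span[OF basis_words_closed])
  interpret V: vectorspace "class_ring :: complex ring" "ext_degree n q k"
    unfolding ext_degree_span vectorspace_def using E.submodule_is_module[OF sub] class_field by blast
  have "\<not> E.lin_dep (basis_words k)"
    by (rule E.subset_li_is_li[OF ew_independent]) (auto simp: basis_words_def)
  then have "V.basis (basis_words k)"
    unfolding V.basis_def using E.span_li_not_depend[OF own sub] own by (simp add: ext_degree_span)
  moreover from this have "V.fin_dim"
    unfolding V.fin_dim_def V.basis_def using card_basis_words(2) by blast
  ultimately show ?thesis using V.dim_basis[OF card_basis_words(2)] card_basis_words(1) by simp
qed

lemma ext_algebra_dim:
  "vectorspace.fin_dim class_ring EA \<and> vectorspace.dim class_ring EA = 2 ^ card (pos_roots n)"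
proof -
  interpret V: vectorspace "class_ring :: complex ring" EA by (rule E.vectorspace)
  have fin: "finite (ew ` {w. increasing n w})" using finite_increasing by simp
  have basis: "V.basis (ew ` {w. increasing n w})"
    unfolding V.basis_def using ew_independent all_words_span ew_closed by auto
  then have "V.fin_dim" unfolding V.fin_dim_def V.basis_def using fin by blast
  then show ?thesis using V.dim_basis[OF fin basis] card_image[OF inj_ew] card_increasing[of n] by simp
qed

end

theorem corollary3p11:
  fixes n :: nat and q :: real
  assumes "n \<ge> 1" and "q \<noteq> -1" and "q \<noteq> 0" and "q \<noteq> 1"
  shows "(\<forall>k\<in>{1..card (pos_roots n)}.
            vectorspace.basis class_ring (ext_degree n q k)
              {wedge n q (map (e01 n q) \<gamma>s) | \<gamma>s.
                 length \<gamma>s = k \<and> set \<gamma>s \<subseteq> pos_roots n \<and> sorted_wrt root_less \<gamma>s} \<and>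
            vectorspace.fin_dim class_ring (ext_degree n q k) \<and>
            vectorspace.dim class_ring (ext_degree n q k) = card (pos_roots n) choose k) \<and>
         vectorspace.fin_dim class_ring (ext_algebra n q) \<and>
         vectorspace.dim class_ring (ext_algebra n q) = 2 ^ card (pos_roots n)"
proof -
  interpret quantum_parameter n q using assms by unfold_locales
  have "{wedge n q (map (e01 n q) \<gamma>s) | \<gamma>s. length \<gamma>s = k \<and> set \<gamma>s \<subseteq> pos_roots n \<and> sorted_wrt root_less \<gamma>s} = basis_words k" for k
    unfolding basis_words_def by auto
  then show ?thesis using ext_degree_basis ext_algebra_dim by simp
qed

end
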